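(* Let $k$ be a field of characteristic zero and $m\geq 3$ an integer. Let $\mathcal{S}$ be the $m\times m$ generic symmetric matrix over $k$, let $\mathcal{SC}$ denote an $\mathcal{MD}$-cloning of $\mathcal{S}$, and let $f=\det(\mathcal{SC})$. Then $f$ is a factor of its Hessian determinant $h(f)$ with effective multiplicity equal to the expected multiplicity $\binom{m}{2}-2$.
   Context: The generic symmetric matrix $\mathcal{S}$ has $(i,j)$-entry $x_{\min(i,j),\max(i,j)}$, where $x_{i,j}$ ($1\leq i\leq j\leq m$) are indeterminates over $k$. An $\mathcal{MD}$-cloning of $\mathcal{S}$ (cloning along the main diagonal) is the matrix obtained by applying to the entries of $\mathcal{S}$ the $k$-algebra endomorphism that fixes all variables except one diagonal variable, which is mapped to another diagonal variable; up to simultaneous permutation of rows and columns, it is the matrix obtained from $\mathcal{S}$ by replacing $x_{m,m}$ with $x_{m-1,m-1}$. The determinant $f$ is regarded as a form in the polynomial ring $R$ over $k$ generated by the entries of $\mathcal{SC}$ (in $\binom{m+1}{2}-1$ variables). The Hessian determinant $h(f)$ is the determinant of the matrix of second partial derivatives of $f$ with respect to all variables of $R$. The effective multiplicity of $f$ as a factor of $h(f)$ is the largest integer $e$ such that $f^e$ divides $h(f)$ in $R$. The expected multiplicity (according to Segre) is defined as $\binom{m+1}{2}-2-\dim V(f)^*-1$, where $V(f)^*$ is the dual variety of the hypersurface $V(f)\subset\mathrm{Proj}(R)$ (the closure, in the dual projective space, of the set of hyperplanes tangent to $V(f)$ at smooth points); here it equals $\binom{m}{2}-2$. *)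

theory Defs
  imports
    "HOL-Library.Poly_Mapping"
    "Jordan_Normal_Form.Determinant"
    "HOL-Algebra.Algebraic_Closure_Type"
begin

section \<open>Multivariate polynomials\<close>

text \<open>A polynomial is a finitely supported map from monomials to coefficients, and a monomial is a
  finitely supported map from variables to exponents. The ring structure is that of
  \<^theory>\<open>HOL-Library.Poly_Mapping\<close> (convolution product).\<close>

type_synonym ('v, 'a) mpoly = "('v \<Rightarrow>\<^sub>0 nat) \<Rightarrow>\<^sub>0 'a"

definition Const :: "'a::zero \<Rightarrow> ('v, 'a) mpoly" where
  "Const c = Poly_Mapping.single 0 c"

definition Var :: "'v \<Rightarrow> ('v, 'a::zero_neq_one) mpoly" where
  "Var x = Poly_Mapping.single (Poly_Mapping.single x 1) 1"

definition polys_in :: "'v set \<Rightarrow> ('v, 'a::zero) mpoly set" where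
  "polys_in V = {p. \<forall>t \<in> Poly_Mapping.keys p. Poly_Mapping.keys t \<subseteq> V}"

text \<open>Apply the map \<open>\<phi>\<close> to the coefficients and substitute \<open>\<sigma> x\<close> for each variable \<open>x\<close>. For a ring
  homomorphism \<open>\<phi>\<close> this is the homomorphism extending \<open>\<phi>\<close> with \<open>x \<mapsto> \<sigma> x\<close>.\<close>

definition mp_subst ::
    "('a::zero \<Rightarrow> 'b::comm_semiring_1) \<Rightarrow> ('v \<Rightarrow> 'b) \<Rightarrow> ('v, 'a) mpoly \<Rightarrow> 'b" where
  "mp_subst \<phi> \<sigma> p = (\<Sum>t \<in> Poly_Mapping.keys p.
     \<phi> (Poly_Mapping.lookup p t) * (\<Prod>x \<in> Poly_Mapping.keys t. \<sigma> x ^ Poly_Mapping.lookup t x))"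

text \<open>In the terms below with \<open>lookup t x = 0\<close> the difference of monomials is truncated, but the
  coefficient is zero.\<close>

definition pderiv_in :: "'v \<Rightarrow> ('v, 'a::comm_semiring_1) mpoly \<Rightarrow> ('v, 'a) mpoly" where
  "pderiv_in x p = (\<Sum>t \<in> Poly_Mapping.keys p.
     Poly_Mapping.single (t - Poly_Mapping.single x 1)
       (of_nat (Poly_Mapping.lookup t x) * Poly_Mapping.lookup p t))"

definition homogeneous :: "('v, 'a::zero) mpoly \<Rightarrow> bool" where
  "homogeneous p \<longleftrightarrow> (\<exists>d. \<forall>t \<in> Poly_Mapping.keys p.
     (\<Sum>x \<in> Poly_Mapping.keys t. Poly_Mapping.lookup t x) = d)"

definition dvd_in :: "'v set \<Rightarrow> ('v, 'a::comm_semiring_1) mpoly \<Rightarrow> ('v, 'a) mpoly \<Rightarrow> bool" where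
  "dvd_in V p q \<longleftrightarrow> (\<exists>r \<in> polys_in V. q = p * r)"

section \<open>Hessian determinant and effective multiplicity\<close>

text \<open>The polynomial ring \<open>R\<close> is given by a list of its distinct variables; the Hessian determinant
  does not depend on their order.\<close>

definition hessian_mat :: "'v list \<Rightarrow> ('v, 'a::comm_ring_1) mpoly \<Rightarrow> ('v, 'a) mpoly mat" where
  "hessian_mat xs f = mat (length xs) (length xs)
     (\<lambda>(i, j). pderiv_in (xs ! i) (pderiv_in (xs ! j) f))"

definition hessian_det :: "'v list \<Rightarrow> ('v, 'a::comm_ring_1) mpoly \<Rightarrow> ('v, 'a) mpoly" where
  "hessian_det xs f = det (hessian_mat xs f)"

definition has_effective_multiplicity ::
    "'v list \<Rightarrow> ('v, 'a::comm_ring_1) mpoly \<Rightarrow> nat \<Rightarrow> bool" where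
  "has_effective_multiplicity xs f e \<longleftrightarrow>
     dvd_in (set xs) (f ^ e) (hessian_det xs f) \<and>
     (\<forall>e'. dvd_in (set xs) (f ^ e') (hessian_det xs f) \<longrightarrow> e' \<le> e)"

section \<open>Dual variety and expected multiplicity\<close>

text \<open>Varieties over \<open>k\<close> are represented by their geometric points, with coordinates in the algebraic
  closure of \<open>k\<close>. A point of projective space is represented by all of its nonzero vectors of
  homogeneous coordinates, so that a subset of projective space is a set of nonzero vectors closed
  under nonzero scaling. Coordinate vectors vanish outside \<open>V\<close>.\<close>

definition hom_coords :: "'v set \<Rightarrow> ('v \<Rightarrow> 'c::zero) set" where
  "hom_coords V = {p. (\<forall>x. x \<notin> V \<longrightarrow> p x = 0) \<and> (\<exists>x \<in> V. p x \<noteq> 0)}"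

definition smooth_points ::
    "'v set \<Rightarrow> ('v, 'k::field) mpoly \<Rightarrow> ('v \<Rightarrow> 'k alg_closure) set" where
  "smooth_points V f = {p \<in> hom_coords V. mp_subst to_ac p f = 0 \<and>
     (\<exists>x \<in> V. mp_subst to_ac p (pderiv_in x f) \<noteq> 0)}"

text \<open>The vector \<open>a\<close> represents the hyperplane \<open>(\<Sum>x\<in>V. a x * v x) = 0\<close>, which is tangent at the
  smooth point \<open>p\<close> iff \<open>a\<close> is proportional to the gradient at \<open>p\<close>.\<close>

definition tangent_hyperplanes ::
    "'v set \<Rightarrow> ('v, 'k::field) mpoly \<Rightarrow> ('v \<Rightarrow> 'k alg_closure) set" where
  "tangent_hyperplanes V f = {a \<in> hom_coords V. \<exists>p \<in> smooth_points V f. \<exists>c. c \<noteq> 0 \<and>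
     (\<forall>x \<in> V. a x = c * mp_subst to_ac p (pderiv_in x f))}"

definition proj_closure :: "'v set \<Rightarrow> ('v \<Rightarrow> 'c::field) set \<Rightarrow> ('v \<Rightarrow> 'c) set" where
  "proj_closure V A = {b \<in> hom_coords V. \<forall>F \<in> polys_in V. homogeneous F \<longrightarrow>
     (\<forall>a \<in> A. mp_subst id a F = 0) \<longrightarrow> mp_subst id b F = 0}"

definition dual_variety ::
    "'v set \<Rightarrow> ('v, 'k::field) mpoly \<Rightarrow> ('v \<Rightarrow> 'k alg_closure) set" where
  "dual_variety V f = proj_closure V (tangent_hyperplanes V f)"

definition vanishing_ideal :: "'v set \<Rightarrow> ('v \<Rightarrow> 'c::field) set \<Rightarrow> ('v, 'c) mpoly set" where
  "vanishing_ideal V Y = {F \<in> polys_in V. \<forall>a \<in> Y. mp_subst id a F = 0}"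

text \<open>\<open>F 0, \<dots>, F (d - 1)\<close> are algebraically independent in the homogeneous coordinate ring
  \<open>polys_in V / vanishing_ideal V Y\<close> of \<open>Y\<close>. (As \<open>Y\<close> is stable under scaling and the field is
  infinite, the vanishing ideal is homogeneous.)\<close>

definition alg_indep_on ::
    "'v set \<Rightarrow> ('v \<Rightarrow> 'c::field) set \<Rightarrow> nat \<Rightarrow> (nat \<Rightarrow> ('v, 'c) mpoly) \<Rightarrow> bool" where
  "alg_indep_on V Y d F \<longleftrightarrow> (\<forall>i < d. F i \<in> polys_in V) \<and>
     (\<forall>P :: (nat, 'c) mpoly. P \<in> polys_in {..<d} \<longrightarrow>
        mp_subst Const F P \<in> vanishing_ideal V Y \<longrightarrow> P = 0)"

text \<open>The dimension of a projective variety is one less than the transcendence degree of its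
  homogeneous coordinate ring. For nonempty \<open>Y\<close> the values of \<open>d\<close> below are bounded by the number of
  variables.\<close>

definition proj_dim :: "'v set \<Rightarrow> ('v \<Rightarrow> 'c::field) set \<Rightarrow> int" where
  "proj_dim V Y = (if Y = {} then -1
     else int (GREATEST d. \<exists>F. alg_indep_on V Y d F) - 1)"

text \<open>The dimension of \<open>Proj R\<close> minus that of the dual variety, minus one.\<close>

definition expected_multiplicity :: "'v list \<Rightarrow> ('v, 'k::field) mpoly \<Rightarrow> int" where
  "expected_multiplicity xs f =
     (int (length xs) - 1) - proj_dim (set xs) (dual_variety (set xs) f) - 1"

section \<open>Generic symmetric matrices and cloning along the main diagonal\<close>

text \<open>Rows and columns are numbered from \<open>0\<close> to \<open>m - 1\<close>.\<close>

definition gen_sym_mat :: "nat \<Rightarrow> (nat \<times> nat, 'k::comm_ring_1) mpoly mat" where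
  "gen_sym_mat m = mat m m (\<lambda>(i, j). Var (min i j, max i j))"

text \<open>The endomorphism fixing all variables but \<open>x\<^bsub>a,a\<^esub>\<close>, which is mapped to \<open>x\<^bsub>b,b\<^esub>\<close>.\<close>

definition md_endo :: "nat \<Rightarrow> nat \<Rightarrow>
    (nat \<times> nat, 'k::comm_ring_1) mpoly \<Rightarrow> (nat \<times> nat, 'k) mpoly" where
  "md_endo a b = mp_subst Const (\<lambda>x. Var (if x = (a, a) then (b, b) else x))"

definition md_clone :: "nat \<Rightarrow> nat \<Rightarrow> nat \<Rightarrow> (nat \<times> nat, 'k::comm_ring_1) mpoly mat" where
  "md_clone m a b = map_mat (md_endo a b) (gen_sym_mat m)"

text \<open>The variables that occur as entries of the cloned matrix.\<close>

definition md_vars :: "nat \<Rightarrow> nat \<Rightarrow> (nat \<times> nat) list" where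
  "md_vars m a = [(i, j). i \<leftarrow> [0..<m], j \<leftarrow> [i..<m], (i, j) \<noteq> (a, a)]"

end

theory Submission
  imports Defs
begin

text \<open>The Hessian of \<open>f\<close> can be computed in closed form: it equals
  \<open>c * f ^ ((m choose 2) - 2) * (x\<^bsub>bb\<^esub>\<^sup>2 - x\<^bsub>ab\<^esub>\<^sup>2)\<close> with a nonzero constant \<open>c\<close> (\<open>hessian_det_md_clone\<close>).

  At an invertible symmetric matrix \<open>S\<close> with inverse \<open>T\<close>, the second derivative of the determinant in
  the directions \<open>A\<close> and \<open>B\<close> is \<open>det S * (tr (T A) * tr (T B) - tr (T A T B))\<close>. On the space of all symmetric
  matrices, the Gram determinant of the form in parentheses is a constant times \<open>det S\<close> to the power
  \<open>- (m + 1)\<close>: after the substitution \<open>A \<mapsto> S A S\<close> only a rank one correction still depends on \<open>S\<close>, with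
  constant determinant (\<open>gdet_gram\<close>), and the substitution itself has determinant \<open>det S ^ (m + 1)\<close>
  (\<open>gdet_sym_square\<close>). Cloning restricts the form to the hyperplane of matrices with equal entries at
  \<open>(a, a)\<close> and \<open>(b, b)\<close>, which multiplies the Gram determinant by an entry of the inverse Gram matrix. That
  entry is the quadric above (\<open>gdet_clone_gram\<close>). Each of the \<open>(m choose 2) + m - 1\<close> variables contributes one
  factor \<open>det S\<close>, of which \<open>m + 1\<close> are used up. The remaining power of \<open>f\<close> cannot be raised, because on the
  multiples of the identity matrix \<open>f\<close> has degree \<open>m \<ge> 3\<close> and the quadric degree 2.

  For the expected multiplicity the dual variety must have dimension \<open>m - 1\<close>. The gradient of \<open>f\<close> is
  given by cofactors, and the cofactor matrix of a singular symmetric matrix is a multiple of \<open>v v\<^sup>T\<close>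
  (\<open>cofactor_matrix_of_singular\<close>). So the affine cone over the dual variety is the closure of a set
  parametrized by \<open>m\<close> coordinates, and its transcendence degree is at most \<open>m\<close> (\<open>algebraically_dependent\<close>).
  Conversely, nearly all vectors \<open>v\<close> occur (\<open>rank_one_tangent_hyperplane\<close>), and \<open>m\<close> of the coordinates of their
  images can be prescribed almost freely (\<open>alg_indep_dual\<close>).\<close>

section \<open>Evaluation and differentiation of polynomials\<close>

abbreviation "keys \<equiv> Poly_Mapping.keys"
abbreviation "lookup \<equiv> Poly_Mapping.lookup"

definition monomial_value :: "('v \<Rightarrow> 'b::comm_semiring_1) \<Rightarrow> ('v \<Rightarrow>\<^sub>0 nat) \<Rightarrow> 'b" where
  "monomial_value \<sigma> t = (\<Prod>x\<in>keys t. \<sigma> x ^ lookup t x)"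

lemma monomial_value_superset:
  assumes "finite V" "keys t \<subseteq> V"
  shows "monomial_value \<sigma> t = (\<Prod>x\<in>V. \<sigma> x ^ lookup t x)"
  unfolding monomial_value_def
  by (rule prod.mono_neutral_left) (use assms in \<open>auto simp: in_keys_iff\<close>)

lemma monomial_value_0 [simp]: "monomial_value \<sigma> 0 = 1"
  by (simp add: monomial_value_def)

lemma monomial_value_add:
  "monomial_value \<sigma> (s + t) = monomial_value \<sigma> s * monomial_value \<sigma> t"
proof -
  let ?V = "keys s \<union> keys t"
  have "monomial_value \<sigma> u = (\<Prod>x\<in>?V. \<sigma> x ^ lookup u x)" if "keys u \<subseteq> ?V" for u
    using that by (intro monomial_value_superset) auto
  thus ?thesis
    using Poly_Mapping.keys_add[of s t] by (simp add: lookup_add power_add prod.distrib)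
qed

text \<open>Sums over the keys of different polynomials become comparable once they are all extended to one
  common finite set.\<close>

lemma mp_subst_superset:
  assumes "finite T" "keys p \<subseteq> T" "\<phi> 0 = 0"
  shows "mp_subst \<phi> \<sigma> p = (\<Sum>t\<in>T. \<phi> (lookup p t) * monomial_value \<sigma> t)"
  unfolding mp_subst_def monomial_value_def[symmetric]
  by (rule sum.mono_neutral_left) (use assms in \<open>auto simp: in_keys_iff\<close>)

lemma sum_of_monomials: "p = (\<Sum>t\<in>keys p. Poly_Mapping.single t (lookup p t))"
  by (rule poly_mapping_eqI)
    (auto simp: lookup_sum lookup_single when_def in_keys_iff if_distrib cong: if_cong)

lemma mpoly_mult_expand:
  fixes p q :: "('v, 'a::comm_semiring_1) mpoly"
  shows "p * q = (\<Sum>s\<in>keys p. \<Sum>t\<in>keys q.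
    Poly_Mapping.single (s + t) (lookup p s * lookup q t))"
proof -
  have "p * q = (\<Sum>s\<in>keys p. Poly_Mapping.single s (lookup p s)) *
      (\<Sum>t\<in>keys q. Poly_Mapping.single t (lookup q t))"
    using sum_of_monomials[of p] sum_of_monomials[of q] by simp
  thus ?thesis by (simp add: sum_product mult_single)
qed

lemma mp_subst_eq:
  "mp_subst \<phi> \<sigma> p = (\<Sum>t\<in>keys p. \<phi> (lookup p t) * monomial_value \<sigma> t)"
  by (simp add: mp_subst_def monomial_value_def)

lemma mp_subst_single:
  "\<phi> 0 = 0 \<Longrightarrow> mp_subst \<phi> \<sigma> (Poly_Mapping.single t c) = \<phi> c * monomial_value \<sigma> t"
  by (subst mp_subst_superset[of "{t}"]) auto

text \<open>The universal property of the polynomial ring. Evaluation at a point, substitution of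
  polynomials and specialization to a univariate ring are all instances, so that determinants,
  cofactors and Hessians may be computed after any of them.\<close>

lemma comm_ring_hom_mp_subst:
  fixes \<phi> :: "'a::comm_ring_1 \<Rightarrow> 'b::comm_ring_1"
  assumes "comm_ring_hom \<phi>"
  shows "comm_ring_hom (mp_subst \<phi> \<sigma>)"
proof -
  interpret comm_ring_hom \<phi> by fact
  have add: "mp_subst \<phi> \<sigma> (p + q) = mp_subst \<phi> \<sigma> p + mp_subst \<phi> \<sigma> q" for p q
  proof -
    let ?T = "keys p \<union> keys q"
    have "mp_subst \<phi> \<sigma> r = (\<Sum>t\<in>?T. \<phi> (lookup r t) * monomial_value \<sigma> t)" if "keys r \<subseteq> ?T" for r
      using that by (intro mp_subst_superset) auto
    thus ?thesis using Poly_Mapping.keys_add[of p q]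
      by (simp add: lookup_add hom_add distrib_right sum.distrib)
  qed
  have zero: "mp_subst \<phi> \<sigma> 0 = 0" by (simp add: mp_subst_def)
  have sum: "mp_subst \<phi> \<sigma> (sum g A) = (\<Sum>a\<in>A. mp_subst \<phi> \<sigma> (g a))" for g :: "'x \<Rightarrow> _" and A
    by (induction A rule: infinite_finite_induct) (simp_all add: add zero)
  have mult: "mp_subst \<phi> \<sigma> (p * q) = mp_subst \<phi> \<sigma> p * mp_subst \<phi> \<sigma> q" for p q
  proof -
    have "mp_subst \<phi> \<sigma> (p * q) = (\<Sum>s\<in>keys p. \<Sum>t\<in>keys q.
        (\<phi> (lookup p s) * monomial_value \<sigma> s) * (\<phi> (lookup q t) * monomial_value \<sigma> t))"
      by (subst mpoly_mult_expand) (simp add: sum mp_subst_single hom_mult monomial_value_add mult_ac)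
    thus ?thesis
      by (simp only: mp_subst_eq sum_product)
  qed
  have "mp_subst \<phi> \<sigma> 1 = 1"
    using mp_subst_single[of \<phi> \<sigma> 0 1] by (simp add: hom_one)
  thus ?thesis by unfold_locales (simp_all add: add zero mult)
qed

lemma mp_subst_Const: "\<phi> 0 = 0 \<Longrightarrow> mp_subst \<phi> \<sigma> (Const c) = \<phi> c"
  by (simp add: Const_def mp_subst_single)

lemma mp_subst_Var: "\<phi> 0 = 0 \<Longrightarrow> \<phi> 1 = 1 \<Longrightarrow> mp_subst \<phi> \<sigma> (Var x) = \<sigma> x"
  by (simp add: Var_def mp_subst_single monomial_value_def)

lemma comm_ring_hom_id: "comm_ring_hom (id :: 'a::comm_ring_1 \<Rightarrow> 'a)"
  by unfold_locales auto

lemma comm_ring_hom_Const: "comm_ring_hom (Const :: 'a::comm_ring_1 \<Rightarrow> ('v, 'a) mpoly)"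
  by unfold_locales (auto simp: Const_def single_add mult_single)

lemma comm_ring_hom_to_ac: "comm_ring_hom to_ac"
  by unfold_locales auto

lemma mp_subst_comp:
  fixes \<phi> :: "'a::comm_ring_1 \<Rightarrow> 'b::comm_ring_1" and h :: "'b \<Rightarrow> 'c::comm_ring_1"
  assumes "comm_ring_hom h"
  shows "h (mp_subst \<phi> \<sigma> p) = mp_subst (\<lambda>c. h (\<phi> c)) (\<lambda>x. h (\<sigma> x)) p"
proof -
  interpret comm_ring_hom h by fact
  show ?thesis by (simp add: mp_subst_def hom_distribs)
qed

lemma mp_subst_cong:
  assumes "p \<in> polys_in V" "\<And>x. x \<in> V \<Longrightarrow> \<sigma> x = \<tau> x"
  shows "mp_subst \<phi> \<sigma> p = mp_subst \<phi> \<tau> p"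
  unfolding mp_subst_def using assms
  by (intro sum.cong arg_cong2[where f = "(*)"] prod.cong) (auto simp: polys_in_def subset_iff)

text \<open>Only additivity and the product rule enter the differentiation of determinants, so it is done
  for derivations of a commutative ring.\<close>

locale derivation =
  fixes \<delta> :: "'r::comm_ring_1 \<Rightarrow> 'r"
  assumes add: "\<delta> (p + q) = \<delta> p + \<delta> q"
    and mult: "\<delta> (p * q) = \<delta> p * q + p * \<delta> q"
begin

lemma zero [simp]: "\<delta> 0 = 0"
  using add[of 0 0] by simp

lemma one [simp]: "\<delta> 1 = 0"
  using mult[of 1 1] by simp

lemma sum: "\<delta> (sum g A) = (\<Sum>a\<in>A. \<delta> (g a))"
  by (induction A rule: infinite_finite_induct) (simp_all add: add)

lemma uminus: "\<delta> (- p) = - \<delta> p"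
  using add[of p "- p"] by (simp add: eq_neg_iff_add_eq_0 add.commute)

lemma prod:
  "finite A \<Longrightarrow> \<delta> (prod g A) = (\<Sum>a\<in>A. \<Prod>b\<in>A. if b = a then \<delta> (g b) else g b)"
proof (induction A rule: finite_induct)
  case (insert x A)
  have "(\<Prod>b\<in>A. if b = x then \<delta> (g b) else g b) = prod g A"
    by (rule prod.cong) (use insert.hyps in auto)
  moreover have "(\<Sum>a\<in>A. \<Prod>b\<in>insert x A. if b = a then \<delta> (g b) else g b)
      = (\<Sum>a\<in>A. g x * (\<Prod>b\<in>A. if b = a then \<delta> (g b) else g b))"
    by (rule sum.cong) (use insert.hyps in auto)
  ultimately show ?case
    using insert by (simp add: mult sum_distrib_left)
qed simp

end

lemma pderiv_in_superset:
  assumes "finite T" "keys p \<subseteq> T"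
  shows "pderiv_in x p = (\<Sum>t\<in>T. Poly_Mapping.single (t - Poly_Mapping.single x 1)
       (of_nat (lookup t x) * lookup p t))"
  unfolding pderiv_in_def
  by (rule sum.mono_neutral_left) (use assms in \<open>auto simp: in_keys_iff\<close>)

lemma pderiv_in_single:
  "pderiv_in x (Poly_Mapping.single t c) =
    Poly_Mapping.single (t - Poly_Mapping.single x 1) (of_nat (lookup t x) * c)"
  by (subst pderiv_in_superset[of "{t}"]) auto

lemma pderiv_in_Var:
  "pderiv_in x (Var y :: ('v, 'a::comm_ring_1) mpoly) = (if x = y then 1 else 0)"
  by (auto simp: Var_def pderiv_in_single lookup_single when_def)

text \<open>Both sides of the product rule are bilinear, so monomials suffice. The truncated difference of
  exponent vectors is harmless: it is wrong only where the coefficient vanishes.\<close>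

lemma derivation_pderiv_in:
  "derivation (pderiv_in x :: ('v, 'a::comm_ring_1) mpoly \<Rightarrow> _)"
proof -
  let ?\<delta> = "pderiv_in x :: ('v, 'a) mpoly \<Rightarrow> _"
  let ?e = "Poly_Mapping.single x (1::nat)"
  have add: "?\<delta> (p + q) = ?\<delta> p + ?\<delta> q" for p q
  proof -
    let ?T = "keys p \<union> keys q"
    have "?\<delta> r = (\<Sum>t\<in>?T. Poly_Mapping.single (t - ?e) (of_nat (lookup t x) * lookup r t))"
      if "keys r \<subseteq> ?T" for r
      using that by (intro pderiv_in_superset) auto
    thus ?thesis using Poly_Mapping.keys_add[of p q]
      by (simp add: lookup_add distrib_left sum.distrib single_add)
  qed
  have "?\<delta> 0 = 0" by (simp add: pderiv_in_def del: One_nat_def)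
  hence sum: "?\<delta> (sum g A) = (\<Sum>a\<in>A. ?\<delta> (g a))" for g :: "'x \<Rightarrow> _" and A
    by (induction A rule: infinite_finite_induct) (simp_all add: add)
  have cancel: "s + t - ?e = (s - ?e) + t" if "lookup s x \<noteq> 0" for s t :: "'v \<Rightarrow>\<^sub>0 nat"
    by (rule poly_mapping_eqI) (use that in \<open>auto simp: lookup_add lookup_minus lookup_single when_def\<close>)
  have mono: "?\<delta> (Poly_Mapping.single (s + t) (c * d)) =
      Poly_Mapping.single (s - ?e) (of_nat (lookup s x) * c) * Poly_Mapping.single t d
    + Poly_Mapping.single s c * Poly_Mapping.single (t - ?e) (of_nat (lookup t x) * d)" for s t c d
  proof -
    have "Poly_Mapping.single (s + t - ?e) (of_nat (lookup s x) * c * d)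
        = Poly_Mapping.single ((s - ?e) + t) (of_nat (lookup s x) * c * d)"
      by (cases "lookup s x = 0") (auto simp: cancel simp del: One_nat_def)
    moreover have "Poly_Mapping.single (s + t - ?e) (of_nat (lookup t x) * c * d)
        = Poly_Mapping.single (s + (t - ?e)) (of_nat (lookup t x) * c * d)"
      using cancel[of t s] by (cases "lookup t x = 0") (auto simp: add.commute simp del: One_nat_def)
    ultimately show ?thesis
      by (simp add: pderiv_in_single mult_single lookup_add distrib_left distrib_right single_add
        mult_ac add_ac del: One_nat_def)
  qed
  have "?\<delta> (p * q) = ?\<delta> p * q + p * ?\<delta> q" for p q
  proof -
    have "?\<delta> (p * q) = (\<Sum>s\<in>keys p. \<Sum>t\<in>keys q.
        Poly_Mapping.single (s - ?e) (of_nat (lookup s x) * lookup p s) * Poly_Mapping.single t (lookup q t)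
      + Poly_Mapping.single s (lookup p s) * Poly_Mapping.single (t - ?e) (of_nat (lookup t x) * lookup q t))"
      by (subst mpoly_mult_expand) (simp add: sum mono del: One_nat_def)
    also have "\<dots> = ?\<delta> p * q + p * ?\<delta> q"
    proof -
      have "?\<delta> p * q = (\<Sum>s\<in>keys p. Poly_Mapping.single (s - ?e) (of_nat (lookup s x) * lookup p s)) *
          (\<Sum>t\<in>keys q. Poly_Mapping.single t (lookup q t))"
        using sum_of_monomials[of q] by (simp add: pderiv_in_def del: One_nat_def)
      moreover have "p * ?\<delta> q = (\<Sum>s\<in>keys p. Poly_Mapping.single s (lookup p s)) *
          (\<Sum>t\<in>keys q. Poly_Mapping.single (t - ?e) (of_nat (lookup t x) * lookup q t))"
        using sum_of_monomials[of p] by (simp add: pderiv_in_def del: One_nat_def)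
      ultimately show ?thesis by (simp add: sum_product sum.distrib del: One_nat_def)
    qed
    finally show ?thesis .
  qed
  thus ?thesis by unfold_locales (simp_all add: add)
qed

section \<open>Polynomials in a given set of variables\<close>

lemma polys_in_0 [simp]: "0 \<in> polys_in V"
  by (simp add: polys_in_def)

lemma polys_in_Const [simp]: "Const c \<in> polys_in V"
  by (auto simp: polys_in_def Const_def split: if_splits)

lemma polys_in_1 [simp]: "1 \<in> polys_in V"
  by (auto simp: polys_in_def split: if_splits)

lemma polys_in_Var: "x \<in> V \<Longrightarrow> Var x \<in> polys_in V"
  by (auto simp: polys_in_def Var_def split: if_splits)

lemma polys_in_add: "p \<in> polys_in V \<Longrightarrow> q \<in> polys_in V \<Longrightarrow> p + q \<in> polys_in V"
  using Poly_Mapping.keys_add[of p q] unfolding polys_in_def by blast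

lemma polys_in_uminus: "p \<in> polys_in V \<Longrightarrow> - p \<in> polys_in V"
  for p :: "('v, 'a::comm_ring_1) mpoly"
  by (auto simp: polys_in_def in_keys_iff)

lemma polys_in_diff: "p \<in> polys_in V \<Longrightarrow> q \<in> polys_in V \<Longrightarrow> p - q \<in> polys_in V"
  for p :: "('v, 'a::comm_ring_1) mpoly"
  using polys_in_add[of p V "- q"] polys_in_uminus[of q V] by simp

lemma polys_in_mult: "p \<in> polys_in V \<Longrightarrow> q \<in> polys_in V \<Longrightarrow> p * q \<in> polys_in V"
  for p :: "('v, 'a::comm_ring_1) mpoly"
proof -
  assume *: "p \<in> polys_in V" "q \<in> polys_in V"
  show ?thesis unfolding polys_in_def
  proof clarify
    fix t x assume "t \<in> keys (p * q)" "x \<in> keys t"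
    then obtain r s where "r \<in> keys p" "s \<in> keys q" "t = r + s"
      using Poly_Mapping.keys_mult[of p q] by blast
    thus "x \<in> V" using * \<open>x \<in> keys t\<close> Poly_Mapping.keys_add[of r s]
      unfolding polys_in_def by blast
  qed
qed

lemma polys_in_power: "p \<in> polys_in V \<Longrightarrow> p ^ n \<in> polys_in V"
  for p :: "('v, 'a::comm_ring_1) mpoly"
  by (induction n) (auto intro: polys_in_mult)

lemma polys_in_sum: "(\<And>i. i \<in> A \<Longrightarrow> g i \<in> polys_in V) \<Longrightarrow> sum g A \<in> polys_in V"
  for g :: "'i \<Rightarrow> ('v, 'a::comm_ring_1) mpoly"
  by (induction A rule: infinite_finite_induct) (auto intro: polys_in_add)

lemma polys_in_prod: "(\<And>i. i \<in> A \<Longrightarrow> g i \<in> polys_in V) \<Longrightarrow> prod g A \<in> polys_in V"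
  for g :: "'i \<Rightarrow> ('v, 'a::comm_ring_1) mpoly"
  by (induction A rule: infinite_finite_induct) (auto intro: polys_in_mult)

lemma polys_in_det:
  fixes A :: "('v, 'a::comm_ring_1) mpoly mat"
  assumes "A \<in> carrier_mat n n" "\<And>i j. i < n \<Longrightarrow> j < n \<Longrightarrow> A $$ (i, j) \<in> polys_in V"
  shows "det A \<in> polys_in V"
proof -
  have "signof p * (\<Prod>i = 0..<n. A $$ (i, p i)) \<in> polys_in V" if "p permutes {0..<n}" for p
  proof -
    have "(\<Prod>i = 0..<n. A $$ (i, p i)) \<in> polys_in V"
      using permutes_in_image[OF that] by (intro polys_in_prod assms) auto
    thus ?thesis by (auto simp: sign_def intro: polys_in_uminus)
  qed
  thus ?thesis unfolding det_def'[OF assms(1)] by (intro polys_in_sum) auto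
qed

section \<open>Points where given polynomials do not vanish\<close>

lemma base_digit_unique:
  fixes a b c d W :: nat
  assumes "a * W + b = c * W + d" "b < W" "d < W"
  shows "a = c"
proof -
  have "(a * W + b) div W = a" "(c * W + d) div W = c"
    using assms(2,3) by simp_all
  thus ?thesis using assms(1) by metis
qed
text \<open>Kronecker's substitution: if each weight exceeds all weighted sums that the earlier variables
  can produce, the exponents are the digits of the weighted sum and can be read off from it.\<close>

lemma exists_separating_weights:
  fixes T :: "('v \<Rightarrow>\<^sub>0 nat) set"
  assumes "finite T" "finite V"
  shows "\<exists>w :: 'v \<Rightarrow> nat. \<forall>s\<in>T. \<forall>t\<in>T.
    (\<Sum>x\<in>V. lookup s x * w x) = (\<Sum>x\<in>V. lookup t x * w x) \<longrightarrow> (\<forall>x\<in>V. lookup s x = lookup t x)"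
  using assms(2)
proof (induction V rule: finite_induct)
  case (insert y V)
  from insert.IH obtain w where w: "\<forall>s\<in>T. \<forall>t\<in>T.
      (\<Sum>x\<in>V. lookup s x * w x) = (\<Sum>x\<in>V. lookup t x * w x) \<longrightarrow> (\<forall>x\<in>V. lookup s x = lookup t x)"
    by (elim exE)
  let ?S = "\<lambda>s. \<Sum>x\<in>V. lookup s x * w x"
  define W where "W = Suc (\<Sum>s\<in>T. ?S s)"
  have W: "?S s < W" if "s \<in> T" for s
    unfolding W_def less_Suc_eq_le by (rule member_le_sum[OF that _ assms(1)]) simp
  let ?w = "w(y := W)"
  have *: "(\<Sum>x\<in>insert y V. lookup s x * ?w x) = lookup s y * W + ?S s" for s
  proof -
    have "(\<Sum>x\<in>V. lookup s x * ?w x) = ?S s"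
      by (rule sum.cong) (use insert.hyps in auto)
    thus ?thesis using insert.hyps by simp
  qed
  have step: "\<forall>x\<in>insert y V. lookup s x = lookup t x"
    if "s \<in> T" "t \<in> T" "lookup s y * W + ?S s = lookup t y * W + ?S t" for s t
  proof -
    have "lookup s y = lookup t y"
      by (rule base_digit_unique[OF that(3) W[OF that(1)] W[OF that(2)]])
    moreover from this have "?S s = ?S t" using that(3) by simp
    with w that(1,2) have "\<forall>x\<in>V. lookup s x = lookup t x" by blast
    ultimately show ?thesis by blast
  qed
  hence "\<forall>s\<in>T. \<forall>t\<in>T. (\<Sum>x\<in>insert y V. lookup s x * ?w x) = (\<Sum>x\<in>insert y V. lookup t x * ?w x)
      \<longrightarrow> (\<forall>x\<in>insert y V. lookup s x = lookup t x)"
    unfolding * by (intro ballI[of T] impI) (rule step)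
  thus ?case by (rule exI[of _ ?w])
qed simp

text \<open>Substituting \<open>x \<mapsto> z ^ w x\<close> with separating weights \<open>w\<close> turns nonzero polynomials into nonzero
  univariate ones, whose product has a nonroot \<open>z \<noteq> 0\<close>. Treating a finite family at once serves two
  purposes: polynomial identities need to be checked only where a given polynomial does not vanish,
  and the coordinates of the point can be kept away from zero.\<close>

lemma finite_family_generic_point:
  fixes P :: "('v, 'a::field) mpoly set"
  assumes inf: "infinite (UNIV :: 'a set)" and "finite P" "0 \<notin> P"
  shows "\<exists>c. (\<forall>x. c x \<noteq> 0) \<and> (\<forall>p\<in>P. mp_subst id c p \<noteq> 0)"
proof -
  define T where "T = (\<Union>p\<in>P. keys p)"
  define V where "V = (\<Union>t\<in>T. keys t)"
  have fin: "finite T" "finite V" using assms(2) by (auto simp: T_def V_def)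
  obtain w :: "'v \<Rightarrow> nat" where w: "\<And>s t. s \<in> T \<Longrightarrow> t \<in> T \<Longrightarrow>
      (\<Sum>x\<in>V. lookup s x * w x) = (\<Sum>x\<in>V. lookup t x * w x) \<Longrightarrow> (\<forall>x\<in>V. lookup s x = lookup t x)"
    using exists_separating_weights[OF fin] by metis
  define wt where "wt t = (\<Sum>x\<in>V. lookup t x * w x)" for t :: "'v \<Rightarrow>\<^sub>0 nat"
  have inj: "s = t" if "s \<in> T" "t \<in> T" "wt s = wt t" for s t
  proof (rule poly_mapping_eqI)
    fix x show "lookup s x = lookup t x"
      using w[OF that(1,2)] that unfolding wt_def V_def by (cases "x \<in> V") (auto simp: V_def in_keys_iff)
  qed
  define q where "q p = (\<Sum>t\<in>keys p. Polynomial.monom (lookup p t) (wt t))" for p :: "('v, 'a) mpoly"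
  have q_eval: "mp_subst id (\<lambda>x. z ^ w x) p = poly (q p) z" if "p \<in> P" for p z
  proof -
    have "monomial_value (\<lambda>x. z ^ w x) t = z ^ wt t" if "t \<in> keys p" for t
      using that \<open>p \<in> P\<close> fin
      by (subst monomial_value_superset[of V])
        (auto simp: V_def T_def wt_def power_sum power_mult[symmetric] mult.commute)
    thus ?thesis
      by (simp add: mp_subst_eq q_def poly_sum poly_monom)
  qed
  have q_nz: "q p \<noteq> 0" if "p \<in> P" for p
  proof -
    have "p \<noteq> 0" using that assms(3) by auto
    then obtain t where t: "t \<in> keys p"
      by (metis all_not_in_conv keys_eq_empty)
    have "Polynomial.coeff (q p) (wt t) = (\<Sum>s\<in>keys p. if s = t then lookup p s else 0)"
      unfolding q_def coeff_sum using inj t that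
      by (intro sum.cong) (auto simp: T_def)
    hence "Polynomial.coeff (q p) (wt t) \<noteq> 0" using t by (simp add: in_keys_iff)
    thus ?thesis by auto
  qed
  \<comment> \<open>The factor \<open>[:0, 1:]\<close> forces the chosen nonroot, and with it all coordinates, to be nonzero.\<close>
  define Q where "Q = [:0, 1:] * (\<Prod>p\<in>P. q p)"
  have "Q \<noteq> 0" unfolding Q_def using q_nz assms(2) by auto
  then obtain z where z: "poly Q z \<noteq> 0"
    using inf poly_roots_finite[of Q] by (metis (mono_tags, lifting) ex_new_if_finite mem_Collect_eq)
  show ?thesis
    by (rule exI[of _ "\<lambda>x. z ^ w x"]) (use z assms(2) in \<open>auto simp: Q_def poly_prod q_eval\<close>)
qed

section \<open>Determinants indexed by a list\<close>

text \<open>Rows and columns are labelled by variables, that is by pairs of indices. Keeping the labels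
  instead of their positions makes matrix products into sums over a set and lets triangularity be
  stated without choosing an order.\<close>

definition gdet :: "'i list \<Rightarrow> ('i \<Rightarrow> 'i \<Rightarrow> 'a::comm_ring_1) \<Rightarrow> 'a" where
  "gdet xs F = det (mat (length xs) (length xs) (\<lambda>(i, j). F (xs ! i) (xs ! j)))"

lemma gdet_cong:
  "(\<And>x y. x \<in> set xs \<Longrightarrow> y \<in> set xs \<Longrightarrow> F x y = G x y) \<Longrightarrow> gdet xs F = gdet xs G"
  unfolding gdet_def by (intro arg_cong[of _ _ det] eq_matI) auto

lemma sum_set_nth:
  "distinct xs \<Longrightarrow> (\<Sum>z\<in>set xs. g z) = (\<Sum>k = 0..<length xs. g (xs ! k))"
  by (subst sum.reindex_bij_betw[OF bij_betw_nth[of xs "{0..<length xs}" "set xs"], symmetric])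
    (auto simp: lessThan_atLeast0)

lemma prod_set_nth:
  "distinct xs \<Longrightarrow> (\<Prod>z\<in>set xs. g z) = (\<Prod>k = 0..<length xs. g (xs ! k))"
  by (subst prod.reindex_bij_betw[OF bij_betw_nth[of xs "{0..<length xs}" "set xs"], symmetric])
    (auto simp: lessThan_atLeast0)

lemma gdet_mult:
  assumes "distinct xs"
  shows "gdet xs (\<lambda>x y. \<Sum>z\<in>set xs. F x z * G z y) = gdet xs F * gdet xs G"
proof -
  let ?n = "length xs"
  let ?M = "\<lambda>F. mat ?n ?n (\<lambda>(i, j). F (xs ! i) (xs ! j))"
  have "?M F * ?M G = ?M (\<lambda>x y. \<Sum>z\<in>set xs. F x z * G z y)"
    by (rule eq_matI) (auto simp: scalar_prod_def sum_set_nth[OF assms])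
  moreover have "det (?M F * ?M G) = det (?M F) * det (?M G)"
    by (rule det_mult[of _ ?n]) auto
  ultimately show ?thesis by (simp add: gdet_def)
qed

lemma gdet_transpose: "gdet xs (\<lambda>x y. F y x) = gdet xs F"
proof -
  let ?n = "length xs"
  let ?M = "\<lambda>F. mat ?n ?n (\<lambda>(i, j). F (xs ! i) (xs ! j))"
  have "transpose_mat (?M F) = ?M (\<lambda>x y. F y x)" by (rule eq_matI) auto
  moreover have "det (transpose_mat (?M F)) = det (?M F)" by (rule det_transpose[of _ ?n]) auto
  ultimately show ?thesis by (simp add: gdet_def)
qed

lemma gdet_scale: "gdet xs (\<lambda>x y. c * F x y) = c ^ length xs * gdet xs F"
proof -
  let ?n = "length xs"
  let ?M = "\<lambda>F. mat ?n ?n (\<lambda>(i, j). F (xs ! i) (xs ! j))"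
  have "c \<cdot>\<^sub>m ?M F = ?M (\<lambda>x y. c * F x y)" by (rule eq_matI) auto
  thus ?thesis using det_smult[of c "?M F"] by (simp add: gdet_def)
qed

lemma gdet_hom:
  assumes "comm_ring_hom h"
  shows "h (gdet xs F) = gdet xs (\<lambda>x y. h (F x y))"
proof -
  interpret comm_ring_hom h by fact
  show ?thesis unfolding gdet_def hom_det[symmetric]
    by (intro arg_cong[of _ _ det] eq_matI) auto
qed

text \<open>In the Leibniz formula a nonzero term belongs to a permutation that does not lower the rank
  anywhere; since a permutation preserves the sum of all ranks, it preserves each rank and hence is
  the identity.\<close>

lemma gdet_ranked_triangular:
  fixes F :: "'i \<Rightarrow> 'i \<Rightarrow> 'a::idom" and r :: "'i \<Rightarrow> nat"
  assumes "distinct xs"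
    and "\<And>x y. x \<in> set xs \<Longrightarrow> y \<in> set xs \<Longrightarrow> x \<noteq> y \<Longrightarrow> r y \<le> r x \<Longrightarrow> F x y = 0"
  shows "gdet xs F = (\<Prod>x\<in>set xs. F x x)"
proof -
  let ?n = "length xs"
  let ?M = "mat ?n ?n (\<lambda>(i, j). F (xs ! i) (xs ! j))"
  let ?t = "\<lambda>p. signof p * (\<Prod>i = 0..<?n. ?M $$ (i, p i)) :: 'a"
  have vanish: "?t p = 0" if p: "p permutes {0..<?n}" and "p \<noteq> id" for p
  proof (rule ccontr)
    assume "?t p \<noteq> 0"
    hence nz: "?M $$ (i, p i) \<noteq> 0" if "i < ?n" for i
      using that by auto
    have pn: "p i < ?n" if "i < ?n" for i
      using permutes_in_image[OF p, of i] that by auto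
    have le: "r (xs ! i) \<le> r (xs ! p i)" and lt: "p i \<noteq> i \<Longrightarrow> r (xs ! i) < r (xs ! p i)"
      if "i < ?n" for i
    proof -
      show "r (xs ! i) < r (xs ! p i)" if "p i \<noteq> i"
      proof (rule ccontr)
        assume "\<not> ?thesis"
        hence "F (xs ! i) (xs ! p i) = 0"
          using \<open>i < ?n\<close> pn[OF \<open>i < ?n\<close>] that assms(1)
          by (intro assms(2)) (auto simp: nth_eq_iff_index_eq)
        thus False using nz[OF \<open>i < ?n\<close>] pn[OF \<open>i < ?n\<close>] \<open>i < ?n\<close> by simp
      qed
      thus "r (xs ! i) \<le> r (xs ! p i)" by (cases "p i = i") auto
    qed
    obtain i where "p i \<noteq> i" using \<open>p \<noteq> id\<close> by (auto simp: fun_eq_iff)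
    hence i: "i < ?n" using p by (meson atLeastLessThan_iff permutes_not_in zero_le)
    have "(\<Sum>i = 0..<?n. r (xs ! i)) < (\<Sum>i = 0..<?n. r (xs ! p i))"
      using i le lt[OF i \<open>p i \<noteq> i\<close>] by (intro sum_strict_mono_ex1) auto
    also have "\<dots> = (\<Sum>i = 0..<?n. r (xs ! i))"
      using sum.permute[OF p, of "\<lambda>i. r (xs ! i)"] by (simp add: o_def)
    finally show False by simp
  qed
  have "gdet xs F = (\<Sum>p\<in>{p. p permutes {0..<?n}}. ?t p)"
    unfolding gdet_def by (rule det_def') simp
  also have "\<dots> = (\<Sum>p\<in>{id}. ?t p)"
    by (rule sum.mono_neutral_right) (use vanish in \<open>auto simp: finite_permutations permutes_id\<close>)
  also have "\<dots> = (\<Prod>x\<in>set xs. F x x)"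
    by (simp add: prod_set_nth[OF assms(1)])
  finally show ?thesis .
qed

lemma gdet_Cons_row:
  assumes "\<And>y. y \<in> set xs \<Longrightarrow> F z y = 0"
  shows "gdet (z # xs) F = F z z * gdet xs F"
proof -
  let ?n = "length xs"
  let ?M = "mat (Suc ?n) (Suc ?n) (\<lambda>(i, j). F ((z # xs) ! i) ((z # xs) ! j))"
  have "det ?M = (\<Sum>j<Suc ?n. ?M $$ (0, j) * cofactor ?M 0 j)"
    by (rule laplace_expansion_row) auto
  also have "\<dots> = ?M $$ (0, 0) * cofactor ?M 0 0 + (\<Sum>j<?n. ?M $$ (0, Suc j) * cofactor ?M 0 (Suc j))"
    by (rule sum.lessThan_Suc_shift)
  also have "(\<Sum>j<?n. ?M $$ (0, Suc j) * cofactor ?M 0 (Suc j)) = 0"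
    by (rule sum.neutral) (auto simp: assms)
  also have "cofactor ?M 0 0 = gdet xs F"
    unfolding cofactor_def gdet_def
    by (auto simp: mat_delete_def intro!: arg_cong[of _ _ det] eq_matI)
  finally show ?thesis by (simp add: gdet_def)
qed

lemma gdet_Cons_col:
  assumes "\<And>y. y \<in> set xs \<Longrightarrow> F y z = 0"
  shows "gdet (z # xs) F = F z z * gdet xs F"
  using gdet_Cons_row[of xs "\<lambda>x y. F y x" z] assms by (simp add: gdet_transpose[of _ F])

lemma gdet_map: "gdet (map g xs) F = gdet xs (\<lambda>x y. F (g x) (g y))"
  unfolding gdet_def by (intro arg_cong[of _ _ det] eq_matI) auto

lemma gdet_diagonal:
  fixes d :: "'i \<Rightarrow> 'a::idom"
  assumes "distinct xs"
  shows "gdet xs (\<lambda>x y. if x = y then d x else 0) = (\<Prod>x\<in>set xs. d x)"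
  using gdet_ranked_triangular[OF assms, of "\<lambda>_. 0" "\<lambda>x y. if x = y then d x else 0"] by simp

text \<open>The matrix determinant lemma. The label \<open>None\<close> provides a border: the bordered matrix with rows
  \<open>(1, - v)\<close> and \<open>(u, I)\<close> is reduced to \<open>I + u v\<^sup>T\<close> by clearing the first column and to
  \<open>1 + v\<^sup>T u\<close> by clearing the first row, both times with unitriangular factors.\<close>

lemma gdet_one_plus_rank_one:
  fixes u v :: "'i \<Rightarrow> 'a::idom"
  assumes "distinct xs"
  shows "gdet xs (\<lambda>x y. (if x = y then 1 else 0) + u x * v y) = 1 + (\<Sum>x\<in>set xs. u x * v x)"
proof -
  let ?ys = "None # map Some xs"
  let ?I = "\<lambda>x y. if x = y then 1 else 0 :: 'a"
  define W where "W x y = (case (x, y) of (None, None) \<Rightarrow> 1 | (None, Some j) \<Rightarrow> - v j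
      | (Some i, None) \<Rightarrow> u i | (Some i, Some j) \<Rightarrow> ?I i j)" for x y
  define L where "L x y = (case (x, y) of (Some i, None) \<Rightarrow> - u i | _ \<Rightarrow> ?I x y)" for x y :: "'i option"
  define U where "U x y = (case (x, y) of (None, Some j) \<Rightarrow> v j | _ \<Rightarrow> ?I x y)" for x y :: "'i option"
  have dist: "distinct ?ys" using assms by (auto simp: distinct_map)
  have sum: "(\<Sum>z\<in>set ?ys. g z) = g None + (\<Sum>i\<in>set xs. g (Some i))" for g :: "'i option \<Rightarrow> 'a"
    by (simp add: sum.reindex)
  have I: "gdet (map Some xs) ?I = 1"
    if "distinct xs" for xs :: "'i list"
    using gdet_diagonal[of xs "\<lambda>_. 1"] that by (simp add: gdet_map)
  have "gdet ?ys L = gdet (map Some xs) L"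
    by (subst gdet_Cons_row) (auto simp: L_def)
  also have "\<dots> = gdet (map Some xs) ?I" by (rule gdet_cong) (auto simp: L_def)
  finally have L: "gdet ?ys L = 1" using I[OF assms] by simp
  have "gdet ?ys U = gdet (map Some xs) U"
    by (subst gdet_Cons_col) (auto simp: U_def)
  also have "\<dots> = gdet (map Some xs) ?I" by (rule gdet_cong) (auto simp: U_def)
  finally have U: "gdet ?ys U = 1" using I[OF assms] by simp
  have "gdet ?ys W = gdet ?ys (\<lambda>x y. L x None * W None y + (\<Sum>i\<in>set xs. L x (Some i) * W (Some i) y))"
    using gdet_mult[OF dist, of L W] by (simp only: sum L mult_1_left)
  also have "\<dots> = gdet (map Some xs) (\<lambda>x y. L x None * W None y + (\<Sum>i\<in>set xs. L x (Some i) * W (Some i) y))"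
    by (subst gdet_Cons_col)
      (auto simp: L_def W_def if_distrib[of "\<lambda>t. t * _"] cong: if_cong)
  also have "\<dots> = gdet xs (\<lambda>x y. (if x = y then 1 else 0) + u x * v y)"
    unfolding gdet_map
    by (rule gdet_cong) (auto simp: L_def W_def if_distrib[of "\<lambda>t. t * _"] cong: if_cong)
  finally have 1: "gdet ?ys W = gdet xs (\<lambda>x y. (if x = y then 1 else 0) + u x * v y)" .
  have "gdet ?ys W = gdet ?ys (\<lambda>x y. U x None * W None y + (\<Sum>i\<in>set xs. U x (Some i) * W (Some i) y))"
    using gdet_mult[OF dist, of U W] by (simp only: sum U mult_1_left)
  also have "\<dots> = (1 + (\<Sum>x\<in>set xs. u x * v x)) * gdet (map Some xs) (\<lambda>x y. U x None * W None y + (\<Sum>i\<in>set xs. U x (Some i) * W (Some i) y))"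
    by (subst gdet_Cons_row)
      (auto simp: U_def W_def if_distrib[of "\<lambda>t. _ * t"] mult.commute cong: if_cong)
  also have "gdet (map Some xs) (\<lambda>x y. U x None * W None y + (\<Sum>i\<in>set xs. U x (Some i) * W (Some i) y)) = gdet (map Some xs) ?I"
    by (rule gdet_cong) (auto split: if_splits simp: U_def W_def if_distrib[of "\<lambda>t. t * _"] cong: if_cong)
  finally show ?thesis using 1 I[OF assms] by simp
qed

section \<open>The action of matrices on symmetric matrices\<close>

definition tri_pairs :: "nat \<Rightarrow> (nat \<times> nat) set" where
  "tri_pairs n = {(i, j). i \<le> j \<and> j < n}"

text \<open>The basis of the space of symmetric matrices that is dual to the coordinates \<open>(i, j)\<close>, \<open>i \<le> j\<close>:
  off the diagonal it is the sum of two matrix units.\<close>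

definition sym_unit :: "nat \<times> nat \<Rightarrow> nat \<Rightarrow> nat \<Rightarrow> 'a::comm_ring_1" where
  "sym_unit x i j = (if (min i j, max i j) = x then 1 else 0)"

text \<open>The product \<open>A B A\<^sup>T\<close>. Matrices are functions here, because linear combinations over sets of
  labels are needed all the time.\<close>

definition congr :: "nat \<Rightarrow> (nat \<Rightarrow> nat \<Rightarrow> 'a) \<Rightarrow> (nat \<Rightarrow> nat \<Rightarrow> 'a) \<Rightarrow> nat \<Rightarrow> nat \<Rightarrow> 'a::comm_ring_1" where
  "congr n A B i j = (\<Sum>k<n. \<Sum>l<n. A i k * B k l * A j l)"

text \<open>The matrix of \<open>B \<mapsto> A B A\<^sup>T\<close> on symmetric matrices, in the basis \<open>sym_unit\<close>.\<close>

definition sym_square :: "nat \<Rightarrow> (nat \<Rightarrow> nat \<Rightarrow> 'a) \<Rightarrow> nat \<times> nat \<Rightarrow> nat \<times> nat \<Rightarrow> 'a::comm_ring_1" where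
  "sym_square n A y x = congr n A (sym_unit x) (fst y) (snd y)"

lemma finite_tri_pairs [simp]: "finite (tri_pairs n)"
  by (rule finite_subset[of _ "{..<n} \<times> {..<n}"]) (auto simp: tri_pairs_def)

lemma sorted_pair_in_tri_pairs: "i < n \<Longrightarrow> j < n \<Longrightarrow> (min i j, max i j) \<in> tri_pairs n"
  by (auto simp: tri_pairs_def)

lemma symmetric_expand:
  assumes "i < n" "j < n" "\<And>i j. B i j = B j i"
  shows "B i j = (\<Sum>x\<in>tri_pairs n. B (fst x) (snd x) * sym_unit x i j)"
proof -
  have "(\<Sum>x\<in>tri_pairs n. B (fst x) (snd x) * sym_unit x i j)
      = (\<Sum>x\<in>tri_pairs n. if x = (min i j, max i j) then B (fst x) (snd x) else 0)"
    by (rule sum.cong) (auto simp: sym_unit_def)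
  also have "\<dots> = B (min i j) (max i j)"
    using sorted_pair_in_tri_pairs[OF assms(1,2)] by simp
  also have "\<dots> = B i j" using assms(3)[of i j] by (simp add: min_def max_def)
  finally show ?thesis by simp
qed

lemma congr_cong:
  "(\<And>k l. k < n \<Longrightarrow> l < n \<Longrightarrow> B k l = B' k l) \<Longrightarrow> congr n A B = congr n A B'"
  by (auto simp: congr_def fun_eq_iff)

lemma congr_linear:
  "congr n A (\<lambda>k l. \<Sum>x\<in>S. c x * B x k l) i j = (\<Sum>x\<in>S. c x * congr n A (B x) i j)"
proof -
  have "congr n A (\<lambda>k l. \<Sum>x\<in>S. c x * B x k l) i j
      = (\<Sum>k<n. \<Sum>l<n. \<Sum>x\<in>S. c x * (A i k * B x k l * A j l))"
    by (simp add: congr_def sum_distrib_left sum_distrib_right mult_ac)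
  also have "\<dots> = (\<Sum>k<n. \<Sum>x\<in>S. \<Sum>l<n. c x * (A i k * B x k l * A j l))"
    by (intro sum.cong refl sum.swap)
  also have "\<dots> = (\<Sum>x\<in>S. c x * congr n A (B x) i j)"
    by (subst sum.swap) (simp add: congr_def sum_distrib_left)
  finally show ?thesis .
qed

lemma congr_sym:
  assumes "\<And>i j. B i j = B j i"
  shows "congr n A B i j = congr n A B j i"
  unfolding congr_def by (subst sum.swap) (auto simp: assms mult_ac intro!: sum.cong)

lemma sym_unit_sym: "sym_unit x i j = sym_unit x j i"
  by (simp add: sym_unit_def min.commute max.commute)

lemma congr_congr:
  "congr n A (congr n B M) i j = congr n (\<lambda>i k. \<Sum>l<n. A i l * B l k) M i j"
proof -
  have "congr n A (congr n B M) i j =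
      (\<Sum>k<n. \<Sum>l<n. \<Sum>p<n. \<Sum>q<n. A i k * B k p * M p q * B l q * A j l)"
    by (simp add: congr_def sum_distrib_left sum_distrib_right mult_ac)
  also have "\<dots> = (\<Sum>k<n. \<Sum>p<n. \<Sum>l<n. \<Sum>q<n. A i k * B k p * M p q * B l q * A j l)"
    by (intro sum.cong refl sum.swap)
  also have "\<dots> = (\<Sum>p<n. \<Sum>k<n. \<Sum>l<n. \<Sum>q<n. A i k * B k p * M p q * B l q * A j l)"
    by (rule sum.swap)
  also have "\<dots> = (\<Sum>p<n. \<Sum>k<n. \<Sum>q<n. \<Sum>l<n. A i k * B k p * M p q * B l q * A j l)"
    by (intro sum.cong refl sum.swap)
  also have "\<dots> = (\<Sum>p<n. \<Sum>q<n. \<Sum>k<n. \<Sum>l<n. A i k * B k p * M p q * B l q * A j l)"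
    by (intro sum.cong refl sum.swap)
  also have "\<dots> = congr n (\<lambda>i k. \<Sum>l<n. A i l * B l k) M i j"
    by (simp add: congr_def sum_distrib_left sum_distrib_right mult_ac)
  finally show ?thesis .
qed

lemma sym_square_apply:
  assumes "\<And>i j. B i j = B j i"
  shows "(\<Sum>x\<in>tri_pairs n. B (fst x) (snd x) * sym_square n A y x) = congr n A B (fst y) (snd y)"
proof -
  have "congr n A B = congr n A (\<lambda>k l. \<Sum>x\<in>tri_pairs n. B (fst x) (snd x) * sym_unit x k l)"
    by (rule congr_cong) (rule symmetric_expand, use assms in auto)
  thus ?thesis by (simp add: congr_linear sym_square_def)
qed

text \<open>The action on symmetric matrices is functorial: acting with \<open>A B\<close> is acting with \<open>B\<close> and then
  with \<open>A\<close>.\<close>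

lemma gdet_sym_square_mult:
  assumes "distinct xs" "set xs = tri_pairs n"
  shows "gdet xs (sym_square n (\<lambda>i k. \<Sum>l<n. A i l * B l k))
    = gdet xs (sym_square n A) * gdet xs (sym_square n B)"
proof -
  have "sym_square n (\<lambda>i k. \<Sum>l<n. A i l * B l k) y x
      = (\<Sum>z\<in>tri_pairs n. sym_square n A y z * sym_square n B z x)" for y x
    using sym_square_apply[of "congr n B (sym_unit x)" n A y] congr_sym[of "sym_unit x" n B]
    by (simp add: congr_congr sym_square_def sym_unit_sym mult.commute fun_eq_iff)
  hence "sym_square n (\<lambda>i k. \<Sum>l<n. A i l * B l k)
      = (\<lambda>y x. \<Sum>z\<in>set xs. sym_square n A y z * sym_square n B z x)"
    unfolding assms(2) by (intro ext)
  thus ?thesis by (simp only: gdet_mult[OF assms(1)])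
qed

lemma congr_sym_unit:
  assumes "k \<le> l" "l < n"
  shows "congr n A (sym_unit (k, l)) i j = (if k = l then A i k * A j k else A i k * A j l + A i l * A j k)"
proof -
  have split: "sym_unit (k, l) p q = (if p = k then if q = l then 1 else 0 else 0)
      + (if k = l then 0 else if p = l then if q = k then 1 else 0 else (0::'a))" for p q
    using assms by (auto simp: sym_unit_def min_def max_def)
  have "congr n A (sym_unit (k, l)) i j =
      (\<Sum>p<n. \<Sum>q<n. if p = k then if q = l then A i k * A j l else 0 else 0)
    + (\<Sum>p<n. \<Sum>q<n. if k = l then 0 else if p = l then if q = k then A i l * A j k else 0 else 0)"
    unfolding congr_def split sum.distrib[symmetric] by (intro sum.cong) auto
  also have "(\<Sum>p<n. \<Sum>q<n. if p = k then if q = l then A i k * A j l else 0 else 0) = A i k * A j l"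
  proof -
    have "(\<Sum>q<n. if p = k then if q = l then A i k * A j l else 0 else 0)
        = (if p = k then A i k * A j l else 0)" for p
      using assms by simp
    thus ?thesis using assms by simp
  qed
  also have "(\<Sum>p<n. \<Sum>q<n. if k = l then 0 else if p = l then if q = k then A i l * A j k else 0 else 0)
      = (if k = l then 0 else A i l * A j k)"
  proof -
    have "(\<Sum>q<n. if k = l then 0 else if p = l then if q = k then A i l * A j k else 0 else 0)
        = (if p = l then if k = l then 0 else A i l * A j k else 0)" for p
      using assms by simp
    thus ?thesis using assms by simp
  qed
  finally show ?thesis by simp
qed

text \<open>Each index occurs \<open>n + 1\<close> times in the pairs \<open>i \<le> j < n\<close>, the diagonal pair counting twice. This
  is where the exponent \<open>n + 1\<close> comes from.\<close>

lemma prod_tri_pairs: "(\<Prod>x\<in>tri_pairs n. d (fst x) * d (snd x)) = (\<Prod>i<n. d i) ^ (n + 1)"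
  for d :: "nat \<Rightarrow> 'a::comm_ring_1"
proof (induction n)
  case 0
  show ?case by (simp add: tri_pairs_def)
next
  case (Suc n)
  have "tri_pairs (Suc n) = tri_pairs n \<union> (\<lambda>i. (i, n)) ` {..n}"
    by (auto simp: tri_pairs_def)
  moreover have "tri_pairs n \<inter> (\<lambda>i. (i, n)) ` {..n} = {}"
    by (auto simp: tri_pairs_def)
  ultimately have "(\<Prod>x\<in>tri_pairs (Suc n). d (fst x) * d (snd x))
      = (\<Prod>i<n. d i) ^ (n + 1) * (\<Prod>i\<le>n. d i * d n)"
    using Suc.IH by (simp add: prod.union_disjoint prod.reindex inj_on_def)
  also have "(\<Prod>i\<le>n. d i * d n) = (\<Prod>i<n. d i) * d n * d n ^ (n + 1)"
    by (simp add: prod.distrib lessThan_Suc_atMost[symmetric])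
  finally show ?case by (simp add: power_mult_distrib mult_ac)
qed

text \<open>An upper triangular \<open>A\<close> sends the basis vector at \<open>(k, l)\<close> to a combination of vectors at \<open>(i, j)\<close>
  with \<open>i \<le> k\<close> and \<open>j \<le> l\<close>, so the action is triangular for the rank \<open>i + j\<close>.\<close>

lemma gdet_sym_square_upper:
  fixes A :: "nat \<Rightarrow> nat \<Rightarrow> 'a::idom"
  assumes "distinct xs" "set xs = tri_pairs n"
    and upper: "\<And>i j. i < n \<Longrightarrow> j < i \<Longrightarrow> A i j = 0"
  shows "gdet xs (sym_square n A) = (\<Prod>i<n. A i i) ^ (n + 1)"
proof -
  have "gdet xs (sym_square n A) = (\<Prod>x\<in>set xs. sym_square n A x x)"
  proof (rule gdet_ranked_triangular[OF assms(1), of "\<lambda>x. fst x + snd x"])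
    fix y x assume "y \<in> set xs" "x \<in> set xs" "y \<noteq> x" "fst x + snd x \<le> fst y + snd y"
    moreover obtain i j k l where yx: "y = (i, j)" "x = (k, l)" by fastforce
    ultimately have *: "i \<le> j" "j < n" "k \<le> l" "l < n" "(i, j) \<noteq> (k, l)" "k + l \<le> i + j"
      by (auto simp: assms(2) tri_pairs_def)
    have "A i k * A j l = 0" using * upper[of i k] upper[of j l]
      by (cases "k < i"; cases "l < j") auto
    moreover have "A i l * A j k = 0" using * upper[of i l] upper[of j k]
      by (cases "l < i"; cases "k < j") auto
    moreover have "k = l \<Longrightarrow> A i k * A j k = 0" using * upper[of i k] upper[of j k]
      by (cases "k < i"; cases "k < j") auto
    ultimately show "sym_square n A y x = 0"
      using * by (simp add: yx sym_square_def congr_sym_unit del: mult_eq_0_iff)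
  qed
  also have "\<dots> = (\<Prod>x\<in>tri_pairs n. A (fst x) (fst x) * A (snd x) (snd x))"
    unfolding assms(2) using upper
    by (intro prod.cong) (auto simp: tri_pairs_def sym_square_def congr_sym_unit)
  finally show ?thesis using prod_tri_pairs[of "\<lambda>i. A i i" n] by simp
qed

lemma gdet_sym_square_lower:
  fixes A :: "nat \<Rightarrow> nat \<Rightarrow> 'a::idom"
  assumes "distinct xs" "set xs = tri_pairs n"
    and lower: "\<And>i j. j < n \<Longrightarrow> i < j \<Longrightarrow> A i j = 0"
  shows "gdet xs (sym_square n A) = (\<Prod>i<n. A i i) ^ (n + 1)"
proof -
  have "gdet xs (\<lambda>x y. sym_square n A y x) = (\<Prod>x\<in>set xs. sym_square n A x x)"
  proof (rule gdet_ranked_triangular[OF assms(1), of "\<lambda>x. fst x + snd x"])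
    fix x y assume "x \<in> set xs" "y \<in> set xs" "x \<noteq> y" "fst y + snd y \<le> fst x + snd x"
    moreover obtain i j k l where yx: "y = (i, j)" "x = (k, l)" by fastforce
    ultimately have *: "i \<le> j" "j < n" "k \<le> l" "l < n" "(i, j) \<noteq> (k, l)" "i + j \<le> k + l"
      by (auto simp: assms(2) tri_pairs_def)
    have "A i k * A j l = 0" using * lower[of k i] lower[of l j]
      by (cases "i < k"; cases "j < l") auto
    moreover have "A i l * A j k = 0" using * lower[of l i] lower[of k j]
      by (cases "i < l"; cases "j < k") auto
    moreover have "k = l \<Longrightarrow> A i k * A j k = 0" using * lower[of k i] lower[of k j]
      by (cases "i < k"; cases "j < k") auto
    ultimately show "sym_square n A y x = 0"
      using * by (simp add: yx sym_square_def congr_sym_unit del: mult_eq_0_iff)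
  qed
  also have "\<dots> = (\<Prod>x\<in>tri_pairs n. A (fst x) (fst x) * A (snd x) (snd x))"
    unfolding assms(2) using lower
    by (intro prod.cong) (auto simp: tri_pairs_def sym_square_def congr_sym_unit)
  finally show ?thesis using prod_tri_pairs[of "\<lambda>i. A i i" n]
    by (simp add: gdet_transpose[of _ "sym_square n A"])
qed

text \<open>Both sides of the formula for the determinant of the action are multiplicative and known for
  triangular matrices, so it is enough to generate all matrices from triangular ones.\<close>

inductive_set triangular_products :: "nat \<Rightarrow> 'a::comm_ring_1 mat set" for n where
  upper: "A \<in> carrier_mat n n \<Longrightarrow> (\<And>i j. i < n \<Longrightarrow> j < i \<Longrightarrow> A $$ (i, j) = 0) \<Longrightarrow> A \<in> triangular_products n"
| lower: "A \<in> carrier_mat n n \<Longrightarrow> (\<And>i j. j < n \<Longrightarrow> i < j \<Longrightarrow> A $$ (i, j) = 0) \<Longrightarrow> A \<in> triangular_products n"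
| times: "A \<in> triangular_products n \<Longrightarrow> B \<in> triangular_products n \<Longrightarrow> A * B \<in> triangular_products n"

lemma triangular_products_carrier: "A \<in> triangular_products n \<Longrightarrow> A \<in> carrier_mat n n"
  by (induction rule: triangular_products.induct) auto

definition bordered :: "nat \<Rightarrow> 'a::comm_ring_1 mat \<Rightarrow> 'a mat" where
  "bordered n A = mat (Suc n) (Suc n) (\<lambda>(i, j). if i = 0 \<or> j = 0 then if i = j then 1 else 0 else A $$ (i - 1, j - 1))"

lemma bordered_mult:
  assumes "A \<in> carrier_mat n n" "B \<in> carrier_mat n n"
  shows "bordered n (A * B) = bordered n A * bordered n B"
proof (rule eq_matI)
  fix i j assume "i < dim_row (bordered n A * bordered n B)" "j < dim_col (bordered n A * bordered n B)"
  hence ij: "i < Suc n" "j < Suc n" by (auto simp: bordered_def)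
  have "(bordered n A * bordered n B) $$ (i, j)
      = (\<Sum>k<Suc n. bordered n A $$ (i, k) * bordered n B $$ (k, j))"
    using ij by (auto simp: scalar_prod_def bordered_def lessThan_atLeast0)
  also have "\<dots> = bordered n (A * B) $$ (i, j)"
    unfolding sum.lessThan_Suc_shift using ij assms
    by (auto simp: bordered_def scalar_prod_def lessThan_atLeast0 intro!: sum.cong)
  finally show "bordered n (A * B) $$ (i, j) = (bordered n A * bordered n B) $$ (i, j)" by simp
qed (auto simp: bordered_def)

lemma bordered_triangular_products:
  assumes "A \<in> triangular_products n"
  shows "bordered n A \<in> triangular_products (Suc n)"
  using assms
proof induction
  case (upper A)
  show ?case
    by (rule triangular_products.upper) (use upper in \<open>auto simp: bordered_def\<close>)
next
  case (lower A)
  show ?case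
    by (rule triangular_products.lower) (use lower in \<open>auto simp: bordered_def\<close>)
next
  case (times A B)
  thus ?case
    by (simp add: bordered_mult triangular_products_carrier triangular_products.times)
qed

lemma if_mult_distribs:
  "(if b then x else y) * z = (if b then x * z else y * z)"
  "z * (if b then x else y) = (if b then z * x else z * y)" for x y z :: "'a::times"
  by simp_all

text \<open>Gaussian elimination, one column at a time. With a nonzero corner entry \<open>M\<close> factors as
  lower times bordered times upper; if the corner vanishes but its column does not, a transvection
  creates a pivot; and if the whole column vanishes, the matrix is itself bordered times upper. In
  each case the bordered factor is covered by induction.\<close>

lemma triangular_products_all:
  "(A :: 'a::field mat) \<in> carrier_mat n n \<Longrightarrow> A \<in> triangular_products n"
proof (induction n arbitrary: A)
  case 0
  thus ?case by (intro triangular_products.upper) auto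
next
  case (Suc n)
  note A = Suc.prems
  have pivot: "M \<in> triangular_products (Suc n)"
    if M: "M \<in> carrier_mat (Suc n) (Suc n)" and M0: "M $$ (0, 0) \<noteq> 0" for M :: "'a mat"
  proof -
    define L where "L = mat (Suc n) (Suc n) (\<lambda>(i, j). if i = j then 1 else if j = 0 then M $$ (i, 0) / M $$ (0, 0) else 0)"
    define U where "U = mat (Suc n) (Suc n) (\<lambda>(i, j). if i = 0 then M $$ (0, j) else if i = j then 1 else 0)"
    define C where "C = mat n n (\<lambda>(i, j). M $$ (Suc i, Suc j) - M $$ (Suc i, 0) / M $$ (0, 0) * M $$ (0, Suc j))"
    have "bordered n C * U = mat (Suc n) (Suc n) (\<lambda>(i, j). if i = 0 then M $$ (0, j) else if j = 0 then 0
        else M $$ (i, j) - M $$ (i, 0) / M $$ (0, 0) * M $$ (0, j))" (is "_ = ?D")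
    proof (rule eq_matI)
      fix i j assume "i < dim_row ?D" "j < dim_col ?D"
      hence ij: "i < Suc n" "j < Suc n" by auto
      have "(bordered n C * U) $$ (i, j) = (\<Sum>k<Suc n. bordered n C $$ (i, k) * U $$ (k, j))"
        using ij by (auto simp: scalar_prod_def bordered_def U_def lessThan_atLeast0)
      also have "\<dots> = ?D $$ (i, j)"
        unfolding sum.lessThan_Suc_shift using ij
        by (cases i; cases j) (auto simp: bordered_def U_def C_def if_mult_distribs cong: if_cong)
      finally show "(bordered n C * U) $$ (i, j) = ?D $$ (i, j)" .
    qed (auto simp: bordered_def U_def)
    moreover have "L * ?D = M"
    proof (rule eq_matI)
      fix i j assume "i < dim_row M" "j < dim_col M"
      hence ij: "i < Suc n" "j < Suc n" using M by auto
      have "(L * ?D) $$ (i, j) = (\<Sum>k<Suc n. L $$ (i, k) * ?D $$ (k, j))"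
        using ij by (auto simp: scalar_prod_def L_def lessThan_atLeast0)
      also have "\<dots> = M $$ (i, j)"
        unfolding sum.lessThan_Suc_shift using ij M0
        by (cases i; cases j) (auto simp: L_def if_mult_distribs cong: if_cong)
      finally show "(L * ?D) $$ (i, j) = M $$ (i, j)" .
    qed (use M in \<open>auto simp: L_def\<close>)
    ultimately have "M = L * (bordered n C * U)" by simp
    moreover have "L \<in> triangular_products (Suc n)"
      by (rule triangular_products.lower) (auto simp: L_def)
    moreover have "U \<in> triangular_products (Suc n)"
      by (rule triangular_products.upper) (auto simp: U_def)
    moreover have "bordered n C \<in> triangular_products (Suc n)"
      by (rule bordered_triangular_products, rule Suc.IH) (auto simp: C_def)
    ultimately show ?thesis by (auto intro!: triangular_products.times)
  qed
  have "0 < r" if "A $$ (0, 0) = 0" "A $$ (r, 0) \<noteq> 0" for r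
    using that by (cases r) auto
  then consider "A $$ (0, 0) \<noteq> 0" | r where "A $$ (0, 0) = 0" "0 < r" "r < Suc n" "A $$ (r, 0) \<noteq> 0"
    | "\<forall>i<Suc n. A $$ (i, 0) = 0"
    by blast
  thus ?case
  proof cases
    case 1
    thus ?thesis by (rule pivot[OF A])
  next
    case (2 r)
    \<comment> \<open>Adding row \<open>r\<close> to row 0 creates a pivot, and it is undone by an upper triangular matrix.\<close>
    define U where "U = mat (Suc n) (Suc n) (\<lambda>(i, j). if i = j then 1 else if i = 0 \<and> j = r then - 1 else 0 :: 'a)"
    define M where "M = mat (Suc n) (Suc n) (\<lambda>(i, j). if i = 0 then A $$ (0, j) + A $$ (r, j) else A $$ (i, j))"
    have "U * M = A"
    proof (rule eq_matI)
      fix i j assume "i < dim_row A" "j < dim_col A"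
      hence ij: "i < Suc n" "j < Suc n" using A by auto
      have "(U * M) $$ (i, j) = (\<Sum>k<Suc n. U $$ (i, k) * M $$ (k, j))"
        using ij by (auto simp: scalar_prod_def U_def M_def lessThan_atLeast0)
      also have "\<dots> = (\<Sum>k<Suc n. (if k = i then M $$ (i, j) else 0) + (if k = r then if i = 0 then - M $$ (r, j) else 0 else 0))"
        using ij 2 by (intro sum.cong) (auto simp: U_def)
      also have "\<dots> = A $$ (i, j)"
        unfolding sum.distrib using ij 2 by (simp add: M_def)
      finally show "(U * M) $$ (i, j) = A $$ (i, j)" .
    qed (use A in \<open>auto simp: U_def M_def\<close>)
    moreover have "U \<in> triangular_products (Suc n)"
      by (rule triangular_products.upper) (use 2 in \<open>auto simp: U_def\<close>)
    moreover have "M \<in> triangular_products (Suc n)"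
      by (rule pivot) (use 2 in \<open>auto simp: M_def\<close>)
    ultimately show ?thesis using triangular_products.times by fastforce
  next
    case 3
    define U where "U = mat (Suc n) (Suc n) (\<lambda>(i, j). if i = 0 then A $$ (0, j) else if i = j then 1 else 0)"
    define C where "C = mat n n (\<lambda>(i, j). A $$ (Suc i, Suc j))"
    have "bordered n C * U = A"
    proof (rule eq_matI)
      fix i j assume "i < dim_row A" "j < dim_col A"
      hence ij: "i < Suc n" "j < Suc n" using A by auto
      have "(bordered n C * U) $$ (i, j) = (\<Sum>k<Suc n. bordered n C $$ (i, k) * U $$ (k, j))"
        using ij by (auto simp: scalar_prod_def bordered_def U_def lessThan_atLeast0)
      also have "\<dots> = A $$ (i, j)"
        unfolding sum.lessThan_Suc_shift using ij 3
        by (cases i; cases j) (auto simp: bordered_def U_def C_def if_mult_distribs cong: if_cong)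
      finally show "(bordered n C * U) $$ (i, j) = A $$ (i, j)" .
    qed (use A in \<open>auto simp: bordered_def U_def\<close>)
    moreover have "U \<in> triangular_products (Suc n)"
      by (rule triangular_products.upper) (auto simp: U_def)
    moreover have "bordered n C \<in> triangular_products (Suc n)"
      by (rule bordered_triangular_products, rule Suc.IH) (auto simp: C_def)
    ultimately show ?thesis using triangular_products.times by fastforce
  qed
qed

text \<open>The determinant of the second symmetric power. It determines how often \<open>det S\<close> divides the
  Hessian.\<close>

lemma gdet_sym_square:
  fixes A :: "'a::field mat"
  assumes "distinct xs" "set xs = tri_pairs n" "A \<in> carrier_mat n n"
  shows "gdet xs (sym_square n (\<lambda>i j. A $$ (i, j))) = det A ^ (n + 1)"
  using triangular_products_all[OF assms(3)]
proof induction
  case (upper A)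
  have "gdet xs (sym_square n (\<lambda>i j. A $$ (i, j))) = (\<Prod>i<n. A $$ (i, i)) ^ (n + 1)"
    by (rule gdet_sym_square_upper[OF assms(1,2)]) (use upper in auto)
  moreover have "det A = (\<Prod>i<n. A $$ (i, i))"
    using det_upper_triangular[of A n] upper
    by (auto simp: upper_triangular_def prod_list_diag_prod lessThan_atLeast0)
  ultimately show ?case by simp
next
  case (lower A)
  have "gdet xs (sym_square n (\<lambda>i j. A $$ (i, j))) = (\<Prod>i<n. A $$ (i, i)) ^ (n + 1)"
    by (rule gdet_sym_square_lower[OF assms(1,2)]) (use lower in auto)
  moreover have "det A = (\<Prod>i<n. A $$ (i, i))"
    using det_lower_triangular[of n A] lower
    by (auto simp: prod_list_diag_prod lessThan_atLeast0)
  ultimately show ?case by simp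
next
  case (times A B)
  hence AB: "A \<in> carrier_mat n n" "B \<in> carrier_mat n n"
    by (auto dest: triangular_products_carrier)
  have "gdet xs (sym_square n (\<lambda>i j. (A * B) $$ (i, j)))
      = gdet xs (sym_square n (\<lambda>i j. \<Sum>k<n. A $$ (i, k) * B $$ (k, j)))"
  proof (rule gdet_cong)
    fix y x assume "y \<in> set xs" "x \<in> set xs"
    hence "fst y < n" "snd y < n" by (auto simp: assms(2) tri_pairs_def)
    thus "sym_square n (\<lambda>i j. (A * B) $$ (i, j)) y x
        = sym_square n (\<lambda>i j. \<Sum>k<n. A $$ (i, k) * B $$ (k, j)) y x"
      unfolding sym_square_def congr_def using AB
      by (intro sum.cong refl arg_cong2[where f = "(*)"]) (auto simp: scalar_prod_def lessThan_atLeast0)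
  qed
  thus ?case using times.IH AB
    by (simp add: gdet_sym_square_mult[OF assms(1,2)] det_mult power_mult_distrib)
qed

section \<open>The Hessian form of the determinant\<close>

text \<open>The trace form \<open>tr (A B)\<close>.\<close>

definition pairing :: "nat \<Rightarrow> (nat \<Rightarrow> nat \<Rightarrow> 'a) \<Rightarrow> (nat \<Rightarrow> nat \<Rightarrow> 'a) \<Rightarrow> 'a::comm_ring_1" where
  "pairing n A B = (\<Sum>i<n. \<Sum>j<n. A i j * B j i)"

text \<open>With \<open>T\<close> the inverse of a symmetric matrix \<open>S\<close>, this is the second derivative of the determinant
  at \<open>S\<close> in the directions \<open>A\<close> and \<open>B\<close>, divided by \<open>det S\<close>; with \<open>T\<close> the adjugate it is \<open>det S\<close> times that
  derivative.\<close>

definition hess_form :: "nat \<Rightarrow> (nat \<Rightarrow> nat \<Rightarrow> 'a) \<Rightarrow> (nat \<Rightarrow> nat \<Rightarrow> 'a) \<Rightarrow> (nat \<Rightarrow> nat \<Rightarrow> 'a) \<Rightarrow> 'a::comm_ring_1" where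
  "hess_form n T A B = pairing n T A * pairing n T B - pairing n (congr n T A) B"

text \<open>The derivative of the cloned symmetric matrix in the direction of the variable \<open>x\<close>: the variable
  at \<open>(b, b)\<close> also fills the entry \<open>(a, a)\<close>. For \<open>x \<noteq> (a, a)\<close> these matrices span the hyperplane of symmetric
  matrices with equal entries at \<open>(a, a)\<close> and \<open>(b, b)\<close>.\<close>

definition clone_unit :: "nat \<Rightarrow> nat \<Rightarrow> nat \<times> nat \<Rightarrow> nat \<Rightarrow> nat \<Rightarrow> 'a::comm_ring_1" where
  "clone_unit a b x i j = sym_unit x i j + (if x = (b, b) then sym_unit (a, a) i j else 0)"

lemma pairing_cong:
  assumes "\<And>i j. i < n \<Longrightarrow> j < n \<Longrightarrow> A i j = A' i j" "\<And>i j. i < n \<Longrightarrow> j < n \<Longrightarrow> B i j = B' i j"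
  shows "pairing n A B = pairing n A' B'"
  unfolding pairing_def by (intro sum.cong refl arg_cong2[where f = "(*)"] assms) auto

lemma pairing_commute: "pairing n A B = pairing n B A"
  unfolding pairing_def by (subst sum.swap) (simp add: mult.commute)

lemma pairing_linear_right:
  "pairing n A (\<lambda>k l. \<Sum>x\<in>I. c x * B x k l) = (\<Sum>x\<in>I. c x * pairing n A (B x))"
proof -
  have "pairing n A (\<lambda>k l. \<Sum>x\<in>I. c x * B x k l)
      = (\<Sum>i<n. \<Sum>j<n. \<Sum>x\<in>I. c x * (A i j * B x j i))"
    by (simp add: pairing_def sum_distrib_left mult_ac)
  also have "\<dots> = (\<Sum>i<n. \<Sum>x\<in>I. \<Sum>j<n. c x * (A i j * B x j i))"
    by (intro sum.cong refl sum.swap)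
  also have "\<dots> = (\<Sum>x\<in>I. c x * pairing n A (B x))"
    by (subst sum.swap) (simp add: pairing_def sum_distrib_left)
  finally show ?thesis .
qed

lemma pairing_linear_left:
  "pairing n (\<lambda>k l. \<Sum>x\<in>I. c x * B x k l) A = (\<Sum>x\<in>I. c x * pairing n (B x) A)"
  using pairing_linear_right[of n A c B I] by (simp add: pairing_commute[of n _ A])

text \<open>The map \<open>B \<mapsto> S B S\<close> is self-adjoint for the trace form.\<close>

lemma pairing_congr:
  assumes "\<And>i j. S i j = S j i"
  shows "pairing n A (congr n S B) = pairing n (congr n S A) B"
proof -
  have "pairing n A (congr n S B) = (\<Sum>i<n. \<Sum>j<n. \<Sum>k<n. \<Sum>l<n. A i j * (S j k * B k l * S i l))"
    by (simp add: pairing_def congr_def sum_distrib_left)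
  also have "\<dots> = (\<Sum>i<n. \<Sum>k<n. \<Sum>j<n. \<Sum>l<n. A i j * (S j k * B k l * S i l))"
    by (intro sum.cong refl sum.swap)
  also have "\<dots> = (\<Sum>k<n. \<Sum>i<n. \<Sum>j<n. \<Sum>l<n. A i j * (S j k * B k l * S i l))"
    by (rule sum.swap)
  also have "\<dots> = (\<Sum>k<n. \<Sum>i<n. \<Sum>l<n. \<Sum>j<n. A i j * (S j k * B k l * S i l))"
    by (intro sum.cong refl sum.swap)
  also have "\<dots> = (\<Sum>k<n. \<Sum>l<n. \<Sum>i<n. \<Sum>j<n. A i j * (S j k * B k l * S i l))"
    by (intro sum.cong refl sum.swap)
  also have "\<dots> = (\<Sum>l<n. \<Sum>k<n. \<Sum>i<n. \<Sum>j<n. A i j * (S j k * B k l * S i l))"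
    by (rule sum.swap)
  also have "\<dots> = (\<Sum>l<n. \<Sum>k<n. \<Sum>i<n. \<Sum>j<n. S l i * A i j * S k j * B k l)"
    by (intro sum.cong refl) (simp add: assms[of _ l for l] assms mult_ac)
  also have "\<dots> = pairing n (congr n S A) B"
    by (simp add: pairing_def congr_def sum_distrib_right)
  finally show ?thesis .
qed

lemma pairing_sym_unit_right:
  assumes "x \<in> tri_pairs n" "\<And>i j. A i j = A j i"
  shows "pairing n A (sym_unit x) = (if fst x = snd x then 1 else 2) * A (fst x) (snd x)"
proof -
  obtain k l where x: "x = (k, l)" "k \<le> l" "l < n"
    using assms(1) by (cases x) (auto simp: tri_pairs_def)
  have "pairing n A (sym_unit x) = (\<Sum>i<n. \<Sum>j<n. (if i = k then if j = l then A k l else 0 else 0)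
      + (if k = l then 0 else if i = l then if j = k then A l k else 0 else 0))"
    unfolding pairing_def using x by (intro sum.cong refl) (auto simp: sym_unit_def min_def max_def)
  also have "\<dots> = (\<Sum>i<n. if i = k then A k l else 0) + (\<Sum>i<n. if k = l then 0 else if i = l then A l k else 0)"
    unfolding sum.distrib using x by (intro arg_cong2[where f = "(+)"] sum.cong refl) auto
  also have "\<dots> = (if k = l then 1 else 2) * A k l"
    using x assms(2)[of l k] by auto
  finally show ?thesis by (simp add: x)
qed

lemma hess_form_linear_left:
  "hess_form n T (\<lambda>k l. \<Sum>x\<in>I. c x * A x k l) B = (\<Sum>x\<in>I. c x * hess_form n T (A x) B)"
proof -
  have "congr n T (\<lambda>k l. \<Sum>x\<in>I. c x * A x k l) = (\<lambda>k l. \<Sum>x\<in>I. c x * congr n T (A x) k l)"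
    by (intro ext congr_linear)
  thus ?thesis
    by (simp add: hess_form_def pairing_linear_right pairing_linear_left sum_distrib_left
        sum_subtractf right_diff_distrib mult_ac)
qed

lemma hess_form_cong:
  assumes "\<And>i j. i < n \<Longrightarrow> j < n \<Longrightarrow> A i j = A' i j" "\<And>i j. i < n \<Longrightarrow> j < n \<Longrightarrow> B i j = B' i j"
  shows "hess_form n T A B = hess_form n T A' B'"
  unfolding hess_form_def
  using congr_cong[of n A A' T] pairing_cong[of n T T A A'] pairing_cong[of n T T B B']
    pairing_cong[of n "congr n T A'" "congr n T A'" B B'] assms by simp

lemma hess_form_commute:
  assumes "\<And>i j. T i j = T j i"
  shows "hess_form n T A B = hess_form n T B A"
  using pairing_congr[of T n B A] assms
  by (simp add: hess_form_def mult.commute pairing_commute[of n "congr n T A" B])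

locale inverse_pair =
  fixes n :: nat and S T :: "nat \<Rightarrow> nat \<Rightarrow> 'a::field"
  assumes S_sym: "S i j = S j i" and T_sym: "T i j = T j i"
    and inv: "i < n \<Longrightarrow> j < n \<Longrightarrow> (\<Sum>k<n. T i k * S k j) = (if i = j then 1 else 0)"
begin

lemma congr_congr_inverse:
  assumes "i < n" "j < n"
  shows "congr n T (congr n S A) i j = A i j"
proof -
  have "congr n T (congr n S A) i j = (\<Sum>k<n. \<Sum>l<n. if k = i then if l = j then A i j else 0 else 0)"
    unfolding congr_congr unfolding congr_def using assms by (intro sum.cong refl) (auto simp: inv)
  also have "\<dots> = (\<Sum>k<n. if k = i then A i j else 0)"
    using assms by (intro sum.cong refl) auto
  also have "\<dots> = A i j" using assms by simp
  finally show ?thesis .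
qed

lemma congr_of_inverse:
  assumes "i < n" "j < n"
  shows "congr n S T i j = S i j"
proof -
  have "congr n S T i j = (\<Sum>k<n. S i k * (\<Sum>l<n. T k l * S l j))"
    unfolding congr_def by (simp add: sum_distrib_left mult_ac S_sym[of _ j])
  also have "\<dots> = (\<Sum>k<n. if k = j then S i k else 0)"
    using assms by (intro sum.cong refl) (auto simp: inv)
  finally show ?thesis using assms by simp
qed

text \<open>The substitution \<open>A \<mapsto> S A S\<close> cancels both factors \<open>T\<close> of the quadratic term. What remains is the
  trace form, which no longer depends on \<open>S\<close>, up to a correction of rank one.\<close>

lemma hess_form_congr:
  "hess_form n T (congr n S A) B = pairing n A S * pairing n T B - pairing n A B"
proof -
  have "pairing n T (congr n S A) = pairing n A S"
    using pairing_congr[of S n T A] S_sym pairing_cong[of n "congr n S T" S A A] congr_of_inverse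
    by (simp add: pairing_commute[of n A])
  moreover have "pairing n (congr n T (congr n S A)) B = pairing n A B"
    by (rule pairing_cong) (auto simp: congr_congr_inverse)
  ultimately show ?thesis by (simp add: hess_form_def)
qed

lemma pairing_inverse: "pairing n T S = of_nat n"
proof -
  have "pairing n T S = (\<Sum>i<n. 1)"
    unfolding pairing_def by (intro sum.cong refl) (simp add: inv)
  thus ?thesis by simp
qed

text \<open>By \<open>hess_form_congr\<close> the product of the two matrices is \<open>- G (I - s t\<^sup>T)\<close>, where \<open>G\<close> is the
  diagonal Gram matrix of the trace form, \<open>s\<close> holds the coordinates of \<open>S\<close> and \<open>t\<close> those of the functional
  \<open>B \<mapsto> tr (T B)\<close>. The rank one factor has determinant \<open>1 - tr (T S) = 1 - n\<close>.\<close>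

lemma gdet_gram:
  assumes "distinct xs" "set xs = tri_pairs n"
  shows "gdet xs (sym_square n S) * gdet xs (\<lambda>x y. hess_form n T (sym_unit x) (sym_unit y))
    = (\<Prod>x\<in>tri_pairs n. if fst x = snd x then - 1 else - 2) * (1 - of_nat n)"
proof -
  define g :: "nat \<times> nat \<Rightarrow> 'a" where "g x = (if fst x = snd x then - 1 else - 2)" for x
  define s where "s x = S (fst x) (snd x)" for x
  define t where "t x = pairing n T (sym_unit x)" for x
  let ?H = "\<lambda>x y. hess_form n T (sym_unit x) (sym_unit y)"
  have prod: "(\<Sum>z\<in>set xs. sym_square n S z x * ?H z y)
      = (\<Sum>z\<in>set xs. (if x = z then g x else 0) * ((if z = y then 1 else 0) + - s z * t y))"
    if "x \<in> set xs" "y \<in> set xs" for x y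
  proof -
    have "(\<Sum>z\<in>set xs. sym_square n S z x * ?H z y) = hess_form n T (congr n S (sym_unit x)) (sym_unit y)"
      unfolding assms(2) hess_form_linear_left[symmetric]
      by (rule hess_form_cong)
        (simp_all add: sym_square_def symmetric_expand[of _ n _ "congr n S (sym_unit x)"] congr_sym sym_unit_sym)
    also have "\<dots> = pairing n (sym_unit x) S * t y - pairing n (sym_unit x) (sym_unit y)"
      by (simp add: hess_form_congr t_def)
    also have "pairing n (sym_unit x) S = - g x * s x"
      using that S_sym by (simp add: pairing_commute[of n _ S] pairing_sym_unit_right assms(2) g_def s_def)
    also have "pairing n (sym_unit x) (sym_unit y) = (if x = y then - g x else 0)"
    proof -
      have "pairing n (sym_unit x) (sym_unit y) = (if fst y = snd y then 1 else 2) * sym_unit x (fst y) (snd y)"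
        using that by (intro pairing_sym_unit_right) (auto simp: assms(2) sym_unit_sym)
      moreover have "(min (fst y) (snd y), max (fst y) (snd y)) = y"
        using that by (auto simp: assms(2) tri_pairs_def)
      ultimately show ?thesis by (auto simp: sym_unit_def g_def)
    qed
    also have "- g x * s x * t y - (if x = y then - g x else 0)
        = g x * ((if x = y then 1 else 0) + - s x * t y)"
      by (simp add: algebra_simps)
    also have "\<dots> = (\<Sum>z\<in>set xs. if z = x then g x * ((if x = y then 1 else 0) + - s x * t y) else 0)"
      using that by simp
    also have "\<dots> = (\<Sum>z\<in>set xs. (if x = z then g x else 0) * ((if z = y then 1 else 0) + - s z * t y))"
      by (intro sum.cong) auto
    finally show ?thesis .
  qed
  have "gdet xs (sym_square n S) * gdet xs ?H = gdet xs (\<lambda>x z. sym_square n S z x) * gdet xs ?H"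
    by (simp add: gdet_transpose[of _ "sym_square n S"])
  also have "\<dots> = gdet xs (\<lambda>x y. \<Sum>z\<in>set xs. sym_square n S z x * ?H z y)"
    by (rule gdet_mult[OF assms(1), symmetric])
  also have "\<dots> = gdet xs (\<lambda>x y. \<Sum>z\<in>set xs. (if x = z then g x else 0) * ((if z = y then 1 else 0) + - s z * t y))"
    by (rule gdet_cong) (rule prod)
  also have "\<dots> = gdet xs (\<lambda>x z. if x = z then g x else 0) * gdet xs (\<lambda>z y. (if z = y then 1 else 0) + - s z * t y)"
    by (rule gdet_mult[OF assms(1)])
  also have "\<dots> = (\<Prod>x\<in>set xs. g x) * (1 + (\<Sum>x\<in>set xs. - s x * t x))"
    by (simp only: gdet_diagonal[OF assms(1)] gdet_one_plus_rank_one[OF assms(1)])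
  also have "(\<Sum>x\<in>set xs. - s x * t x) = - pairing n T (\<lambda>k l. \<Sum>x\<in>tri_pairs n. s x * sym_unit x k l)"
    by (simp add: pairing_linear_right t_def assms(2) sum_negf)
  also have "pairing n T (\<lambda>k l. \<Sum>x\<in>tri_pairs n. s x * sym_unit x k l) = pairing n T S"
    by (rule pairing_cong) (use symmetric_expand[of _ n _ S] S_sym in \<open>auto simp: s_def\<close>)
  finally show ?thesis by (simp add: pairing_inverse assms(2) g_def)
qed

end

lemma hess_form_linear_right:
  assumes "\<And>i j. T i j = T j i"
  shows "hess_form n T A (\<lambda>k l. \<Sum>x\<in>I. c x * B x k l) = (\<Sum>x\<in>I. c x * hess_form n T A (B x))"
  using hess_form_linear_left[where n = n and T = T and c = c and A = B and I = I and B = A] by (simp add: hess_form_commute[OF assms, where n = n and A = A])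

text \<open>The coordinates in the basis \<open>clone_unit\<close> differ from the entries only at \<open>(a, a)\<close>, where the
  coordinate measures the distance from the hyperplane of equal entries.\<close>

lemma clone_unit_expand:
  assumes "i < n" "j < n" "a < n" "b < n" "a \<noteq> b" "\<And>i j. B i j = B j i"
  shows "B i j = (\<Sum>x\<in>tri_pairs n. (B (fst x) (snd x) - (if x = (a, a) then B b b else 0)) * clone_unit a b x i j)"
proof -
  have ab: "(a, a) \<in> tri_pairs n" "(b, b) \<in> tri_pairs n" "(b, b) \<noteq> (a, a)"
    using assms by (auto simp: tri_pairs_def)
  let ?E = "\<lambda>x. sym_unit x i j"
  let ?B = "\<lambda>x. B (fst x) (snd x)"
  have "(\<Sum>x\<in>tri_pairs n. (?B x - (if x = (a, a) then B b b else 0)) * clone_unit a b x i j)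
      = (\<Sum>x\<in>tri_pairs n. ?B x * ?E x + (if x = (b, b) then B b b * ?E (a, a) else 0)
          - (if x = (a, a) then B b b * ?E (a, a) else 0))"
    using ab by (intro sum.cong refl) (auto simp: clone_unit_def algebra_simps)
  also have "\<dots> = (\<Sum>x\<in>tri_pairs n. ?B x * ?E x)"
    using ab by (simp add: sum.distrib sum_subtractf)
  also have "\<dots> = B i j" using symmetric_expand[OF assms(1,2), of B] assms(6) by simp
  finally show ?thesis by simp
qed

context inverse_pair
begin

text \<open>The restricted Gram matrix arises from the full one by deleting the row and column of \<open>(a, a)\<close>, so
  its determinant is the full determinant times a diagonal entry of the inverse Gram matrix. That
  entry is read off from the matrix \<open>Z = - S N S\<close>, where \<open>N\<close> is the conormal of the hyperplane: because
  \<open>tr (N S) = S a a - S b b = 0\<close>, the form with \<open>Z\<close> in one argument is the conormal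
  functional. Up to a constant the entry is the quadric \<open>(S b b)\<^sup>2 - (S a b)\<^sup>2\<close>, the residual factor of the Hessian.\<close>

lemma gdet_clone_gram:
  assumes xs: "distinct xs" "set xs = tri_pairs n - {(a, a)}"
    and ab: "a < n" "b < n" "a \<noteq> b" and S_eq: "S a a = S b b"
  shows "gdet ((a, a) # xs) (sym_square n S)
      * gdet xs (\<lambda>x y. hess_form n T (clone_unit a b x) (clone_unit a b y))
    = - 2 * (1 - of_nat n) * (\<Prod>x\<in>tri_pairs n. if fst x = snd x then - 1 else - 2) * ((S b b)\<^sup>2 - (S a b)\<^sup>2)"
proof -
  let ?ys = "(a, a) # xs"
  have tri: "(a, a) \<in> tri_pairs n" "(b, b) \<in> tri_pairs n" using ab by (auto simp: tri_pairs_def)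
  have ys: "distinct ?ys" "set ?ys = tri_pairs n" using xs tri by auto
  let ?H = "\<lambda>x y. hess_form n T (sym_unit x) (sym_unit y)"
  let ?M = "\<lambda>x y. hess_form n T (clone_unit a b x) (clone_unit a b y)"
  define C :: "nat \<times> nat \<Rightarrow> nat \<times> nat \<Rightarrow> 'a" where
    "C x z = (if x = z then 1 else 0) + (if x = (b, b) \<and> z = (a, a) then 1 else 0)" for x z
  have C: "clone_unit a b x = (\<lambda>k l. \<Sum>z\<in>set ?ys. C x z * sym_unit z k l)" if "x \<in> set ?ys" for x
  proof (intro ext)
    fix k l
    have "(\<Sum>z\<in>set ?ys. C x z * sym_unit z k l)
        = (\<Sum>z\<in>set ?ys. if z = x then sym_unit x k l else 0)
        + (\<Sum>z\<in>set ?ys. if z = (a, a) then if x = (b, b) then sym_unit (a, a) k l else 0 else 0)"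
      unfolding sum.distrib[symmetric] by (intro sum.cong refl) (auto simp: C_def)
    also have "\<dots> = clone_unit a b x k l"
      using that by (simp only: sum.delta finite_set if_True) (auto simp: clone_unit_def)
    finally show "clone_unit a b x k l = (\<Sum>z\<in>set ?ys. C x z * sym_unit z k l)" by simp
  qed
  have detC: "gdet ?ys C = 1"
  proof -
    have "gdet ?ys C = (\<Prod>x\<in>set ?ys. C x x)"
      by (rule gdet_ranked_triangular[OF ys(1), of "\<lambda>x. if x = (a, a) then 1 else 0"])
        (auto simp: C_def split: if_splits)
    also have "\<dots> = 1" using ab by (intro prod.neutral) (auto simp: C_def)
    finally show ?thesis .
  qed
  have "gdet ?ys ?M = gdet ?ys (\<lambda>x y. \<Sum>z\<in>set ?ys. C x z * hess_form n T (sym_unit z) (clone_unit a b y))"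
    by (rule gdet_cong) (simp only: C hess_form_linear_left)
  also have "\<dots> = gdet ?ys (\<lambda>z y. hess_form n T (sym_unit z) (clone_unit a b y))"
    by (simp only: gdet_mult[OF ys(1)] detC mult_1_left)
  also have "\<dots> = gdet ?ys (\<lambda>z y. \<Sum>w\<in>set ?ys. hess_form n T (sym_unit z) (sym_unit w) * C y w)"
    by (rule gdet_cong) (simp only: C hess_form_linear_right[OF T_sym] mult.commute)
  also have "\<dots> = gdet ?ys ?H * gdet ?ys (\<lambda>w y. C y w)"
    by (rule gdet_mult[OF ys(1)])
  finally have full: "gdet ?ys ?M = gdet ?ys ?H"
    by (simp only: gdet_transpose[of ?ys C] detC mult_1_right)

  \<comment> \<open>\<open>N\<close> represents the functional \<open>B \<mapsto> B a a - B b b\<close> for the trace form, and \<open>Z\<close> represents it for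
    the Hessian form.\<close>
  define N :: "nat \<Rightarrow> nat \<Rightarrow> 'a" where "N i j = sym_unit (a, a) i j - sym_unit (b, b) i j" for i j
  define Z where "Z i j = - congr n S N i j" for i j
  have N_sym: "N i j = N j i" for i j by (simp add: N_def sym_unit_sym[of _ i j])
  have Z_sym: "Z i j = Z j i" for i j using congr_sym[of N n S i j] N_sym by (simp add: Z_def)
  have pairing_N: "pairing n N A = A a a - A b b" if "\<And>i j. A i j = A j i" for A
  proof -
    have "N = (\<lambda>k l. \<Sum>x\<in>{(a, a), (b, b)}. (if x = (a, a) then 1 else - 1) * sym_unit x k l)"
      using ab by (auto simp: N_def fun_eq_iff)
    hence "pairing n N A = (\<Sum>x\<in>{(a, a), (b, b)}. (if x = (a, a) then 1 else - 1) * pairing n (sym_unit x) A)"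
      by (simp only: pairing_linear_left)
    thus ?thesis using ab tri that pairing_sym_unit_right[of "(a, a)" n A] pairing_sym_unit_right[of "(b, b)" n A]
      by (simp add: pairing_commute[of n _ A])
  qed
  have hess_Z: "hess_form n T Z B = B a a - B b b" if "\<And>i j. B i j = B j i" for B
  proof -
    have "Z = (\<lambda>k l. \<Sum>x\<in>{0::nat}. - 1 * congr n S N k l)"
      by (intro ext) (simp add: Z_def)
    hence "hess_form n T Z B = hess_form n T (\<lambda>k l. \<Sum>x\<in>{0::nat}. - 1 * congr n S N k l) B"
      by (simp only:)
    also have "\<dots> = - hess_form n T (congr n S N) B"
      by (subst hess_form_linear_left) simp
    also have "\<dots> = pairing n N B"
      using pairing_N[of S] S_sym S_eq by (simp add: hess_form_congr)
    finally show ?thesis using pairing_N that by simp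
  qed
  \<comment> \<open>\<open>R\<close> replaces the basis vector at \<open>(a, a)\<close> by \<open>Z\<close> in one argument of the form; the Gram matrix then
    has the first row \<open>(1, 0, \<dots>, 0)\<close>.\<close>
  define z where "z x = Z (fst x) (snd x) - (if x = (a, a) then Z b b else 0)" for x
  define R where "R x y = (if x = (a, a) then z y else if x = y then 1 else 0)" for x y
  have clone_sym: "clone_unit a b x i j = clone_unit a b x j i" for x i j
    by (simp add: clone_unit_def sym_unit_sym[of _ i j])
  have row: "(\<Sum>y\<in>set ?ys. R (a, a) y * ?M y x) = (if x = (a, a) then 1 else 0)" if "x \<in> set ?ys" for x
  proof -
    have "(\<Sum>y\<in>set ?ys. R (a, a) y * ?M y x)
        = hess_form n T (\<lambda>k l. \<Sum>y\<in>set ?ys. R (a, a) y * clone_unit a b y k l) (clone_unit a b x)"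
      by (simp only: hess_form_linear_left)
    also have "\<dots> = hess_form n T Z (clone_unit a b x)"
    proof (rule hess_form_cong)
      fix i j assume "i < n" "j < n"
      thus "(\<Sum>y\<in>set ?ys. R (a, a) y * clone_unit a b y i j) = Z i j"
        unfolding ys(2) using clone_unit_expand[where B = Z and b = b, of i n j a] ab Z_sym by (simp add: R_def z_def)
    qed simp
    also have "\<dots> = clone_unit a b x a a - clone_unit a b x b b"
      using clone_sym by (rule hess_Z)
    also have "\<dots> = (if x = (a, a) then 1 else 0)"
      using ab by (auto simp: clone_unit_def sym_unit_def)
    finally show ?thesis .
  qed
  have other: "(\<Sum>y\<in>set ?ys. R x y * ?M y w) = ?M x w" if "x \<in> set ?ys" "x \<noteq> (a, a)" for x w
  proof -
    have "(\<Sum>y\<in>set ?ys. R x y * ?M y w) = (\<Sum>y\<in>set ?ys. if y = x then ?M x w else 0)"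
      using that by (intro sum.cong refl) (auto simp: R_def)
    also have "\<dots> = ?M x w" using that(1) by (simp only: sum.delta finite_set if_True)
    finally show ?thesis .
  qed
  have notin: "y \<noteq> (a, a)" if "y \<in> set xs" for y using that xs by auto
  have "gdet ?ys R * gdet ?ys ?M = gdet ?ys (\<lambda>x w. \<Sum>y\<in>set ?ys. R x y * ?M y w)"
    by (rule gdet_mult[OF ys(1), symmetric])
  also have "\<dots> = gdet ?ys (\<lambda>x w. if x = (a, a) then if w = (a, a) then 1 else 0 else ?M x w)"
  proof (rule gdet_cong)
    fix x w assume xw: "x \<in> set ?ys" "w \<in> set ?ys"
    show "(\<Sum>y\<in>set ?ys. R x y * ?M y w) = (if x = (a, a) then if w = (a, a) then 1 else 0 else ?M x w)"
    proof (cases "x = (a, a)")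
      case True
      show ?thesis unfolding True using row[OF xw(2)] by (simp only: refl if_True)
    next
      case False
      show ?thesis using other[OF xw(1) False] False by (simp only: if_False)
    qed
  qed
  also have "\<dots> = gdet xs (\<lambda>x w. if x = (a, a) then if w = (a, a) then 1 else 0 else ?M x w)"
    by (subst gdet_Cons_row) (auto dest: notin)
  also have "\<dots> = gdet xs ?M" by (rule gdet_cong) (auto dest: notin)
  finally have restricted: "gdet xs ?M = gdet ?ys R * gdet ?ys ?M" by simp
  have "gdet ?ys R = z (a, a) * gdet xs R"
    by (subst gdet_Cons_col) (auto dest: notin simp: R_def)
  also have "gdet xs R = gdet xs (\<lambda>x y. if x = y then 1 else 0)"
    by (rule gdet_cong) (auto dest: notin simp: R_def)
  also have "\<dots> = 1" using gdet_diagonal[OF xs(1), of "\<lambda>_. 1"] by simp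
  finally have "gdet ?ys R = Z a a - Z b b" by (simp add: z_def)
  moreover have "congr n S N i i = (S i a)\<^sup>2 - (S i b)\<^sup>2" for i
  proof -
    have "N = (\<lambda>k l. \<Sum>x\<in>{(a, a), (b, b)}. (if x = (a, a) then 1 else - 1) * sym_unit x k l)"
      using ab by (auto simp: N_def fun_eq_iff)
    hence "congr n S N i i = (\<Sum>x\<in>{(a, a), (b, b)}. (if x = (a, a) then 1 else - 1) * congr n S (sym_unit x) i i)"
      by (simp only: congr_linear)
    thus ?thesis using ab by (simp add: congr_sym_unit power2_eq_square)
  qed
  ultimately have R: "gdet ?ys R = - 2 * ((S b b)\<^sup>2 - (S a b)\<^sup>2)"
    using S_eq S_sym[of b a] by (simp add: Z_def)
  have "gdet ?ys (sym_square n S) * gdet xs ?M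
      = gdet ?ys R * (gdet ?ys (sym_square n S) * gdet ?ys ?H)"
    by (simp only: restricted full mult_ac)
  also have "gdet ?ys (sym_square n S) * gdet ?ys ?H
      = (\<Prod>x\<in>tri_pairs n. if fst x = snd x then - 1 else - 2) * (1 - of_nat n)"
    by (rule gdet_gram[OF ys])
  finally show ?thesis by (simp only: R mult_ac)
qed

end

section \<open>Derivatives of determinants\<close>

lemma cofactor_symmetric:
  assumes A: "A \<in> carrier_mat n n" and sym: "\<And>i j. i < n \<Longrightarrow> j < n \<Longrightarrow> A $$ (i, j) = A $$ (j, i)"
  shows "cofactor A i j = cofactor A j i"
proof -
  have "mat_delete A j i = transpose_mat (mat_delete A i j)"
    by (rule eq_matI) (use A in \<open>auto simp: mat_delete_def intro!: sym\<close>)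
  moreover have "det (transpose_mat (mat_delete A i j)) = det (mat_delete A i j)"
    by (rule det_transpose[OF mat_delete_carrier[OF A]])
  ultimately show ?thesis by (simp add: cofactor_def add.commute)
qed

lemma cofactor_expansion_row:
  assumes A: "A \<in> carrier_mat n n" and "i < n" "j < n"
  shows "(\<Sum>k<n. A $$ (i, k) * cofactor A j k) = (if i = j then det A else 0)"
proof -
  have "(A * adj_mat A) $$ (i, j) = (\<Sum>k<n. A $$ (i, k) * cofactor A j k)"
    using assms by (auto simp: scalar_prod_def adj_mat_def lessThan_atLeast0)
  thus ?thesis using adj_mat(2)[OF A] assms by (auto split: if_splits)
qed

lemma cofactor_expansion_col:
  assumes A: "A \<in> carrier_mat n n" and "i < n" "j < n"
  shows "(\<Sum>k<n. cofactor A k i * A $$ (k, j)) = (if i = j then det A else 0)"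
proof -
  have "(adj_mat A * A) $$ (i, j) = (\<Sum>k<n. cofactor A k i * A $$ (k, j))"
    using assms by (auto simp: scalar_prod_def adj_mat_def lessThan_atLeast0)
  thus ?thesis using adj_mat(3)[OF A] assms by (auto split: if_splits)
qed

context derivation
begin

text \<open>Jacobi's formula: by the product rule the Leibniz formula is differentiated one row at a time,
  and each summand is expanded along the differentiated row.\<close>

lemma det_derivative:
  assumes A: "A \<in> carrier_mat n n"
  shows "\<delta> (det A) = (\<Sum>i<n. \<Sum>j<n. \<delta> (A $$ (i, j)) * cofactor A i j)"
proof -
  define B where "B k = mat n n (\<lambda>(i, j). if i = k then \<delta> (A $$ (i, j)) else A $$ (i, j))" for k
  let ?P = "{p. p permutes {0..<n}}"
  have sgn: "\<delta> (signof p * x) = signof p * \<delta> x" for p :: "nat \<Rightarrow> nat" and x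
    by (simp add: sign_def uminus)
  have "\<delta> (det A) = (\<Sum>p\<in>?P. signof p * (\<Sum>k\<in>{0..<n}. \<Prod>i = 0..<n. if i = k then \<delta> (A $$ (i, p i)) else A $$ (i, p i)))"
    unfolding det_def'[OF A] sum sgn by (simp add: prod)
  also have "\<dots> = (\<Sum>k\<in>{0..<n}. \<Sum>p\<in>?P. signof p * (\<Prod>i = 0..<n. if i = k then \<delta> (A $$ (i, p i)) else A $$ (i, p i)))"
    unfolding sum_distrib_left by (rule sum.swap)
  also have "\<dots> = (\<Sum>k\<in>{0..<n}. det (B k))"
  proof (rule sum.cong[OF refl])
    fix k
    have B: "B k \<in> carrier_mat n n" by (simp add: B_def)
    show "(\<Sum>p\<in>?P. signof p * (\<Prod>i = 0..<n. if i = k then \<delta> (A $$ (i, p i)) else A $$ (i, p i))) = det (B k)"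
      unfolding det_def'[OF B]
    proof (intro sum.cong refl arg_cong2[where f = "(*)"] prod.cong)
      fix p i assume "p \<in> ?P" "i \<in> {0..<n}"
      hence "p i < n" using permutes_in_image[of p "{0..<n}" i] by auto
      thus "(if i = k then \<delta> (A $$ (i, p i)) else A $$ (i, p i)) = B k $$ (i, p i)"
        using \<open>i \<in> {0..<n}\<close> by (simp add: B_def)
    qed
  qed
  also have "\<dots> = (\<Sum>k<n. \<Sum>j<n. \<delta> (A $$ (k, j)) * cofactor A k j)"
    unfolding lessThan_atLeast0[symmetric]
  proof (rule sum.cong[OF refl])
    fix k assume "k \<in> {..<n}"
    hence k: "k < n" by simp
    have "det (B k) = (\<Sum>j<n. B k $$ (k, j) * cofactor (B k) k j)"
      by (rule laplace_expansion_row[OF _ k]) (simp add: B_def)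
    also have "\<dots> = (\<Sum>j<n. \<delta> (A $$ (k, j)) * cofactor A k j)"
    proof (intro sum.cong refl arg_cong2[where f = "(*)"])
      fix j assume "j \<in> {..<n}"
      thus "B k $$ (k, j) = \<delta> (A $$ (k, j))" using k by (simp add: B_def)
      have "mat_delete (B k) k j = mat_delete A k j"
        by (rule eq_matI) (use A k in \<open>auto simp: mat_delete_def B_def\<close>)
      thus "cofactor (B k) k j = cofactor A k j" by (simp add: cofactor_def)
    qed
    finally show "det (B k) = (\<Sum>j<n. \<delta> (A $$ (k, j)) * cofactor A k j)" .
  qed
  finally show ?thesis .
qed

text \<open>Differentiate \<open>A * adj A = det A * I\<close> and multiply by the adjugate from the left, which avoids
  inverting \<open>A\<close>.\<close>

lemma det_times_cofactor_derivative:
  assumes A: "A \<in> carrier_mat n n" and "i < n" "j < n"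
  shows "det A * \<delta> (cofactor A j i) = \<delta> (det A) * cofactor A j i
    - (\<Sum>k<n. \<Sum>l<n. cofactor A k i * \<delta> (A $$ (k, l)) * cofactor A j l)"
proof -
  have row: "(\<Sum>l<n. A $$ (k, l) * \<delta> (cofactor A j l))
      = (if k = j then \<delta> (det A) else 0) - (\<Sum>l<n. \<delta> (A $$ (k, l)) * cofactor A j l)" if "k < n" for k
  proof -
    have "(if k = j then \<delta> (det A) else 0) = \<delta> (\<Sum>l<n. A $$ (k, l) * cofactor A j l)"
      using cofactor_expansion_row[OF A that \<open>j < n\<close>] by simp
    also have "\<dots> = (\<Sum>l<n. \<delta> (A $$ (k, l)) * cofactor A j l) + (\<Sum>l<n. A $$ (k, l) * \<delta> (cofactor A j l))"
      by (simp add: sum mult Groups_Big.comm_monoid_add_class.sum.distrib)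
    finally show ?thesis by simp
  qed
  have "det A * \<delta> (cofactor A j i) = (\<Sum>l<n. if i = l then det A * \<delta> (cofactor A j l) else 0)"
    using \<open>i < n\<close> by simp
  also have "\<dots> = (\<Sum>l<n. \<Sum>k<n. cofactor A k i * A $$ (k, l) * \<delta> (cofactor A j l))"
    using cofactor_expansion_col[OF A \<open>i < n\<close>]
    by (intro sum.cong refl) (auto simp: sum_distrib_right[symmetric])
  also have "\<dots> = (\<Sum>k<n. cofactor A k i * (\<Sum>l<n. A $$ (k, l) * \<delta> (cofactor A j l)))"
    by (subst sum.swap) (simp add: sum_distrib_left mult.assoc)
  also have "\<dots> = (\<Sum>k<n. (if k = j then \<delta> (det A) * cofactor A j i else 0)
      - (\<Sum>l<n. cofactor A k i * \<delta> (A $$ (k, l)) * cofactor A j l))"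
    by (intro sum.cong refl) (auto simp: row sum_distrib_left right_diff_distrib mult_ac)
  also have "\<dots> = \<delta> (det A) * cofactor A j i
      - (\<Sum>k<n. \<Sum>l<n. cofactor A k i * \<delta> (A $$ (k, l)) * cofactor A j l)"
    using \<open>j < n\<close> by (simp add: sum_subtractf)
  finally show ?thesis .
qed

end

text \<open>For a matrix with linear entries the second derivative comes from differentiating the cofactors
  in Jacobi's formula; after multiplication by \<open>det A\<close> it is the Hessian form of the adjugate.\<close>

lemma det_times_second_derivative:
  assumes "derivation \<delta>" "derivation \<epsilon>"
    and A: "A \<in> carrier_mat n n" and sym: "\<And>i j. i < n \<Longrightarrow> j < n \<Longrightarrow> A $$ (i, j) = A $$ (j, i)"
    and linear: "\<And>i j. i < n \<Longrightarrow> j < n \<Longrightarrow> \<delta> (\<epsilon> (A $$ (i, j))) = 0"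
  shows "det A * \<delta> (\<epsilon> (det A))
    = hess_form n (cofactor A) (\<lambda>i j. \<delta> (A $$ (i, j))) (\<lambda>i j. \<epsilon> (A $$ (i, j)))"
proof -
  interpret \<delta>: derivation \<delta> by fact
  interpret \<epsilon>: derivation \<epsilon> by fact
  let ?U = "cofactor A" and ?B = "\<lambda>i j. \<delta> (A $$ (i, j))" and ?C = "\<lambda>i j. \<epsilon> (A $$ (i, j))"
  note U_sym = cofactor_symmetric[OF A sym]
  have pair: "(\<Sum>i<n. \<Sum>j<n. D i j * ?U i j) = pairing n ?U D" for D
    unfolding pairing_def by (subst sum.swap) (intro sum.cong refl, metis U_sym mult.commute)
  have "det A * \<delta> (\<epsilon> (det A)) = (\<Sum>i<n. \<Sum>j<n. ?C i j * (det A * \<delta> (?U i j)))"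
    by (simp add: \<epsilon>.det_derivative[OF A] \<delta>.sum \<delta>.mult linear sum_distrib_left mult_ac)
  also have "\<dots> = (\<Sum>i<n. \<Sum>j<n. \<delta> (det A) * (?C i j * ?U i j) - ?C i j * congr n ?U ?B j i)"
  proof (intro sum.cong refl)
    fix i j assume "i \<in> {..<n}" "j \<in> {..<n}"
    hence "det A * \<delta> (?U i j) = \<delta> (det A) * ?U i j - congr n ?U ?B j i"
      using \<delta>.det_times_cofactor_derivative[OF A, of j i]
      by (simp add: congr_def U_sym[of _ j])
    thus "?C i j * (det A * \<delta> (?U i j)) = \<delta> (det A) * (?C i j * ?U i j) - ?C i j * congr n ?U ?B j i"
      by (simp add: right_diff_distrib mult_ac)
  qed
  also have "\<dots> = \<delta> (det A) * pairing n ?U ?C - pairing n ?C (congr n ?U ?B)"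
    by (simp add: sum_subtractf sum_distrib_left[symmetric] pair) (simp add: pairing_def)
  finally show ?thesis
    by (simp add: hess_form_def \<delta>.det_derivative[OF A] pair pairing_commute[of n ?C])
qed

section \<open>The Hessian of the cloned determinant\<close>

lemma card_tri_pairs: "card (tri_pairs n) = (n choose 2) + n"
proof (induction n)
  case 0
  show ?case by (simp add: tri_pairs_def)
next
  case (Suc n)
  have "tri_pairs (Suc n) = tri_pairs n \<union> (\<lambda>i. (i, n)) ` {..n}"
    by (auto simp: tri_pairs_def)
  moreover have "tri_pairs n \<inter> (\<lambda>i. (i, n)) ` {..n} = {}"
    by (auto simp: tri_pairs_def)
  ultimately have "card (tri_pairs (Suc n)) = card (tri_pairs n) + card ((\<lambda>i. (i, n)) ` {..n})"
    by (simp add: card_Un_disjoint)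
  also have "card ((\<lambda>i. (i, n)) ` {..n}) = Suc n"
    by (subst card_image) (auto simp: inj_on_def)
  finally show ?case using Suc.IH by (simp add: numeral_2_eq_2)
qed

lemma hess_form_hom:
  assumes "comm_ring_hom h"
  shows "h (hess_form n T A B) = hess_form n (\<lambda>i j. h (T i j)) (\<lambda>i j. h (A i j)) (\<lambda>i j. h (B i j))"
proof -
  interpret comm_ring_hom h by fact
  show ?thesis by (simp add: hess_form_def pairing_def congr_def hom_distribs)
qed

lemma hess_form_scale:
  "hess_form n (\<lambda>i j. d * T i j) A B = d\<^sup>2 * hess_form n T A B"
proof -
  have "pairing n (\<lambda>i j. d * T i j) D = d * pairing n T D" for D
    by (simp add: pairing_def sum_distrib_left mult_ac)
  moreover have "pairing n (congr n (\<lambda>i j. d * T i j) A) B = d\<^sup>2 * pairing n (congr n T A) B"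
    by (simp add: pairing_def congr_def sum_distrib_left sum_distrib_right power2_eq_square mult_ac)
  ultimately show ?thesis by (simp add: hess_form_def power2_eq_square algebra_simps)
qed

locale diagonal_cloning =
  fixes m a b :: nat
  assumes m: "3 \<le> m" and a: "a < m" and b: "b < m" and ab: "a \<noteq> b"
begin

definition clone_var :: "nat \<Rightarrow> nat \<Rightarrow> nat \<times> nat" where
  "clone_var i j = (if (min i j, max i j) = (a, a) then (b, b) else (min i j, max i j))"

lemma clone_var_sym: "clone_var i j = clone_var j i"
  by (simp add: clone_var_def min.commute max.commute)

lemma md_clone_carrier: "(md_clone m a b :: (nat \<times> nat, 'k::comm_ring_1) mpoly mat) \<in> carrier_mat m m"
  by (simp add: md_clone_def gen_sym_mat_def)

lemma md_clone_index:
  "i < m \<Longrightarrow> j < m \<Longrightarrow> (md_clone m a b :: (nat \<times> nat, 'k::comm_ring_1) mpoly mat) $$ (i, j) = Var (clone_var i j)"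
  by (simp add: md_clone_def gen_sym_mat_def md_endo_def clone_var_def mp_subst_Var
      comm_ring_hom_Const[THEN comm_ring_hom.axioms(1)] Const_def)

lemma set_md_vars: "set (md_vars m a) = tri_pairs m - {(a, a)}"
  by (auto simp: md_vars_def tri_pairs_def)

lemma distinct_md_vars: "distinct (md_vars m a)"
proof -
  have "distinct (concat (map (\<lambda>i. concat (map (\<lambda>j. if (i, j) \<noteq> (a, a) then [(i, j)] else []) (js i))) is))"
    if "distinct is" "\<And>i. distinct (js i)" for "is" and js :: "nat \<Rightarrow> nat list"
    using that(1)
  proof (induction "is")
    case (Cons i "is")
    have "distinct (concat (map (\<lambda>j. if (i, j) \<noteq> (a, a) then [(i, j)] else []) js))" if "distinct js" for js
      using that by (induction js) auto
    thus ?case using Cons that(2) by (auto split: if_splits)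
  qed simp
  from this[of "[0..<m]" "\<lambda>i. [i..<m]"] show ?thesis by (simp add: md_vars_def)
qed

lemma choose_ge_2: "2 \<le> m choose 2"
proof -
  have "3 * 2 \<le> m * (m - 1)" by (rule mult_le_mono) (use m in auto)
  thus ?thesis by (simp add: choose_two)
qed

text \<open>The number of variables is written in the form needed to split off the power \<open>m + 1\<close> that stems
  from the second symmetric power.\<close>

lemma length_md_vars: "length (md_vars m a) = ((m choose 2) - 2) + (m + 1)"
proof -
  have "length (md_vars m a) = card (tri_pairs m - {(a, a)})"
    using distinct_card[OF distinct_md_vars] set_md_vars by simp
  also have "\<dots> = (m choose 2) + m - 1"
  proof -
    have "(a, a) \<in> tri_pairs m" using a by (simp add: tri_pairs_def)
    thus ?thesis by (simp add: card_tri_pairs)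
  qed
  finally show ?thesis using choose_ge_2 by simp
qed

lemma clone_var_in_md_vars: "i < m \<Longrightarrow> j < m \<Longrightarrow> clone_var i j \<in> set (md_vars m a)"
  using a b ab by (auto simp: clone_var_def set_md_vars tri_pairs_def)

lemma pderiv_md_clone:
  assumes "x \<in> set (md_vars m a)" "i < m" "j < m"
  shows "pderiv_in x ((md_clone m a b :: (nat \<times> nat, 'k::comm_ring_1) mpoly mat) $$ (i, j))
    = clone_unit a b x i j"
  using assms ab by (auto simp: md_clone_index pderiv_in_Var clone_var_def clone_unit_def sym_unit_def set_md_vars)

lemma det_md_clone_polys_in:
  "det (md_clone m a b :: (nat \<times> nat, 'k::comm_ring_1) mpoly mat) \<in> polys_in (set (md_vars m a))"
  by (rule polys_in_det[OF md_clone_carrier])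
    (simp add: md_clone_index polys_in_Var clone_var_in_md_vars)

lemma eval_det_md_clone:
  fixes \<phi> :: "'k::comm_ring_1 \<Rightarrow> 'c::comm_ring_1"
  assumes "comm_ring_hom \<phi>"
  shows "mp_subst \<phi> p (det (md_clone m a b)) = det (mat m m (\<lambda>(i, j). p (clone_var i j)))"
proof -
  interpret ev: comm_ring_hom "mp_subst \<phi> p" by (rule comm_ring_hom_mp_subst[OF assms])
  interpret \<phi>: comm_ring_hom \<phi> by fact
  show ?thesis unfolding ev.hom_det[symmetric] using md_clone_carrier
    by (intro arg_cong[of _ _ det] eq_matI) (auto simp: md_clone_index mp_subst_Var)
qed

lemma det_times_hessian_entry:
  fixes f :: "(nat \<times> nat, 'k::comm_ring_1) mpoly"
  assumes "f = det (md_clone m a b)" "x \<in> set (md_vars m a)" "y \<in> set (md_vars m a)"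
  shows "f * pderiv_in x (pderiv_in y f)
    = hess_form m (cofactor (md_clone m a b)) (clone_unit a b x) (clone_unit a b y)"
proof -
  let ?M = "md_clone m a b :: (nat \<times> nat, 'k) mpoly mat"
  have const: "pderiv_in x (clone_unit a b y i j :: (nat \<times> nat, 'k) mpoly) = 0" for i j
  proof -
    interpret derivation "pderiv_in x :: (nat \<times> nat, 'k) mpoly \<Rightarrow> _" by (rule derivation_pderiv_in)
    show ?thesis by (simp add: clone_unit_def sym_unit_def add)
  qed
  have M_sym: "?M $$ (i, j) = ?M $$ (j, i)" if "i < m" "j < m" for i j
    using that clone_var_sym[of i j] by (simp add: md_clone_index)
  have "f * pderiv_in x (pderiv_in y f) = hess_form m (cofactor ?M)
      (\<lambda>i j. pderiv_in x (?M $$ (i, j))) (\<lambda>i j. pderiv_in y (?M $$ (i, j)))"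
    unfolding assms(1)
    by (rule det_times_second_derivative[OF derivation_pderiv_in derivation_pderiv_in md_clone_carrier M_sym])
      (simp_all add: pderiv_md_clone[OF assms(3)] const)
  also have "\<dots> = hess_form m (cofactor ?M) (clone_unit a b x) (clone_unit a b y)"
    by (rule hess_form_cong) (simp_all add: pderiv_md_clone assms)
  finally show ?thesis .
qed

definition hessian_constant :: "'k::field_char_0" where
  "hessian_constant = - 2 * (1 - of_nat m) * (\<Prod>x\<in>tri_pairs m. if fst x = snd x then - 1 else - 2)"

lemma hessian_constant_nonzero: "(hessian_constant :: 'k::field_char_0) \<noteq> 0"
proof -
  have "(of_nat m :: 'k) \<noteq> of_nat 1" using m by (subst of_nat_eq_iff) simp
  thus ?thesis by (simp add: hessian_constant_def)
qed

text \<open>At a point \<open>p\<close> where the cloned matrix \<open>S\<close> is invertible, with inverse \<open>T\<close>, each entry of the Hessian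
  is \<open>det S\<close> times the Hessian form of \<open>T\<close>. Taking determinants gives one factor \<open>det S\<close> for each
  variable, and the Gram determinant takes away \<open>m + 1\<close> of them.\<close>

lemma eval_hessian_det:
  fixes f :: "(nat \<times> nat, 'k::field_char_0) mpoly"
  assumes f: "f = det (md_clone m a b)" and nz: "mp_subst id p f \<noteq> 0"
  shows "mp_subst id p (hessian_det (md_vars m a) f) =
    hessian_constant * mp_subst id p f ^ ((m choose 2) - 2) * ((p (b, b))\<^sup>2 - (p (min a b, max a b))\<^sup>2)"
proof -
  let ?ev = "mp_subst id p :: (nat \<times> nat, 'k) mpoly \<Rightarrow> 'k" and ?xs = "md_vars m a"
  let ?M = "md_clone m a b :: (nat \<times> nat, 'k) mpoly mat"
  interpret ev: comm_ring_hom ?ev by (rule comm_ring_hom_mp_subst[OF comm_ring_hom_id])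
  define d where "d = ?ev f"
  define S where "S i j = p (clone_var i j)" for i j
  define T where "T i j = ?ev (cofactor ?M i j) / d" for i j
  have M_sym: "?M $$ (i, j) = ?M $$ (j, i)" if "i < m" "j < m" for i j
    using that clone_var_sym[of i j] by (simp add: md_clone_index)
  note cofactor_sym = cofactor_symmetric[OF md_clone_carrier M_sym]
  have ev_M: "?ev (?M $$ (i, j)) = S i j" if "i < m" "j < m" for i j
    using that by (simp add: md_clone_index mp_subst_Var S_def)
  interpret inverse_pair m S T
  proof
    show "S i j = S j i" for i j using clone_var_sym[of i j] by (simp add: S_def)
    show "T i j = T j i" for i j
      using cofactor_sym[of i j] by (simp only: T_def)
    show "(\<Sum>k<m. T i k * S k j) = (if i = j then 1 else 0)" if "i < m" "j < m" for i j
    proof -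
      have "d * (\<Sum>k<m. T i k * S k j) = (\<Sum>k<m. ?ev (cofactor ?M k i) * ?ev (?M $$ (k, j)))"
        unfolding sum_distrib_left
      proof (rule sum.cong[OF refl])
        fix k assume "k \<in> {..<m}"
        thus "d * (T i k * S k j) = ?ev (cofactor ?M k i) * ?ev (?M $$ (k, j))"
          using that nz cofactor_sym[of i k] by (simp add: T_def ev_M d_def)
      qed
      also have "\<dots> = ?ev (\<Sum>k<m. cofactor ?M k i * ?M $$ (k, j))"
        by (simp add: ev.hom_sum ev.hom_mult)
      also have "\<dots> = (if i = j then d else 0)"
        using that by (simp add: cofactor_expansion_col[OF md_clone_carrier] d_def f)
      finally show ?thesis using nz by (auto simp: d_def split: if_splits)
    qed
  qed
  have clone_hom: "?ev (clone_unit a b x i j) = clone_unit a b x i j" for x i j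
    by (simp add: clone_unit_def sym_unit_def ev.hom_add)
  have entry: "?ev (pderiv_in x (pderiv_in y f)) = d * hess_form m T (clone_unit a b x) (clone_unit a b y)"
    if "x \<in> set ?xs" "y \<in> set ?xs" for x y
  proof -
    have "d * ?ev (pderiv_in x (pderiv_in y f)) = ?ev (f * pderiv_in x (pderiv_in y f))"
      by (simp add: d_def ev.hom_mult)
    also have "\<dots> = hess_form m (\<lambda>i j. ?ev (cofactor ?M i j)) (clone_unit a b x) (clone_unit a b y)"
      unfolding det_times_hessian_entry[OF f that]
      by (simp add: hess_form_hom[OF ev.comm_ring_hom_axioms] clone_hom)
    also have "(\<lambda>i j. ?ev (cofactor ?M i j)) = (\<lambda>i j. d * T i j)"
      using nz by (simp add: T_def d_def)
    finally have "d * ?ev (pderiv_in x (pderiv_in y f))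
        = d * (d * hess_form m T (clone_unit a b x) (clone_unit a b y))"
      by (simp only: hess_form_scale power2_eq_square mult.assoc)
    thus ?thesis using nz unfolding d_def[symmetric] by (metis mult_left_cancel)
  qed
  have "?ev (hessian_det ?xs f) = gdet ?xs (\<lambda>x y. ?ev (pderiv_in x (pderiv_in y f)))"
  proof -
    have "hessian_det ?xs f = gdet ?xs (\<lambda>x y. pderiv_in x (pderiv_in y f))"
      by (simp add: hessian_det_def hessian_mat_def gdet_def)
    thus ?thesis by (simp only: gdet_hom[OF ev.comm_ring_hom_axioms])
  qed
  also have "\<dots> = gdet ?xs (\<lambda>x y. d * hess_form m T (clone_unit a b x) (clone_unit a b y))"
    by (rule gdet_cong) (rule entry)
  finally have h: "?ev (hessian_det ?xs f) = d ^ length ?xs * gdet ?xs (\<lambda>x y. hess_form m T (clone_unit a b x) (clone_unit a b y))"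
    by (simp add: gdet_scale)
  have "gdet ((a, a) # ?xs) (sym_square m S) = gdet ((a, a) # ?xs) (sym_square m (\<lambda>i j. mat m m (\<lambda>(i, j). S i j) $$ (i, j)))"
  proof (rule gdet_cong)
    fix y x assume "y \<in> set ((a, a) # ?xs)" "x \<in> set ((a, a) # ?xs)"
    hence "fst y < m" "snd y < m" using a by (auto simp: set_md_vars tri_pairs_def)
    thus "sym_square m S y x = sym_square m (\<lambda>i j. mat m m (\<lambda>(i, j). S i j) $$ (i, j)) y x"
      unfolding sym_square_def congr_def by (intro sum.cong refl) auto
  qed
  also have "\<dots> = det (mat m m (\<lambda>(i, j). S i j)) ^ (m + 1)"
    by (rule gdet_sym_square) (use distinct_md_vars set_md_vars a in \<open>auto simp: tri_pairs_def\<close>)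
  also have "det (mat m m (\<lambda>(i, j). S i j)) = d"
    by (simp add: d_def f eval_det_md_clone[OF comm_ring_hom_id] S_def)
  finally have chi: "gdet ((a, a) # ?xs) (sym_square m S) = d ^ (m + 1)" .
  have S_bb: "S a a = S b b" "S b b = p (b, b)" "S a b = p (min a b, max a b)"
    using ab by (auto simp: S_def clone_var_def)
  have "d ^ (m + 1) * ?ev (hessian_det ?xs f) = d ^ length ?xs *
      (d ^ (m + 1) * gdet ?xs (\<lambda>x y. hess_form m T (clone_unit a b x) (clone_unit a b y)))"
    by (simp add: h)
  also have "\<dots> = d ^ length ?xs * (hessian_constant * ((S b b)\<^sup>2 - (S a b)\<^sup>2))"
    using gdet_clone_gram[OF distinct_md_vars set_md_vars a b ab S_bb(1)]
    by (simp only: chi hessian_constant_def)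
  also have "\<dots> = d ^ (m + 1) * (hessian_constant * d ^ ((m choose 2) - 2) * ((S b b)\<^sup>2 - (S a b)\<^sup>2))"
    by (simp only: length_md_vars power_add mult_ac)
  finally show ?thesis using nz by (simp add: d_def[symmetric] S_bb(2,3))
qed

lemma det_md_clone_nonzero: "det (md_clone m a b :: (nat \<times> nat, 'k::field) mpoly mat) \<noteq> 0"
proof
  assume "det (md_clone m a b :: (nat \<times> nat, 'k) mpoly mat) = 0"
  hence "mp_subst (id :: 'k \<Rightarrow> 'k) (\<lambda>(i, j). if i = j then 1 else 0) (det (md_clone m a b)) = 0"
    by (simp add: mp_subst_def)
  moreover have "mat m m (\<lambda>(i, j). (\<lambda>(i, j). if i = j then 1 else 0) (clone_var i j)) = (1\<^sub>m m :: 'k mat)"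
    by (rule eq_matI) (auto simp: clone_var_def min_def max_def)
  ultimately show False by (simp add: eval_det_md_clone[OF comm_ring_hom_id])
qed

text \<open>The pointwise formula holds wherever \<open>f\<close> does not vanish, and a nonzero difference of both sides
  would not vanish at some such point.\<close>

lemma hessian_det_md_clone:
  fixes f :: "(nat \<times> nat, 'k::field_char_0) mpoly"
  assumes f: "f = det (md_clone m a b)"
  shows "hessian_det (md_vars m a) f =
    f ^ ((m choose 2) - 2) * (Const hessian_constant * (Var (b, b) ^ 2 - Var (min a b, max a b) ^ 2))"
    (is "?h = ?r")
proof (rule ccontr)
  assume neq: "?h \<noteq> ?r"
  define D where "D = ?h - ?r"
  have nonzero: "0 \<notin> {D, f}" using det_md_clone_nonzero neq f by (auto simp: D_def)
  have "finite {D, f}" by simp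
  from finite_family_generic_point[OF infinite_UNIV_char_0 this nonzero] obtain p
    where p: "(\<forall>x. p x \<noteq> 0) \<and> (\<forall>q\<in>{D, f}. mp_subst id p q \<noteq> 0)" by (rule exE)
  hence nz: "mp_subst id p f \<noteq> 0" and "mp_subst id p D \<noteq> 0" by simp_all
  interpret ev: comm_ring_hom "mp_subst id p :: (nat \<times> nat, 'k) mpoly \<Rightarrow> 'k"
    by (rule comm_ring_hom_mp_subst[OF comm_ring_hom_id])
  have "mp_subst id p D = mp_subst id p ?h - mp_subst id p ?r"
    unfolding D_def by (rule ev.hom_minus)
  also have "mp_subst id p ?r = mp_subst id p ?h"
    unfolding eval_hessian_det[OF f nz]
    by (simp only: ev.hom_minus ev.hom_mult ev.hom_power mp_subst_Var[of id, OF id_apply id_apply]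
      mp_subst_Const[of id, OF id_apply] id_apply mult_ac)
  finally have "mp_subst id p D = 0" by (simp only: diff_self)
  with \<open>mp_subst id p D \<noteq> 0\<close> show False by contradiction
qed

text \<open>A larger power is excluded by the specialization that sends the matrix to \<open>t\<close> times the identity:
  \<open>f\<close> becomes \<open>t ^ m\<close> with \<open>m \<ge> 3\<close>, but the residual quadric only becomes \<open>t\<^sup>2\<close>.\<close>

lemma has_effective_multiplicity_md_clone:
  fixes f :: "(nat \<times> nat, 'k::field_char_0) mpoly"
  assumes f: "f = det (md_clone m a b)"
  shows "has_effective_multiplicity (md_vars m a) f ((m choose 2) - 2)"
  unfolding has_effective_multiplicity_def
proof (intro conjI allI impI)
  let ?g = "Const hessian_constant * (Var (b, b) ^ 2 - Var (min a b, max a b) ^ 2) :: (nat \<times> nat, 'k) mpoly"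
  have vars: "(b, b) \<in> set (md_vars m a)" "(min a b, max a b) \<in> set (md_vars m a)"
    using a b ab by (auto simp: set_md_vars tri_pairs_def)
  hence "?g \<in> polys_in (set (md_vars m a))"
    by (intro polys_in_mult polys_in_diff polys_in_power polys_in_Var polys_in_Const)
  thus "dvd_in (set (md_vars m a)) (f ^ ((m choose 2) - 2)) (hessian_det (md_vars m a) f)"
    unfolding dvd_in_def hessian_det_md_clone[OF f] by blast
next
  fix e assume "dvd_in (set (md_vars m a)) (f ^ e) (hessian_det (md_vars m a) f)"
  then obtain r where r: "hessian_det (md_vars m a) f = f ^ e * r" by (auto simp: dvd_in_def)
  define t where "t = [:0, 1 :: 'k:]"
  have "comm_ring_hom (\<lambda>c :: 'k. [:c:])" by unfold_locales (auto simp: one_pCons)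
  note hom = comm_ring_hom_mp_subst[OF this, of "(\<lambda>(i, j). if i = j then t else 0) :: nat \<times> nat \<Rightarrow> 'k poly"]
  let ?\<psi> = "mp_subst (\<lambda>c. [:c:]) ((\<lambda>(i, j). if i = j then t else 0) :: nat \<times> nat \<Rightarrow> 'k poly)"
  interpret \<psi>: comm_ring_hom ?\<psi> by (rule hom)
  have "mat m m (\<lambda>(i, j). (\<lambda>(i, j). if i = j then t else 0) (clone_var i j)) = t \<cdot>\<^sub>m 1\<^sub>m m"
    by (rule eq_matI) (auto simp: clone_var_def min_def max_def)
  hence \<psi>f: "?\<psi> f = t ^ m"
    unfolding f by (subst eval_det_md_clone) (use \<open>comm_ring_hom (\<lambda>c. [:c:])\<close> in auto)
  have "?\<psi> (f ^ e * r) = t ^ (m * ((m choose 2) - 2)) * ([:hessian_constant:] * t ^ 2)"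
    unfolding r[symmetric] hessian_det_md_clone[OF f] using ab
    by (simp add: \<psi>.hom_mult \<psi>.hom_power \<psi>.hom_minus \<psi>f mp_subst_Const mp_subst_Var one_pCons
        power_mult[symmetric] min_def max_def)
  hence "t ^ (m * e) * ?\<psi> r = [:hessian_constant:] * t ^ (m * ((m choose 2) - 2) + 2)"
    by (simp add: \<psi>.hom_mult \<psi>.hom_power \<psi>f power_mult[symmetric] power_add power2_eq_square mult_ac)
  moreover have "Polynomial.degree ([:hessian_constant:] * t ^ k) = k" "[:hessian_constant:] * t ^ k \<noteq> 0" for k
    using hessian_constant_nonzero by (auto simp: t_def degree_power_eq)
  moreover have "Polynomial.degree (t ^ k) = k" for k by (simp add: t_def degree_power_eq)
  ultimately have "m * e \<le> m * ((m choose 2) - 2) + 2"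
    by (metis dvd_imp_degree_le dvd_triv_left)
  also have "\<dots> < m * (((m choose 2) - 2) + 1)" using m by simp
  finally have "e < (m choose 2) - 2 + 1" by (simp only: mult_less_cancel1)
  thus "e \<le> (m choose 2) - 2" by simp
qed

end

section \<open>Algebraic dependence and projective closure\<close>

text \<open>Elimination of one equation and one unknown at a time.\<close>

lemma underdetermined_system_solvable:
  fixes M :: "'e \<Rightarrow> 's \<Rightarrow> 'a::field"
  assumes "finite S" "finite E" "card S < card E"
  shows "\<exists>c. (\<exists>e\<in>E. c e \<noteq> 0) \<and> (\<forall>s\<in>S. (\<Sum>e\<in>E. c e * M e s) = 0)"
  using assms
proof (induction S arbitrary: E M rule: finite_induct)
  case empty
  then obtain e where "e \<in> E" by fastforce
  thus ?case by (intro exI[of _ "\<lambda>_. 1"]) auto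
next
  case (insert s S)
  show ?case
  proof (cases "\<forall>e\<in>E. M e s = 0")
    case True
    have "card S < card E" using insert by simp
    from insert.IH[OF insert.prems(1) this, of M] obtain c where
      "\<exists>e\<in>E. c e \<noteq> 0" "\<forall>s\<in>S. (\<Sum>e\<in>E. c e * M e s) = 0" by auto
    thus ?thesis using True by (intro exI[of _ c]) auto
  next
    case False
    then obtain e0 where e0: "e0 \<in> E" "M e0 s \<noteq> 0" by blast
    define E' where "E' = E - {e0}"
    have E: "E = insert e0 E'" "e0 \<notin> E'" "finite E'" using e0 insert.prems by (auto simp: E'_def)
    have "card S < card E'" using insert E by simp
    from insert.IH[OF E(3) this, of "\<lambda>e r. M e r - M e s / M e0 s * M e0 r"] obtain c where
      c: "\<exists>e\<in>E'. c e \<noteq> 0" "\<And>r. r \<in> S \<Longrightarrow> (\<Sum>e\<in>E'. c e * (M e r - M e s / M e0 s * M e0 r)) = 0" by auto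
    define q where "q = - (\<Sum>e\<in>E'. c e * (M e s / M e0 s))"
    define c' where "c' = c(e0 := q)"
    have sum: "(\<Sum>e\<in>E. c' e * M e r) = q * M e0 r + (\<Sum>e\<in>E'. c e * M e r)" for r
    proof -
      have "(\<Sum>e\<in>E'. c' e * M e r) = (\<Sum>e\<in>E'. c e * M e r)"
        by (intro sum.cong refl) (use E in \<open>auto simp: c'_def\<close>)
      thus ?thesis using E by (simp add: c'_def)
    qed
    have "(\<Sum>e\<in>E. c' e * M e r) = 0" if "r \<in> insert s S" for r
    proof -
      have "(\<Sum>e\<in>E. c' e * M e r) = (\<Sum>e\<in>E'. c e * (M e r - M e s / M e0 s * M e0 r))"
        unfolding sum q_def by (simp add: right_diff_distrib sum_subtractf sum_distrib_left sum_distrib_right mult_ac)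
      also have "\<dots> = 0" using that c(2) e0(2) by auto
      finally show ?thesis .
    qed
    moreover have "\<exists>e\<in>E. c' e \<noteq> 0" using c(1) E by (auto simp: c'_def)
    ultimately show ?thesis by blast
  qed
qed

definition monomial_box :: "nat \<Rightarrow> nat \<Rightarrow> (nat \<Rightarrow>\<^sub>0 nat) set" where
  "monomial_box n N = {t. keys t \<subseteq> {..<n} \<and> (\<forall>i. lookup t i < N)}"

lemma monomial_box_card:
  assumes "0 < N"
  shows "finite (monomial_box n N)" "card (monomial_box n N) = N ^ n"
proof -
  let ?F = "PiE {..<n} (\<lambda>_. {..<N})"
  let ?enc = "\<lambda>t :: nat \<Rightarrow>\<^sub>0 nat. restrict (lookup t) {..<n}"
  let ?dec = "\<lambda>e. \<Sum>i<n. Poly_Mapping.single i (e i :: nat)"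
  have dec: "lookup (?dec e) j = (if j < n then e j else 0)" for e j
    by (simp add: lookup_sum lookup_single when_def)
  have "bij_betw ?enc (monomial_box n N) ?F"
  proof (rule bij_betw_byWitness[where f' = ?dec])
    show "\<forall>t\<in>monomial_box n N. ?dec (?enc t) = t"
    proof
      fix t assume t: "t \<in> monomial_box n N"
      show "?dec (?enc t) = t"
      proof (rule poly_mapping_eqI)
        fix j show "lookup (?dec (?enc t)) j = lookup t j"
          unfolding dec using t by (cases "j < n") (auto simp: monomial_box_def in_keys_iff)
      qed
    qed
    show "\<forall>e\<in>?F. ?enc (?dec e) = e"
    proof
      fix e assume e: "e \<in> ?F"
      show "?enc (?dec e) = e"
      proof (rule ext)
        fix j show "?enc (?dec e) j = e j"
          unfolding restrict_def dec using PiE_arb[OF e, of j] by simp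
      qed
    qed
    show "?enc ` monomial_box n N \<subseteq> ?F"
    proof (rule image_subsetI)
      fix t assume "t \<in> monomial_box n N"
      thus "?enc t \<in> ?F" by (intro restrict_PiE_iff[THEN iffD2] ballI) (simp add: monomial_box_def)
    qed
    show "?dec ` ?F \<subseteq> monomial_box n N"
    proof (rule image_subsetI)
      fix e assume e: "e \<in> ?F"
      have "lookup (?dec e) i < N" for i
        unfolding dec using PiE_mem[OF e, of i] assms by simp
      moreover have "keys (?dec e) \<subseteq> {..<n}"
        by (auto simp: in_keys_iff dec split: if_splits)
      ultimately show "?dec e \<in> monomial_box n N" by (simp add: monomial_box_def)
    qed
  qed
  note bij = this
  have F: "finite ?F" "card ?F = N ^ n"
    by (rule finite_PiE) (simp_all add: card_PiE)
  show "finite (monomial_box n N)" using bij_betw_finite[OF bij] F(1) by simp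
  show "card (monomial_box n N) = N ^ n" using bij_betw_same_card[OF bij] F(2) by simp
qed

definition exponents_le :: "nat \<Rightarrow> ('v, 'a::zero) mpoly \<Rightarrow> bool" where
  "exponents_le B p \<longleftrightarrow> (\<forall>t\<in>keys p. \<forall>x. lookup t x \<le> B)"

lemma exponents_le_mult:
  "exponents_le B p \<Longrightarrow> exponents_le C q \<Longrightarrow> exponents_le (B + C) (p * q)"
  for p :: "('v, 'a::comm_ring_1) mpoly"
proof -
  assume *: "exponents_le B p" "exponents_le C q"
  show ?thesis unfolding exponents_le_def
  proof (intro ballI allI)
    fix t x assume "t \<in> keys (p * q)"
    then obtain r s where "r \<in> keys p" "s \<in> keys q" "t = r + s"
      using Poly_Mapping.keys_mult[of p q] by blast
    thus "lookup t x \<le> B + C"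
      using * by (simp add: exponents_le_def lookup_add add_mono)
  qed
qed

lemma exponents_le_power: "exponents_le B p \<Longrightarrow> exponents_le (n * B) (p ^ n)"
  for p :: "('v, 'a::comm_ring_1) mpoly"
proof (induction n)
  case 0
  show ?case by (simp add: exponents_le_def)
next
  case (Suc n)
  thus ?case using exponents_le_mult[of B p "n * B" "p ^ n"] by simp
qed

lemma exponents_le_prod:
  "finite I \<Longrightarrow> (\<And>i. i \<in> I \<Longrightarrow> exponents_le (B i) (g i)) \<Longrightarrow> exponents_le (sum B I) (prod g I)"
  for g :: "'i \<Rightarrow> ('v, 'a::comm_ring_1) mpoly"
proof (induction I rule: finite_induct)
  case empty
  show ?case by (simp add: exponents_le_def)
qed (auto intro: exponents_le_mult)

lemma exponents_le_mono: "exponents_le B p \<Longrightarrow> B \<le> C \<Longrightarrow> exponents_le C p"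
  unfolding exponents_le_def by (intro ballI allI) (rule order_trans, auto)

lemma exponents_le_exists: "\<exists>B. exponents_le B p"
proof -
  define B where "B = (\<Sum>t\<in>keys p. \<Sum>x\<in>keys t. lookup t x)"
  have "lookup t x \<le> B" if "t \<in> keys p" for t x
  proof (cases "x \<in> keys t")
    case True
    have "lookup t x \<le> (\<Sum>x\<in>keys t. lookup t x)" using True by (intro member_le_sum) auto
    also have "\<dots> \<le> B" unfolding B_def using that by (intro member_le_sum) auto
    finally show ?thesis .
  qed (simp add: in_keys_iff)
  thus ?thesis unfolding exponents_le_def by blast
qed

lemma lookup_Const_mult: "lookup (Const c * p) t = c * lookup p t"
  for p :: "('v, 'a::comm_ring_1) mpoly"
  by (simp add: Const_def mult_map_scale_conv_mult[symmetric] Poly_Mapping.map.rep_eq when_def)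

lemma polys_in_mono: "p \<in> polys_in V \<Longrightarrow> V \<subseteq> W \<Longrightarrow> p \<in> polys_in W"
  unfolding polys_in_def by blast

lemma polys_in_subst:
  fixes p :: "('v, 'a::comm_ring_1) mpoly" and \<sigma> :: "'v \<Rightarrow> ('w, 'a) mpoly"
  assumes "p \<in> polys_in V" "\<And>x. x \<in> V \<Longrightarrow> \<sigma> x \<in> polys_in W"
  shows "mp_subst Const \<sigma> p \<in> polys_in W"
  unfolding mp_subst_def
  by (intro polys_in_sum polys_in_mult polys_in_Const polys_in_prod polys_in_power assms(2))
    (use assms(1) in \<open>auto simp: polys_in_def\<close>)

text \<open>A count of monomials. The \<open>N ^ (m + 1)\<close> monomials in \<open>m + 1\<close> variables with exponents below \<open>N\<close> are
  mapped to polynomials in \<open>m\<close> variables whose exponents grow at most linearly in \<open>N\<close>, and these lie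
  in a space of dimension at most a constant times \<open>N ^ m\<close>. For large \<open>N\<close> there is a linear relation.\<close>

lemma algebraically_dependent:
  fixes G :: "nat \<Rightarrow> (nat, 'a::field) mpoly"
  assumes "\<And>i. i \<le> m \<Longrightarrow> G i \<in> polys_in {..<m}"
  obtains P :: "(nat, 'a) mpoly" where "P \<in> polys_in {..<Suc m}" "P \<noteq> 0" "mp_subst Const G P = 0"
proof -
  define Bd where "Bd i = (SOME B. exponents_le B (G i))" for i
  have Bd: "exponents_le (Bd i) (G i)" for i
    unfolding Bd_def by (rule someI_ex[OF exponents_le_exists])
  define D where "D = (\<Sum>i\<le>m. Bd i)"
  have D: "exponents_le D (G i)" if "i \<le> m" for i
    unfolding D_def by (rule exponents_le_mono[OF Bd]) (use that in \<open>auto intro: member_le_sum\<close>)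
  \<comment> \<open>The images have exponents at most \<open>(m + 1) N D < N Q\<close>, and \<open>N\<close> is chosen so that
    \<open>(N Q) ^ m < N ^ (m + 1)\<close>.\<close>
  define Q where "Q = Suc m * D + 1"
  define N where "N = Q ^ m + 1"
  define E where "E = monomial_box (Suc m) N"
  define S where "S = monomial_box m (N * Q)"
  have pos: "0 < N" "0 < N * Q" by (auto simp: N_def Q_def)
  have "card S = N ^ m * Q ^ m" by (simp add: S_def monomial_box_card[OF pos(2)] power_mult_distrib)
  also have "\<dots> < N ^ m * N" using pos by (simp add: N_def)
  also have "\<dots> = card E" by (simp add: E_def monomial_box_card[OF pos(1)])
  finally have less: "card S < card E" .
  have fin: "finite S" "finite E"
    unfolding S_def E_def by (rule monomial_box_card(1)[OF pos(2)], rule monomial_box_card(1)[OF pos(1)])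
  obtain c where c: "\<exists>t\<in>E. c t \<noteq> 0"
      "\<forall>s\<in>S. (\<Sum>t\<in>E. c t * lookup (monomial_value G t) s) = 0"
    using underdetermined_system_solvable[OF fin less, of "\<lambda>t. lookup (monomial_value G t)"] by auto
  define P where "P = (\<Sum>t\<in>E. Poly_Mapping.single t (c t))"
  have lookup_P: "lookup P t = (if t \<in> E then c t else 0)" for t
    using fin by (simp add: P_def lookup_sum lookup_single when_def)
  have keys_P: "keys P \<subseteq> E" by (auto simp: in_keys_iff lookup_P split: if_splits)
  have "P \<noteq> 0" using c(1) lookup_P by (metis lookup_zero)
  moreover have "P \<in> polys_in {..<Suc m}"
    using keys_P by (auto simp: polys_in_def E_def monomial_box_def)
  moreover have "mp_subst Const G P = 0"
  proof (rule poly_mapping_eqI)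
    fix s
    have "mp_subst Const G P = (\<Sum>t\<in>E. Const (c t) * monomial_value G t)"
      by (subst mp_subst_superset[OF fin(2) keys_P]) (auto simp: Const_def lookup_P)
    hence eq: "lookup (mp_subst Const G P) s = (\<Sum>t\<in>E. c t * lookup (monomial_value G t) s)"
      by (simp add: lookup_sum lookup_Const_mult)
    show "lookup (mp_subst Const G P) s = lookup 0 s"
    proof (cases "s \<in> S")
      case True
      thus ?thesis using c(2) eq by simp
    next
      case False
      have "lookup (monomial_value G t) s = 0" if t: "t \<in> E" for t
      proof (rule ccontr)
        assume "lookup (monomial_value G t) s \<noteq> 0"
        hence s: "s \<in> keys (monomial_value G t)" by (simp add: in_keys_iff)
        have mono: "monomial_value G t = (\<Prod>i<Suc m. G i ^ lookup t i)"
          using t by (intro monomial_value_superset) (auto simp: E_def monomial_box_def)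
        have "monomial_value G t \<in> polys_in {..<m}"
          unfolding mono by (intro polys_in_prod polys_in_power assms) auto
        moreover have "exponents_le (\<Sum>i<Suc m. lookup t i * D) (monomial_value G t)"
          unfolding mono by (intro exponents_le_prod exponents_le_power D) auto
        hence "exponents_le (Suc m * (N * D)) (monomial_value G t)"
        proof (rule exponents_le_mono)
          have "(\<Sum>i<Suc m. lookup t i * D) \<le> (\<Sum>i<Suc m. N * D)"
            using t by (intro sum_mono mult_right_mono) (auto simp: E_def monomial_box_def less_imp_le)
          thus "(\<Sum>i<Suc m. lookup t i * D) \<le> Suc m * (N * D)" by simp
        qed
        moreover have "Suc m * (N * D) < N * Q" using pos by (simp add: Q_def algebra_simps)
        ultimately have "keys s \<subseteq> {..<m}" "lookup s x < N * Q" for x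
          using s le_less_trans[of "lookup s x" "Suc m * (N * D)" "N * Q"]
          by (simp_all only: polys_in_def exponents_le_def mem_Collect_eq)
        hence "s \<in> S" by (simp add: S_def monomial_box_def)
        thus False using False by contradiction
      qed
      thus ?thesis using eq by simp
    qed
  qed
  ultimately show ?thesis using that by blast
qed

lemma eval_substituted:
  fixes F :: "'i \<Rightarrow> ('v, 'a::comm_ring_1) mpoly"
  shows "mp_subst id p (mp_subst Const F P) = mp_subst id (\<lambda>i. mp_subst id p (F i)) P"
proof -
  have "(\<lambda>c :: 'a. mp_subst id p (Const c)) = id" by (auto simp: mp_subst_Const)
  thus ?thesis
    by (simp only: mp_subst_comp[OF comm_ring_hom_mp_subst[OF comm_ring_hom_id]])
qed

text \<open>The closure is defined by homogeneous equations only. Since \<open>A\<close> is a cone over an infinite field,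
  a polynomial that vanishes on \<open>A\<close> vanishes on each line of \<open>A\<close> identically in the scaling parameter, so its
  homogeneous parts vanish on \<open>A\<close> too.\<close>

lemma vanishing_on_proj_closure:
  fixes F :: "('v, 'a::field) mpoly"
  assumes inf: "infinite (UNIV :: 'a set)"
    and scale: "\<And>p l. p \<in> A \<Longrightarrow> l \<noteq> 0 \<Longrightarrow> (\<lambda>x. l * p x) \<in> A"
    and F: "F \<in> polys_in V" "\<And>p. p \<in> A \<Longrightarrow> mp_subst id p F = 0"
    and q: "q \<in> proj_closure V A"
  shows "mp_subst id q F = 0"
proof -
  define deg where "deg t = (\<Sum>x\<in>keys t. lookup t x)" for t :: "'v \<Rightarrow>\<^sub>0 nat"
  define part where "part d = (\<Sum>t\<in>{t \<in> keys F. deg t = d}. Poly_Mapping.single t (lookup F t))" for d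
  have lookup_part: "lookup (part d) t = (if t \<in> keys F \<and> deg t = d then lookup F t else 0)" for d t
    by (simp add: part_def lookup_sum lookup_single when_def)
  have keys_part: "keys (part d) = {t \<in> keys F. deg t = d}" for d
    by (auto simp: in_keys_iff lookup_part split: if_splits)
  have eval_part: "mp_subst id p (part d) = (\<Sum>t\<in>{t \<in> keys F. deg t = d}. lookup F t * monomial_value p t)" for p d
    unfolding mp_subst_eq keys_part by (intro sum.cong refl) (auto simp: lookup_part)
  have part_zero: "mp_subst id p (part d) = 0" if p: "p \<in> A" for p d
  proof -
    define R where "R = (\<Sum>t\<in>keys F. Polynomial.monom (lookup F t * monomial_value p t) (deg t))"
    have "poly R l = 0" if "l \<noteq> 0" for l
    proof -
      have "monomial_value (\<lambda>x. l * p x) t = l ^ deg t * monomial_value p t" for t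
        by (simp add: monomial_value_def deg_def power_mult_distrib prod.distrib power_sum)
      hence "poly R l = mp_subst id (\<lambda>x. l * p x) F"
        by (simp add: R_def poly_sum poly_monom mp_subst_eq mult_ac)
      thus ?thesis using F(2)[OF scale[OF p that]] by simp
    qed
    hence "UNIV - {0} \<subseteq> {l. poly R l = 0}" by auto
    moreover have "infinite (UNIV - {0 :: 'a})" using inf by simp
    ultimately have "infinite {l. poly R l = 0}" by (rule infinite_super)
    hence "R = 0" using poly_roots_finite[of R] by auto
    hence "0 = Polynomial.coeff R d" by simp
    also have "\<dots> = (\<Sum>t\<in>keys F. if deg t = d then lookup F t * monomial_value p t else 0)"
      by (simp add: R_def coeff_sum)
    also have "\<dots> = mp_subst id p (part d)"
      unfolding eval_part by (simp add: sum.inter_filter)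
    finally show ?thesis by simp
  qed
  have "part d \<in> polys_in V" "homogeneous (part d)" for d
    using F(1) by (auto simp: polys_in_def homogeneous_def keys_part deg_def)
  moreover have "\<forall>G\<in>polys_in V. homogeneous G \<longrightarrow> (\<forall>p\<in>A. mp_subst id p G = 0) \<longrightarrow> mp_subst id q G = 0"
    using q by (simp add: proj_closure_def)
  ultimately have "mp_subst id q (part d) = 0" for d
    using part_zero by simp
  hence "(\<Sum>d\<in>deg ` keys F. \<Sum>t\<in>{t \<in> keys F. deg t = d}. lookup F t * monomial_value q t) = 0"
    by (simp add: eval_part)
  thus ?thesis
    by (subst (asm) sum.group) (auto simp: mp_subst_eq)
qed

section \<open>The dual variety\<close>

lemma infinite_alg_closure: "infinite (UNIV :: 'k::field_char_0 alg_closure set)"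
proof -
  have "inj (to_ac :: 'k \<Rightarrow> _)"
  proof (rule injI)
    fix x y :: 'k assume "to_ac x = to_ac y"
    hence "to_ac (x - y) = 0" by simp
    hence "to_ac ((x - y) * inverse (x - y)) = 0" by (simp only: to_ac_mult mult_zero_left)
    thus "x = y" by (cases "x - y = 0") auto
  qed
  hence "infinite (range (to_ac :: 'k \<Rightarrow> _))"
    using infinite_UNIV_char_0 by (simp add: finite_image_iff)
  thus ?thesis by (rule infinite_super[OF subset_UNIV])
qed

lemma two_nonzero_alg_closure: "(2 :: 'k::field_char_0 alg_closure) \<noteq> 0"
proof
  assume two: "(2 :: 'k alg_closure) = 0"
  have "2 * inverse 2 = (1 :: 'k)" by simp
  hence "(1 :: 'k alg_closure) = to_ac (2 * inverse 2)" by (simp only: to_ac_1)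
  also have "\<dots> = 2 * to_ac (inverse 2)" by (simp only: to_ac_mult to_ac_numeral)
  finally show False unfolding two by simp
qed

lemma cofactor_hom:
  assumes "comm_ring_hom h" "A \<in> carrier_mat n n" "i < n" "j < n"
  shows "h (cofactor A i j) = cofactor (map_mat h A) i j"
proof -
  interpret comm_ring_hom h by fact
  have "map_mat h (mat_delete A i j) = mat_delete (map_mat h A) i j"
    by (rule eq_matI) (use assms in \<open>auto simp: mat_delete_def\<close>)
  thus ?thesis by (simp add: cofactor_def hom_distribs flip: hom_det)
qed

text \<open>The columns of the adjugate of a singular matrix lie in the kernel. If some cofactor is nonzero,
  the kernel is a line, so the adjugate has rank one; by symmetry it is a multiple of \<open>w w\<^sup>T\<close>.\<close>

lemma cofactor_matrix_of_singular:
  fixes A :: "'a::field mat"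
  assumes A: "A \<in> carrier_mat n n" and sym: "\<And>i j. i < n \<Longrightarrow> j < n \<Longrightarrow> A $$ (i, j) = A $$ (j, i)"
    and sing: "det A = 0"
  shows "\<exists>c w. \<forall>i<n. \<forall>j<n. cofactor A i j = c * w i * w j"
proof (cases "\<forall>i<n. \<forall>j<n. cofactor A i j = 0")
  case True
  thus ?thesis by (intro exI[of _ 0]) simp
next
  case False
  then obtain i0 j0 where ij0: "i0 < n" "j0 < n" "cofactor A i0 j0 \<noteq> 0" by blast
  let ?U = "cofactor A"
  note U_sym = cofactor_symmetric[OF A sym]
  have kernel: "(\<Sum>k<n. A $$ (i, k) * ?U j k) = 0" if "i < n" "j < n" for i j
    using cofactor_expansion_row[OF A that] sing by simp
  \<comment> \<open>Replacing row \<open>i0\<close> by a unit vector gives a matrix whose determinant is the nonzero cofactor.\<close>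
  define C where "C = mat n n (\<lambda>(i, j). if i = i0 then if j = j0 then 1 else 0 else A $$ (i, j))"
  have C: "C \<in> carrier_mat n n" by (simp add: C_def)
  have "det C \<noteq> 0"
  proof -
    have "mat_delete C i0 j0 = mat_delete A i0 j0"
      by (rule eq_matI) (use A ij0 in \<open>auto simp: mat_delete_def C_def\<close>)
    hence "cofactor C i0 j0 = ?U i0 j0" by (simp add: cofactor_def)
    have "det C = (\<Sum>j<n. C $$ (i0, j) * cofactor C i0 j)"
      by (rule laplace_expansion_row[OF C ij0(1)])
    also have "\<dots> = (\<Sum>j<n. if j = j0 then cofactor C i0 j0 else 0)"
      by (intro sum.cong refl) (use ij0 in \<open>auto simp: C_def\<close>)
    also have "\<dots> = cofactor C i0 j0" using ij0 by simp
    finally show ?thesis using ij0 \<open>cofactor C i0 j0 = ?U i0 j0\<close> by simp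
  qed
  \<comment> \<open>A kernel vector of \<open>A\<close> with vanishing coordinate \<open>j0\<close> is a kernel vector of the invertible matrix \<open>C\<close>.\<close>
  have inj: "y k = 0" if y: "\<And>i. i < n \<Longrightarrow> (\<Sum>k<n. A $$ (i, k) * y k) = 0" "y j0 = 0" and "k < n" for y k
  proof -
    let ?v = "vec n y"
    have "C *\<^sub>v ?v = 0\<^sub>v n"
    proof (rule eq_vecI)
      fix i assume "i < dim_vec (0\<^sub>v n :: 'a vec)"
      hence i: "i < n" by simp
      have "(C *\<^sub>v ?v) $ i = (\<Sum>k<n. C $$ (i, k) * y k)"
        using i by (simp add: C_def scalar_prod_def lessThan_atLeast0)
      also have "\<dots> = 0"
      proof (cases "i = i0")
        case True
        have "(\<Sum>k<n. C $$ (i, k) * y k) = (\<Sum>k<n. if k = j0 then y j0 else 0)"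
          by (intro sum.cong refl) (use True ij0 in \<open>auto simp: C_def\<close>)
        thus ?thesis using y(2) by simp
      next
        case False
        have "(\<Sum>k<n. C $$ (i, k) * y k) = (\<Sum>k<n. A $$ (i, k) * y k)"
          by (intro sum.cong refl) (use False i in \<open>auto simp: C_def\<close>)
        thus ?thesis using y(1)[OF i] by simp
      qed
      finally show "(C *\<^sub>v ?v) $ i = 0\<^sub>v n $ i" using i by simp
    qed (simp add: C_def)
    moreover have "\<nexists>v. v \<in> carrier_vec n \<and> v \<noteq> 0\<^sub>v n \<and> C *\<^sub>v v = 0\<^sub>v n"
      using \<open>det C \<noteq> 0\<close> by (simp only: det_0_iff_vec_prod_zero_field[OF C] not_False_eq_True)
    ultimately have "?v = 0\<^sub>v n" using vec_carrier[of n y] by metis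
    hence "?v $ k = 0" using that(3) by simp
    thus ?thesis using that(3) by simp
  qed
  have rows: "?U j k * ?U i0 j0 = ?U j j0 * ?U i0 k" if jk: "j < n" "k < n" for j k
  proof -
    have "?U j k * ?U i0 j0 - ?U j j0 * ?U i0 k = 0"
    proof (rule inj[where y = "\<lambda>k. ?U j k * ?U i0 j0 - ?U j j0 * ?U i0 k"])
      fix i assume i: "i < n"
      have "(\<Sum>k<n. A $$ (i, k) * (?U j k * ?U i0 j0 - ?U j j0 * ?U i0 k))
          = ?U i0 j0 * (\<Sum>k<n. A $$ (i, k) * ?U j k) - ?U j j0 * (\<Sum>k<n. A $$ (i, k) * ?U i0 k)"
        by (simp add: right_diff_distrib sum_subtractf sum_distrib_left mult_ac)
      thus "(\<Sum>k<n. A $$ (i, k) * (?U j k * ?U i0 j0 - ?U j j0 * ?U i0 k)) = 0"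
        using kernel i jk ij0 by simp
    qed (use jk in auto)
    thus ?thesis by simp
  qed
  let ?u = "?U i0 j0"
  have "?U j k = ?U j0 j0 / ?u\<^sup>2 * ?U i0 j * ?U i0 k" if jk: "j < n" "k < n" for j k
  proof -
    have "?U j k * ?u * ?u = ?U j j0 * ?u * ?U i0 k" using rows[OF jk] by (simp add: mult_ac)
    also have "?U j j0 * ?u = ?U j0 j0 * ?U i0 j"
      using rows[OF ij0(2) jk(1)] U_sym[of j j0] by simp
    finally show ?thesis using ij0(3) by (simp add: field_simps power2_eq_square)
  qed
  thus ?thesis by blast
qed

lemma tangent_hyperplanes_scale:
  assumes "h \<in> tangent_hyperplanes V g" "l \<noteq> 0"
  shows "(\<lambda>x. l * h x) \<in> tangent_hyperplanes V g"
proof -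
  obtain p c where h: "h \<in> hom_coords V" and p: "p \<in> smooth_points V g" "c \<noteq> 0" and
    grad: "\<forall>x\<in>V. h x = c * mp_subst to_ac p (pderiv_in x g)"
    using assms(1) unfolding tangent_hyperplanes_def by blast
  have "(\<lambda>x. l * h x) \<in> hom_coords V" using h assms(2) by (auto simp: hom_coords_def)
  moreover have "\<forall>x\<in>V. l * h x = (l * c) * mp_subst to_ac p (pderiv_in x g)" using grad by simp
  moreover have "l * c \<noteq> 0" using assms(2) p(2) by simp
  ultimately show ?thesis unfolding tangent_hyperplanes_def using p(1) by blast
qed

lemma tangent_hyperplanes_subset_dual: "tangent_hyperplanes V g \<subseteq> dual_variety V g"
  by (auto simp: dual_variety_def proj_closure_def tangent_hyperplanes_def)

context diagonal_cloning
begin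

text \<open>The gradient of the cloned determinant at a matrix with adjugate \<open>v v\<^sup>T\<close>. Over any commutative
  ring, so that it can also be applied to the vector of variables.\<close>

definition rank_one_point :: "(nat \<Rightarrow> 'c::comm_ring_1) \<Rightarrow> nat \<times> nat \<Rightarrow> 'c" where
  "rank_one_point v x = (if x \<in> set (md_vars m a) then
     (if fst x = snd x then 1 else 2) * (v (fst x) * v (snd x)) + (if x = (b, b) then v a * v a else 0)
   else 0)"

lemma rank_one_point_pairing:
  assumes "x \<in> set (md_vars m a)"
  shows "(\<Sum>i<m. \<Sum>j<m. clone_unit a b x i j * (v i * v j)) = rank_one_point v x"
proof -
  have tri: "x \<in> tri_pairs m" "(a, a) \<in> tri_pairs m" using assms a by (auto simp: set_md_vars tri_pairs_def)
  have unit: "(\<Sum>i<m. \<Sum>j<m. sym_unit y i j * (v i * v j)) = (if fst y = snd y then 1 else 2) * (v (fst y) * v (snd y))"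
    if "y \<in> tri_pairs m" for y
  proof -
    have "(\<Sum>i<m. \<Sum>j<m. sym_unit y i j * (v i * v j)) = pairing m (\<lambda>i j. v i * v j) (sym_unit y)"
      unfolding pairing_def by (intro sum.cong refl, subst sym_unit_sym) (rule mult.commute)
    thus ?thesis using pairing_sym_unit_right[OF that, of "\<lambda>i j. v i * v j"] by (simp add: mult.commute)
  qed
  have "(\<Sum>i<m. \<Sum>j<m. clone_unit a b x i j * (v i * v j))
      = (\<Sum>i<m. \<Sum>j<m. sym_unit x i j * (v i * v j))
      + (\<Sum>i<m. \<Sum>j<m. if x = (b, b) then sym_unit (a, a) i j * (v i * v j) else 0)"
    unfolding clone_unit_def sum.distrib[symmetric] by (intro sum.cong refl) (auto simp: distrib_right)
  also have "(\<Sum>i<m. \<Sum>j<m. if x = (b, b) then sym_unit (a, a) i j * (v i * v j) else 0)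
      = (if x = (b, b) then v a * v a else 0)"
    using unit[OF tri(2)] by auto
  finally show ?thesis using assms unit[OF tri(1)] by (simp add: rank_one_point_def)
qed

lemma rank_one_point_scale: "rank_one_point (\<lambda>i. r * v i) x = r\<^sup>2 * rank_one_point v x"
  by (simp add: rank_one_point_def power2_eq_square algebra_simps)

lemma eval_pderiv_det:
  fixes \<phi> :: "'k::comm_ring_1 \<Rightarrow> 'c::comm_ring_1"
  assumes "comm_ring_hom \<phi>" "x \<in> set (md_vars m a)"
  shows "mp_subst \<phi> p (pderiv_in x (det (md_clone m a b)))
    = (\<Sum>i<m. \<Sum>j<m. clone_unit a b x i j * cofactor (mat m m (\<lambda>(i, j). p (clone_var i j))) i j)"
proof -
  let ?M = "md_clone m a b :: (nat \<times> nat, 'k) mpoly mat"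
  interpret ev: comm_ring_hom "mp_subst \<phi> p" by (rule comm_ring_hom_mp_subst[OF assms(1)])
  interpret \<phi>: comm_ring_hom \<phi> by fact
  interpret derivation "pderiv_in x :: (nat \<times> nat, 'k) mpoly \<Rightarrow> _" by (rule derivation_pderiv_in)
  have map: "map_mat (mp_subst \<phi> p) ?M = mat m m (\<lambda>(i, j). p (clone_var i j))"
    by (rule eq_matI) (auto simp: md_clone_index mp_subst_Var carrier_matD[OF md_clone_carrier])
  have clone: "mp_subst \<phi> p (clone_unit a b x i j) = clone_unit a b x i j" for i j
    by (simp add: clone_unit_def sym_unit_def ev.hom_add)
  have "pderiv_in x (det ?M) = (\<Sum>i<m. \<Sum>j<m. clone_unit a b x i j * cofactor ?M i j)"
    unfolding det_derivative[OF md_clone_carrier]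
    by (intro sum.cong refl) (simp add: pderiv_md_clone assms(2))
  thus ?thesis
    by (simp add: ev.hom_sum ev.hom_mult clone map cofactor_hom[OF ev.comm_ring_hom_axioms md_clone_carrier])
qed

text \<open>At a smooth point the gradient consists of cofactors of a singular matrix; the scalar in front of
  the rank one matrix is absorbed into \<open>v\<close> by a square root.\<close>

lemma tangent_hyperplane_rank_one:
  fixes f :: "(nat \<times> nat, 'k::field) mpoly"
  assumes f: "f = det (md_clone m a b)" and t: "h \<in> tangent_hyperplanes (set (md_vars m a)) f"
  shows "\<exists>v. h = rank_one_point v"
proof -
  let ?V = "set (md_vars m a)"
  obtain p c where h: "h \<in> hom_coords ?V" and p: "p \<in> smooth_points ?V f" and
    grad: "\<forall>x\<in>?V. h x = c * mp_subst to_ac p (pderiv_in x f)"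
    using t unfolding tangent_hyperplanes_def by blast
  let ?A = "mat m m (\<lambda>(i, j). p (clone_var i j))"
  have "det ?A = 0" using p by (simp add: smooth_points_def f eval_det_md_clone[OF comm_ring_hom_to_ac])
  moreover have "?A $$ (i, j) = ?A $$ (j, i)" if "i < m" "j < m" for i j
    using that clone_var_sym[of i j] by simp
  ultimately obtain d w where cof: "\<forall>i<m. \<forall>j<m. cofactor ?A i j = d * w i * w j"
    using cofactor_matrix_of_singular[of ?A m] by auto
  obtain r where r: "r ^ 2 = c * d" using nth_root_exists[of 2 "c * d"] by auto
  have "h x = rank_one_point (\<lambda>i. r * w i) x" for x
  proof (cases "x \<in> ?V")
    case True
    have "mp_subst to_ac p (pderiv_in x f) = (\<Sum>i<m. \<Sum>j<m. clone_unit a b x i j * cofactor ?A i j)"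
      unfolding f by (rule eval_pderiv_det[OF comm_ring_hom_to_ac True])
    also have "\<dots> = d * (\<Sum>i<m. \<Sum>j<m. clone_unit a b x i j * (w i * w j))"
      unfolding sum_distrib_left by (intro sum.cong refl) (simp add: cof)
    also have "\<dots> = d * rank_one_point w x" by (simp only: rank_one_point_pairing[OF True])
    finally show ?thesis using grad True by (simp add: rank_one_point_scale r)
  next
    case False
    thus ?thesis using h by (cases x) (simp add: hom_coords_def rank_one_point_def)
  qed
  thus ?thesis by blast
qed

text \<open>A singular symmetric matrix with kernel spanned by \<open>v\<close> is needed that in addition has equal entries
  at \<open>(a, a)\<close> and \<open>(b, b)\<close>. With \<open>u = v / v c\<close> the Gram matrix \<open>B\<^sup>T B\<close> does it, where \<open>B\<close> is the identity
  bordered by the column \<open>- u\<close> in position \<open>c\<close>: all its diagonal entries except the one at \<open>c\<close> are 1.\<close>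

lemma rank_one_tangent_hyperplane:
  fixes f :: "(nat \<times> nat, 'k::field) mpoly"
  assumes f: "f = det (md_clone m a b)" and c: "c < m" "c \<noteq> a" "c \<noteq> b" and v: "v c \<noteq> 0"
  shows "rank_one_point v \<in> tangent_hyperplanes (set (md_vars m a)) f"
proof -
  let ?V = "set (md_vars m a)"
  define u where "u i = v i / v c" for i
  have u_c: "u c = 1" using v by (simp add: u_def)
  define A where "A i j = (if i = j then if i = c then (\<Sum>k\<in>{..<m} - {c}. u k * u k) else 1
    else if i = c then - u j else if j = c then - u i else 0)" for i j
  have A_sym: "A i j = A j i" for i j
    unfolding A_def by (cases "i = j"; cases "i = c"; cases "j = c") simp_all
  define p where "p x = (if x \<in> ?V then A (fst x) (snd x) else 0)" for x
  let ?A = "mat m m (\<lambda>(i, j). p (clone_var i j))"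
  have p_clone: "p (clone_var i j) = A i j" if "i < m" "j < m" for i j
  proof -
    have "p (clone_var i j) = A (fst (clone_var i j)) (snd (clone_var i j))"
      using clone_var_in_md_vars[OF that] by (simp add: p_def)
    also have "\<dots> = A (min i j) (max i j)"
    proof (cases "(min i j, max i j) = (a, a)")
      case True
      hence "clone_var i j = (b, b)" "min i j = a" "max i j = a" by (simp_all add: clone_var_def)
      moreover have "A a a = 1" "A b b = 1" using c by (simp_all add: A_def)
      ultimately show ?thesis by simp
    next
      case False
      thus ?thesis by (simp only: clone_var_def if_False fst_conv snd_conv)
    qed
    also have "\<dots> = A i j"
      using A_sym[of j i] by (cases "i \<le> j") (simp_all only: min_def max_def if_True if_False)
    finally show ?thesis .
  qed
  have carrier: "?A \<in> carrier_mat m m" by simp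
  have kernel_eq: "(\<Sum>k<m. A i k * y k) = (if i = c then A c c * y c - (\<Sum>k\<in>{..<m} - {c}. u k * y k) else y i - u i * y c)"
    if "i < m" for i y
  proof (cases "i = c")
    case True
    have "(\<Sum>k<m. A i k * y k) = A c c * y c + (\<Sum>k\<in>{..<m} - {c}. A c k * y k)"
      unfolding True using c by (subst sum.remove[of _ c]) auto
    also have "(\<Sum>k\<in>{..<m} - {c}. A c k * y k) = (\<Sum>k\<in>{..<m} - {c}. - (u k * y k))"
      by (intro sum.cong refl) (auto simp: A_def)
    finally show ?thesis using True by (simp add: sum_negf)
  next
    case False
    have "(\<Sum>k<m. A i k * y k) = (\<Sum>k<m. (if k = i then y i else 0) + (if k = c then - (u i * y c) else 0))"
      by (intro sum.cong refl) (use False in \<open>auto simp: A_def\<close>)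
    thus ?thesis using False c that by (simp add: sum.distrib)
  qed
  have "det ?A = 0"
  proof -
    have "?A *\<^sub>v vec m u = 0\<^sub>v m"
    proof (rule eq_vecI)
      fix i assume "i < dim_vec (0\<^sub>v m :: 'k alg_closure vec)"
      hence i: "i < m" by simp
      have "(?A *\<^sub>v vec m u) $ i = (\<Sum>k<m. A i k * u k)"
        using i by (auto simp: scalar_prod_def lessThan_atLeast0 p_clone intro!: sum.cong)
      also have "\<dots> = 0" unfolding kernel_eq[OF i] using u_c by (simp add: A_def)
      finally show "(?A *\<^sub>v vec m u) $ i = 0\<^sub>v m $ i" using i by simp
    qed simp
    moreover have "vec m u \<noteq> 0\<^sub>v m"
    proof
      assume "vec m u = 0\<^sub>v m"
      hence "vec m u $ c = 0" using c by simp
      thus False using c u_c by simp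
    qed
    ultimately show ?thesis
      unfolding det_0_iff_vec_prod_zero_field[OF carrier] using vec_carrier[of m u] by metis
  qed
  have sym: "?A $$ (i, j) = ?A $$ (j, i)" if "i < m" "j < m" for i j
    using that clone_var_sym[of i j] by simp
  note U_sym = cofactor_symmetric[OF carrier sym]
  have cof_cc: "cofactor ?A c c = 1"
  proof -
    have "mat_delete ?A c c = 1\<^sub>m (m - 1)"
      by (rule eq_matI) (auto simp: mat_delete_def p_clone A_def split: if_splits)
    thus ?thesis by (simp add: cofactor_def)
  qed
  have col: "cofactor ?A j i = u i * cofactor ?A j c" if "i < m" "j < m" for i j
  proof (cases "i = c")
    case True
    thus ?thesis using u_c by simp
  next
    case False
    have "0 = (\<Sum>k<m. ?A $$ (i, k) * cofactor ?A j k)"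
      using cofactor_expansion_row[OF carrier that] \<open>det ?A = 0\<close> by simp
    also have "\<dots> = (\<Sum>k<m. A i k * cofactor ?A j k)"
      by (intro sum.cong refl) (use that in \<open>simp add: p_clone\<close>)
    also have "\<dots> = cofactor ?A j i - u i * cofactor ?A j c"
      using kernel_eq[OF that(1)] False by simp
    finally show ?thesis by simp
  qed
  have cof: "cofactor ?A i j = u i * u j" if "i < m" "j < m" for i j
    using col[OF that(2,1)] col[OF that(1) c(1)] U_sym[of i c] cof_cc by simp
  have grad: "mp_subst to_ac p (pderiv_in x f) = rank_one_point u x" if "x \<in> ?V" for x
    unfolding f eval_pderiv_det[OF comm_ring_hom_to_ac that] rank_one_point_pairing[OF that, symmetric]
    by (intro sum.cong refl) (simp add: cof)
  have V: "(b, b) \<in> ?V" "(c, c) \<in> ?V" using b c ab by (auto simp: set_md_vars tri_pairs_def)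
  have "p \<in> hom_coords ?V"
    unfolding hom_coords_def using V c by (auto simp: p_def A_def intro!: bexI[of _ "(b, b)"])
  moreover have "mp_subst to_ac p f = 0"
    unfolding f eval_det_md_clone[OF comm_ring_hom_to_ac] by (rule \<open>det ?A = 0\<close>)
  moreover have "mp_subst to_ac p (pderiv_in (c, c) f) \<noteq> 0"
    unfolding grad[OF V(2)] using V(2) c u_c by (simp add: rank_one_point_def)
  ultimately have smooth: "p \<in> smooth_points ?V f"
    unfolding smooth_points_def using V(2) by (intro CollectI conjI bexI[of _ "(c, c)"])
  have hom: "rank_one_point v \<in> hom_coords ?V"
    unfolding hom_coords_def using V(2) c v by (auto simp: rank_one_point_def intro!: bexI[of _ "(c, c)"])
  have "rank_one_point v x = (v c)\<^sup>2 * mp_subst to_ac p (pderiv_in x f)" if "x \<in> ?V" for x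
    using rank_one_point_scale[of "v c" u x] v by (simp add: grad[OF that] u_def)
  moreover have "(v c)\<^sup>2 \<noteq> 0" using v by simp
  ultimately show ?thesis unfolding tangent_hyperplanes_def
    by (intro CollectI conjI hom bexI[OF _ smooth] exI[of _ "(v c)\<^sup>2"] ballI)
qed

lemma exists_third_index: "\<exists>c<m. c \<noteq> a \<and> c \<noteq> b"
proof -
  have "card {a, b} < card {..<m}" using m by (auto intro: le_less_trans[OF card_insert_le_m1])
  hence "\<not> {..<m} \<subseteq> {a, b}" by (meson card_mono finite.emptyI finite.insertI not_less)
  thus ?thesis by blast
qed

text \<open>The coordinates at \<open>(i, i)\<close> for \<open>i \<noteq> a\<close> and the one at \<open>{a, b}\<close> take the values \<open>v i * v i\<close>,
  \<open>v a * v a + v b * v b\<close> and \<open>2 * v a * v b\<close> at the tangent hyperplane belonging to \<open>v\<close>. Over an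
  algebraically closed field of characteristic zero, arbitrary nonzero values can be prescribed for
  them, and a nonzero polynomial has a nonroot with nonzero coordinates.\<close>

lemma alg_indep_dual:
  fixes f :: "(nat \<times> nat, 'k::field_char_0) mpoly"
  assumes f: "f = det (md_clone m a b)"
  shows "\<exists>F. alg_indep_on (set (md_vars m a)) (dual_variety (set (md_vars m a)) f) m F"
proof -
  let ?V = "set (md_vars m a)"
  obtain c where c: "c < m" "c \<noteq> a" "c \<noteq> b" using exists_third_index by blast
  define s where "s i = (if i = a then (min a b, max a b) else (i, i))" for i
  define F where "F i = (Var (s i) :: (nat \<times> nat, 'k alg_closure) mpoly)" for i
  have s_V: "s i \<in> ?V" if "i < m" for i
    using that a b ab by (auto simp: s_def set_md_vars tri_pairs_def)
  have "P = 0" if P: "P \<in> polys_in {..<m}"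
    and van: "mp_subst Const F P \<in> vanishing_ideal ?V (dual_variety ?V f)" for P :: "(nat, 'k alg_closure) mpoly"
  proof (rule ccontr)
    assume "P \<noteq> 0"
    hence "\<exists>u. (\<forall>i. u i \<noteq> 0) \<and> (\<forall>p\<in>{P}. mp_subst id u p \<noteq> 0)"
      by (intro finite_family_generic_point[OF infinite_alg_closure]) auto
    then obtain u where u: "\<And>i. u i \<noteq> 0" "mp_subst id u P \<noteq> 0" by auto
    have "\<exists>r. r ^ 2 = z" for z :: "'k alg_closure" using nth_root_exists[of 2 z] by auto
    then obtain sq where sq: "\<And>z :: 'k alg_closure. sq z ^ 2 = z" by metis
    \<comment> \<open>\<open>v a\<close> and \<open>v b\<close> are found from the squares of their sum and difference.\<close>
    define v where "v i = (if i = a then (sq (u b + u a) + sq (u b - u a)) / 2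
      else if i = b then (sq (u b + u a) - sq (u b - u a)) / 2 else sq (u i))" for i
    have ab_sum: "v b * v b + v a * v a = u b" and ab_prod: "2 * (v a * v b) = u a"
    proof -
      define s t where "s = sq (u b + u a)" and "t = sq (u b - u a)"
      have st: "s * s = u b + u a" "t * t = u b - u a"
        using sq[of "u b + u a"] sq[of "u b - u a"] by (simp_all add: s_def t_def power2_eq_square)
      have va: "2 * v a = s + t" and vb: "2 * v b = s - t"
        using ab two_nonzero_alg_closure by (simp_all add: v_def s_def t_def)
      have "2 * 2 * (v b * v b + v a * v a) = (2 * v b) * (2 * v b) + (2 * v a) * (2 * v a)"
        by (simp add: algebra_simps)
      also have "\<dots> = 2 * (s * s) + 2 * (t * t)" unfolding va vb by (simp add: algebra_simps)
      also have "\<dots> = 2 * 2 * u b" unfolding st by (simp add: algebra_simps)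
      finally show "v b * v b + v a * v a = u b" using two_nonzero_alg_closure
        by (metis mult_left_cancel mult_eq_0_iff)
      have "2 * (2 * (v a * v b)) = (2 * v a) * (2 * v b)" by (simp add: algebra_simps)
      also have "\<dots> = s * s - t * t" unfolding va vb by (simp add: algebra_simps)
      also have "\<dots> = 2 * u a" unfolding st by simp
      finally show "2 * (v a * v b) = u a" using two_nonzero_alg_closure
        by (metis mult_left_cancel)
    qed
    have "v c \<noteq> 0" using sq[of "u c"] u(1)[of c] c by (auto simp: v_def)
    hence "rank_one_point v \<in> dual_variety ?V f"
      using rank_one_tangent_hyperplane[OF f c] tangent_hyperplanes_subset_dual by blast
    hence "mp_subst id (rank_one_point v) (mp_subst Const F P) = 0"
      using van by (simp add: vanishing_ideal_def)
    hence "mp_subst id (\<lambda>i. rank_one_point v (s i)) P = 0"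
      by (simp add: eval_substituted F_def mp_subst_Var)
    also have "mp_subst id (\<lambda>i. rank_one_point v (s i)) P = mp_subst id u P"
    proof (rule mp_subst_cong[OF P])
      fix i assume "i \<in> {..<m}"
      hence V: "s i \<in> ?V" by (simp add: s_V)
      consider "i = a" | "i = b" | "i \<noteq> a" "i \<noteq> b" by blast
      thus "rank_one_point v (s i) = u i"
      proof cases
        case 1
        define k l where "k = min a b" and "l = max a b"
        have "k \<noteq> l" "v k * v l = v a * v b"
          using ab by (auto simp: k_def l_def min_def max_def)
        moreover have "s i = (k, l)" using 1 by (simp add: s_def k_def l_def)
        ultimately show ?thesis using V 1 ab_prod by (auto simp: rank_one_point_def)
      next
        case 2
        thus ?thesis using V ab ab_sum by (simp add: rank_one_point_def s_def)
      next
        case 3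
        thus ?thesis using V sq[of "u i"] by (simp add: rank_one_point_def s_def v_def power2_eq_square)
      qed
    qed
    finally show False using u(2) by contradiction
  qed
  moreover have "F i \<in> polys_in ?V" if "i < m" for i
    unfolding F_def by (rule polys_in_Var[OF s_V[OF that]])
  ultimately have "alg_indep_on ?V (dual_variety ?V f) m F"
    unfolding alg_indep_on_def by blast
  thus ?thesis by (rule exI[of _ F])
qed

text \<open>All tangent hyperplanes are parametrized by the \<open>m\<close> coordinates of \<open>v\<close>. Pulled back along this
  parametrization, \<open>m + 1\<close> polynomials are algebraically dependent, and the relation extends to the closure.\<close>

lemma alg_indep_dual_bound:
  fixes f :: "(nat \<times> nat, 'k::field_char_0) mpoly"
  assumes f: "f = det (md_clone m a b)"
    and indep: "alg_indep_on (set (md_vars m a)) (dual_variety (set (md_vars m a)) f) d F"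
  shows "d \<le> m"
proof (rule ccontr)
  let ?V = "set (md_vars m a)"
  assume "\<not> d \<le> m"
  hence d: "Suc m \<le> d" by simp
  have F: "F i \<in> polys_in ?V" if "i \<le> m" for i
    using indep d that by (simp add: alg_indep_on_def)
  define G where "G i = mp_subst Const (rank_one_point Var) (F i)" for i
  have "(rank_one_point Var x :: (nat, 'k alg_closure) mpoly) \<in> polys_in {..<m}" if "x \<in> ?V" for x :: "nat \<times> nat"
  proof -
    have "fst x < m" "snd x < m" using that by (auto simp: set_md_vars tri_pairs_def)
    moreover have "(2 :: (nat, 'k alg_closure) mpoly) \<in> polys_in {..<m}"
    proof -
      have "(1 + 1 :: (nat, 'k alg_closure) mpoly) \<in> polys_in {..<m}" by (intro polys_in_add polys_in_1)
      thus ?thesis by (simp only: one_add_one)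
    qed
    ultimately show ?thesis unfolding rank_one_point_def using a
      by (auto intro!: polys_in_add polys_in_mult polys_in_Var)
  qed
  hence "G i \<in> polys_in {..<m}" if "i \<le> m" for i
    unfolding G_def using F[OF that] by (intro polys_in_subst)
  then obtain P :: "(nat, 'k alg_closure) mpoly" where
    P: "P \<in> polys_in {..<Suc m}" "P \<noteq> 0" "mp_subst Const G P = 0"
    using algebraically_dependent by blast
  have "mp_subst id h (mp_subst Const F P) = 0" if h: "h \<in> tangent_hyperplanes ?V f" for h
  proof -
    obtain v where v: "h = rank_one_point v" using tangent_hyperplane_rank_one[OF f h] by blast
    interpret ev: comm_ring_hom "mp_subst id v :: (nat, 'k alg_closure) mpoly \<Rightarrow> 'k alg_closure"
      by (rule comm_ring_hom_mp_subst[OF comm_ring_hom_id])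
    have "mp_subst id v (rank_one_point Var x) = h x" for x
      by (simp add: v rank_one_point_def ev.hom_add ev.hom_mult ev.hom_numeral mp_subst_Var)
    hence "mp_subst id v (G i) = mp_subst id h (F i)" for i
      by (simp add: G_def eval_substituted)
    hence "mp_subst id h (mp_subst Const F P) = mp_subst id v (mp_subst Const G P)"
      by (simp add: eval_substituted)
    thus ?thesis by (simp add: P(3))
  qed
  moreover have inV: "mp_subst Const F P \<in> polys_in ?V"
    by (rule polys_in_subst[OF P(1)]) (use F in auto)
  ultimately have "mp_subst id h (mp_subst Const F P) = 0" if "h \<in> dual_variety ?V f" for h
    using vanishing_on_proj_closure[OF infinite_alg_closure tangent_hyperplanes_scale inV] that
    unfolding dual_variety_def by blast
  hence "mp_subst Const F P \<in> vanishing_ideal ?V (dual_variety ?V f)"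
    using inV by (simp add: vanishing_ideal_def)
  moreover have "P \<in> polys_in {..<d}" by (rule polys_in_mono[OF P(1)]) (use d in auto)
  ultimately show False using indep P(2) unfolding alg_indep_on_def by blast
qed

lemma expected_multiplicity_md_clone:
  fixes f :: "(nat \<times> nat, 'k::field_char_0) mpoly"
  assumes f: "f = det (md_clone m a b)"
  shows "expected_multiplicity (md_vars m a) f = int (m choose 2) - 2"
proof -
  let ?V = "set (md_vars m a)"
  obtain c where c: "c < m" "c \<noteq> a" "c \<noteq> b" using exists_third_index by blast
  have "rank_one_point (\<lambda>_. 1) \<in> dual_variety ?V f"
    using rank_one_tangent_hyperplane[OF f c, of "\<lambda>_. 1"] tangent_hyperplanes_subset_dual by auto
  hence "dual_variety ?V f \<noteq> {}" by blast
  moreover have "(GREATEST d. \<exists>F. alg_indep_on ?V (dual_variety ?V f) d F) = m"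
    by (rule Greatest_equality) (use alg_indep_dual[OF f] alg_indep_dual_bound[OF f] in auto)
  ultimately have "proj_dim ?V (dual_variety ?V f) = int m - 1" by (simp add: proj_dim_def)
  thus ?thesis using choose_ge_2 by (simp add: expected_multiplicity_def length_md_vars)
qed

end

theorem proposition4p6:
  fixes m a b :: nat and f :: "(nat \<times> nat, 'k::field_char_0) mpoly"
  assumes "m \<ge> 3"
    and "a < m" "b < m" "a \<noteq> b"
    and "f = det (md_clone m a b)"
  shows "dvd_in (set (md_vars m a)) f (hessian_det (md_vars m a) f)
    \<and> expected_multiplicity (md_vars m a) f = int (m choose 2) - 2
    \<and> has_effective_multiplicity (md_vars m a) f ((m choose 2) - 2)"
proof -
  interpret diagonal_cloning m a b
    by unfold_locales (use assms in auto)
  let ?V = "set (md_vars m a)" and ?e = "(m choose 2) - 2"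
  have mult: "has_effective_multiplicity (md_vars m a) f ?e"
    by (rule has_effective_multiplicity_md_clone[OF assms(5)])
  then obtain r where r: "r \<in> polys_in ?V" "hessian_det (md_vars m a) f = f ^ ?e * r"
    unfolding has_effective_multiplicity_def dvd_in_def by blast
  \<comment> \<open>The multiplicity is positive, as \<open>m choose 2 \<ge> 3\<close>.\<close>
  have "3 * 2 \<le> m * (m - 1)" by (rule mult_le_mono) (use assms(1) in auto)
  hence "?e = Suc (?e - 1)" by (simp add: choose_two)
  hence "hessian_det (md_vars m a) f = f * (f ^ (?e - 1) * r)"
    using r(2) by (metis mult.assoc power_Suc)
  moreover have "f ^ (?e - 1) * r \<in> polys_in ?V"
    using r(1) det_md_clone_polys_in unfolding assms(5) by (intro polys_in_mult polys_in_power)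
  ultimately have "dvd_in ?V f (hessian_det (md_vars m a) f)"
    unfolding dvd_in_def by blast
  thus ?thesis using mult expected_multiplicity_md_clone[OF assms(5)] by blast
qed

end
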